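(* Let $n\ge 3$. The group $G$ is generated by $R_1,\dots,R_{n-1}$ and has the presentation $$G=\left\langle R_1,\dots,R_{n-1}\ \middle|\ \begin{array}{l} R_iR_{i+1}R_i=R_{i+1}R_iR_{i+1}\ (1\le i\le n-2),\\ R_iR_j=R_jR_i\ (|i-j|\ge 2),\\ R_1^{2}=R_2R_1^{2}R_2\end{array}\right\rangle .$$
   Context: The hyperoctahedron in $\mathbb{R}^n$ is the polytope with the $2n$ vertices $\pm e_1,\dots,\pm e_n$ ($e_i$ the standard basis vectors). Its rotational symmetry group $G'\subset SO(n)$ consists of the elements of $SO(n)$ that permute these vertices. $G$ is the group of homotopy classes (with fixed end-points) of continuous paths $R:[0,1]\to SO(n)$ with $R(0)=Id$ and $R(1)\in G'$. The product of paths is $(RS)(t)=S(2t)$ for $t<1/2$ and $(RS)(t)=R(2t-1)S(1)$ for $t\ge 1/2$; the inverse of the class of $R$ is the class of $t\mapsto R(t)^{-1}$. For $i\neq j$, $R_{ij}$ is (the class of) the path of rotations from angle $0$ to angle $\pi/2$ in the coordinate plane $ij$, whose end-point sends $e_i\mapsto e_j$, $e_j\mapsto -e_i$ and fixes the other basis vectors. Put $R_i:=R_{i\,i+1}$ for $i=1,\dots,n-1$. *)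

theory Defs
  imports "HOL-Analysis.Analysis" "HOL-Algebra.Generated_Groups"
begin

section \<open>Groups given by generators and relations\<close>

text \<open>
  A word over \<open>S\<close> is a list of letters; \<open>(s, True)\<close> stands for \<open>s\<close> and \<open>(s, False)\<close> for its formal
  inverse. A relation \<open>u = v\<close> is the pair \<open>(u, v)\<close>.
\<close>

type_synonym 'a gword = "('a \<times> bool) list"

definition gwords :: "'a set \<Rightarrow> 'a gword set" where
  "gwords S = lists (S \<times> UNIV)"

text \<open>
  The least congruence on words that contains free cancellation and the relations; its classes
  are the cosets, in the free group on \<open>S\<close>, of the normal closure of the relators.
\<close>

inductive_set pres_cong :: "'a set \<Rightarrow> ('a gword \<times> 'a gword) set \<Rightarrow> ('a gword \<times> 'a gword) set"
  for S :: "'a set" and rels :: "('a gword \<times> 'a gword) set" where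
  refl: "u \<in> gwords S \<Longrightarrow> (u, u) \<in> pres_cong S rels"
| sym: "(u, v) \<in> pres_cong S rels \<Longrightarrow> (v, u) \<in> pres_cong S rels"
| trans: "(u, v) \<in> pres_cong S rels \<Longrightarrow> (v, w) \<in> pres_cong S rels \<Longrightarrow> (u, w) \<in> pres_cong S rels"
| append: "(u, v) \<in> pres_cong S rels \<Longrightarrow> (u', v') \<in> pres_cong S rels
    \<Longrightarrow> (u @ u', v @ v') \<in> pres_cong S rels"
| cancel: "s \<in> S \<Longrightarrow> ([(s, b), (s, \<not> b)], []) \<in> pres_cong S rels"
| rel: "(u, v) \<in> rels \<Longrightarrow> u \<in> gwords S \<Longrightarrow> v \<in> gwords S \<Longrightarrow> (u, v) \<in> pres_cong S rels"

definition presented_group :: "'a set \<Rightarrow> ('a gword \<times> 'a gword) set \<Rightarrow> 'a gword set monoid" where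
  "presented_group S rels =
    \<lparr>carrier = gwords S // pres_cong S rels,
     mult = (\<lambda>A B. pres_cong S rels `` {u @ v | u v. u \<in> A \<and> v \<in> B}),
     one = pres_cong S rels `` {[]}\<rparr>"

definition gen :: "'a \<Rightarrow> 'a gword" where
  "gen s = [(s, True)]"

definition presented_gen :: "'a set \<Rightarrow> ('a gword \<times> 'a gword) set \<Rightarrow> 'a \<Rightarrow> 'a gword set" where
  "presented_gen S rels s = pres_cong S rels `` {gen s}"

lemma gwords_Nil [simp]: "[] \<in> gwords S"
  by (simp add: gwords_def)

lemma gwords_append [simp]: "u @ v \<in> gwords S \<longleftrightarrow> u \<in> gwords S \<and> v \<in> gwords S"
  by (auto simp: gwords_def)

lemma pres_cong_in_gwords: "(u, v) \<in> pres_cong S rels \<Longrightarrow> u \<in> gwords S \<and> v \<in> gwords S"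
  by (induction rule: pres_cong.induct) (auto simp: gwords_def)

lemma equiv_pres_cong: "equiv (gwords S) (pres_cong S rels)"
  by (rule equivI)
    (auto simp: refl_on_def intro!: symI transI
      dest: pres_cong_in_gwords intro: pres_cong.refl pres_cong.sym pres_cong.trans)

lemma presented_mult_class:
  assumes "u \<in> gwords S" "v \<in> gwords S"
  shows "pres_cong S rels `` {u} \<otimes>\<^bsub>presented_group S rels\<^esub> pres_cong S rels `` {v}
    = pres_cong S rels `` {u @ v}"
  using assms
  by (auto simp: presented_group_def)
    (blast intro: pres_cong.append pres_cong.refl pres_cong.trans)+

lemma presented_left_inverse:
  assumes "u \<in> gwords S"
  shows "\<exists>v\<in>gwords S. (v @ u, []) \<in> pres_cong S rels"
  using assms
proof (induction u)
  case Nil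
  then show ?case by (auto intro!: bexI[of _ "[]"] pres_cong.refl)
next
  case (Cons a u)
  obtain s b where a: "a = (s, b)" by (cases a)
  from Cons.prems a have s: "s \<in> S" and u: "u \<in> gwords S" by (auto simp: gwords_def)
  from Cons.IH[OF u] obtain v where v: "v \<in> gwords S" "(v @ u, []) \<in> pres_cong S rels" by blast
  have "([(s, \<not> b), (s, b)], []) \<in> pres_cong S rels"
    using pres_cong.cancel[OF s, of "\<not> b"] by simp
  from pres_cong.append[OF this pres_cong.refl[OF u]]
  have "([(s, \<not> b), (s, b)] @ u, u) \<in> pres_cong S rels" by simp
  from pres_cong.append[OF pres_cong.refl[OF v(1)] this]
  have "(v @ [(s, \<not> b), (s, b)] @ u, v @ u) \<in> pres_cong S rels" .
  then have "((v @ [(s, \<not> b)]) @ a # u, []) \<in> pres_cong S rels"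
    using v(2) a by (auto intro: pres_cong.trans)
  moreover have "v @ [(s, \<not> b)] \<in> gwords S" using v s by (auto simp: gwords_def)
  ultimately show ?case by blast
qed

lemma group_presented_group: "group (presented_group S rels)"
proof -
  let ?G = "presented_group S rels"
  let ?c = "\<lambda>u. pres_cong S rels `` {u}"
  have car: "carrier ?G = ?c ` gwords S"
    by (auto simp: presented_group_def quotient_def)
  have one: "\<one>\<^bsub>?G\<^esub> = ?c []"
    by (simp add: presented_group_def)
  show ?thesis
  proof (rule groupI)
    fix x assume "x \<in> carrier ?G"
    then obtain u where u: "u \<in> gwords S" "x = ?c u" by (auto simp: car)
    from presented_left_inverse[OF u(1)] obtain v
      where v: "v \<in> gwords S" "(v @ u, []) \<in> pres_cong S rels" by blast
    have "?c v \<otimes>\<^bsub>?G\<^esub> x = \<one>\<^bsub>?G\<^esub>"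
      using u v by (simp add: presented_mult_class one equiv_class_eq[OF equiv_pres_cong])
    then show "\<exists>y\<in>carrier ?G. y \<otimes>\<^bsub>?G\<^esub> x = \<one>\<^bsub>?G\<^esub>"
      using v by (auto simp: car)
  qed (auto simp: car one presented_mult_class)
qed

section \<open>Rotations of the hyperoctahedron\<close>

definition SO :: "(real^'n^'n) set" where
  "SO = {A. rotation_matrix A}"

definition hyperoct_vertices :: "(real^'n) set" where
  "hyperoct_vertices = range (\<lambda>i. axis i 1) \<union> range (\<lambda>i. - axis i 1)"

definition hyperoct_rotations :: "(real^'n^'n) set" where
  "hyperoct_rotations = {A \<in> SO. bij_betw ((*v) A) hyperoct_vertices hyperoct_vertices}"

section \<open>The group of homotopy classes of paths\<close>

text \<open>
  Paths are functions on \<open>real\<close> of which only the restriction to the unit interval matters;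
  \<^const>\<open>homotopic_paths\<close> is homotopy with fixed end-points and ignores the values outside it.
\<close>

definition SO_path_class :: "(real \<Rightarrow> real^'n^'n) \<Rightarrow> (real \<Rightarrow> real^'n^'n) set" where
  "SO_path_class p = {q. homotopic_paths SO p q}"

definition hyperoct_paths :: "(real \<Rightarrow> real^'n^'n) set" where
  "hyperoct_paths = {p. path p \<and> path_image p \<subseteq> SO \<and> pathstart p = mat 1
     \<and> pathfinish p \<in> hyperoct_rotations}"

definition path_mult :: "(real \<Rightarrow> real^'n^'n) \<Rightarrow> (real \<Rightarrow> real^'n^'n) \<Rightarrow> real \<Rightarrow> real^'n^'n" where
  "path_mult R S = (\<lambda>t. if t < 1/2 then S (2 * t) else R (2 * t - 1) ** S 1)"

definition hyperoct_path_group :: "(real \<Rightarrow> real^'n^'n) set monoid" where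
  "hyperoct_path_group =
    \<lparr>carrier = SO_path_class ` hyperoct_paths,
     mult = (\<lambda>A B. \<Union>R\<in>A. \<Union>S\<in>B. SO_path_class (path_mult R S)),
     one = SO_path_class (\<lambda>t. mat 1)\<rparr>"

text \<open>Column \<open>l\<close> of the matrix is the image of the basis vector \<open>axis l 1\<close>.\<close>

definition plane_rotation :: "'n \<Rightarrow> 'n \<Rightarrow> real \<Rightarrow> real^'n^'n" where
  "plane_rotation i j \<theta> = (\<chi> k l.
     if l = i then (if k = i then cos \<theta> else if k = j then sin \<theta> else 0)
     else if l = j then (if k = i then - sin \<theta> else if k = j then cos \<theta> else 0)
     else if k = l then 1 else 0)"

definition R_path :: "'n \<Rightarrow> 'n \<Rightarrow> real \<Rightarrow> real^'n^'n" where
  "R_path i j = (\<lambda>t. plane_rotation i j (t * (pi / 2)))"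

lemma plane_rotation_axis:
  fixes i j :: "'n::finite"
  assumes "i \<noteq> j"
  shows "plane_rotation i j \<theta> *v axis i 1 = cos \<theta> *\<^sub>R axis i 1 + sin \<theta> *\<^sub>R axis j 1"
    and "plane_rotation i j \<theta> *v axis j 1 = - sin \<theta> *\<^sub>R axis i 1 + cos \<theta> *\<^sub>R axis j 1"
    and "l \<noteq> i \<Longrightarrow> l \<noteq> j \<Longrightarrow> plane_rotation i j \<theta> *v axis l 1 = axis l 1"
  using assms unfolding matrix_vector_mult_basis column_def
  by (auto simp: plane_rotation_def vec_eq_iff axis_def)

text \<open>\<open>e\<close> enumerates the coordinates as \<open>e 1, ..., e n\<close>.\<close>

definition R_gen :: "(nat \<Rightarrow> 'n) \<Rightarrow> nat \<Rightarrow> (real \<Rightarrow> real^'n^'n) set" where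
  "R_gen e i = SO_path_class (R_path (e i) (e (i + 1)))"

definition hyperoct_rels :: "nat \<Rightarrow> (nat gword \<times> nat gword) set" where
  "hyperoct_rels n =
     {(gen i @ gen (i + 1) @ gen i, gen (i + 1) @ gen i @ gen (i + 1)) | i. 1 \<le> i \<and> i \<le> n - 2}
   \<union> {(gen i @ gen j, gen j @ gen i) | i j.
        i \<in> {1..n - 1} \<and> j \<in> {1..n - 1} \<and> \<bar>int i - int j\<bar> \<ge> 2}
   \<union> {(gen 1 @ gen 1, gen 2 @ gen 1 @ gen 1 @ gen 2)}"

end

theory Submission
  imports Defs
begin

text \<open>
  All homotopy theory is reduced to one lifting lemma: a map \<open>h\<close> from a compact star-shaped set to a
  coordinate sphere with \<open>h 0 = axis k 1\<close> is \<open>x \<mapsto> A x *v axis k 1\<close> for a continuous \<open>A\<close>, obtained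
  by subdividing rays and composing the rotations in the plane of two nearby unit vectors.
  These elementary rotations are products of two reflections and therefore lift to the spin group, so
  by induction on the number of moving coordinates every map from a square into the orthogonal
  group lifts. As the full turn lifts to a path from \<open>1\<close> to \<open>-1\<close>, it is not null-homotopic.
  Since spheres of dimension at least \<open>2\<close> are simply connected, the same lemma deforms any loop
  into the rotations of one coordinate plane, where it is a power of the full turn.

  Pointwise multiplication of paths computes the product in the path group, and
  \<open>[p] [q] [p]\<inverse> = [p(1) q p(1)\<inverse>]\<close>, which gives the relations. Conversely, in any group with these
  relations all \<open>r\<^sub>i\<^sup>4\<close> are one central element \<open>z\<close> with \<open>z\<^sup>2 = 1\<close>, and the stabilizer chain of the
  vertices \<open>e\<^sub>n, e\<^sub>n\<^sub>-\<^sub>1, \<dots>\<close> shows that only \<open>1\<close> and \<open>z\<close> act trivially. As \<open>z\<close> becomes the full turn,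
  the presented group embeds.
\<close>

subsection \<open>Clifford matrices\<close>

text \<open>The relations bound the presented group from above: an element that acts trivially on
  the vertices is \<open>1\<close> or \<open>z\<close>. Algebra cannot decide whether
  \<open>z\<close> collapses, and the double cover is needed for exactly this one bit. In the other
  direction, generation needs that loops contribute nothing beyond powers of the full turn.

  The spin group is realised by real matrices indexed by the subsets of the coordinates, so that
  lifts are ordinary continuous matrix functions. This representation is far from irreducible: a
  matrix that commutes with the Clifford generators alone need not be scalar. The second
  anticommuting family \<open>del\<close> removes this freedom and makes lifts unique up to sign.

  Determinants are kept out of the lifting arguments. The inductions over the moving coordinates
  take place in the orthogonal group, and connectedness of the parameter space leads back to
  \<open>SO\<close>.\<close>

definition flip :: "'a \<Rightarrow> 'a set \<Rightarrow> 'a set" where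
  "flip i S = (if i \<in> S then S - {i} else insert i S)"

lemma flip_flip [simp]: "flip i (flip i S) = S"
  by (auto simp: flip_def)

lemma flip_commute: "flip i (flip j S) = flip j (flip i S)"
  by (auto simp: flip_def)

lemma mem_flip [simp]: "j \<in> flip i S \<longleftrightarrow> (j \<in> S) \<noteq> (j = i)"
  by (auto simp: flip_def)

text \<open>The Jordan-Wigner string: minus one to the number of elements of \<open>S\<close> before
  \<open>i\<close>, in the order that \<open>to_nat\<close> induces on the index type. It turns the
  commuting flips into anticommuting matrices.\<close>

definition jw_sign :: "'n::finite \<Rightarrow> 'n set \<Rightarrow> real" where
  "jw_sign i S = (\<Prod>j\<in>{j. to_nat j < to_nat i}. if j \<in> S then -1 else 1)"

lemma jw_sign_square [simp]: "jw_sign i S * jw_sign i S = 1"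
  by (auto simp: jw_sign_def simp flip: prod.distrib intro!: prod.neutral)

text \<open>Of two distinct indices exactly one precedes the other, so exchanging two flips changes
  exactly one of the two signs. This is the source of anticommutation for distinct indices.\<close>

lemma jw_sign_flip:
  "jw_sign i (flip j S) = (if to_nat j < to_nat i then - 1 else 1) * jw_sign i S"
proof -
  have "jw_sign i (flip j S)
      = (\<Prod>l\<in>{l. to_nat l < to_nat i}. (if l = j then -1 else 1) * (if l \<in> S then -1 else 1))"
    unfolding jw_sign_def by (intro prod.cong) auto
  also have "\<dots> = (\<Prod>l\<in>{l. to_nat l < to_nat i}. (if l = j then -1 else 1)) * jw_sign i S"
    by (simp add: prod.distrib jw_sign_def)
  also have "(\<Prod>l\<in>{l. to_nat l < to_nat i}. (if l = j then -1 else 1::real)) =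
      (if to_nat j < to_nat i then -1 else 1)"
    by (simp add: prod.delta)
  finally show ?thesis .
qed

text \<open>\<open>gam\<close> and \<open>del\<close> are the Jordan--Wigner matrices, acting on functions of the subsets of the
  index set: the \<open>gam i\<close> generate the Clifford algebra with \<open>(gam i)\<^sup>2 = 1\<close>, and the \<open>del i\<close>
  anticommute with all of them.\<close>

definition par :: "'n \<Rightarrow> 'n set \<Rightarrow> real" where
  "par i S = (if i \<in> S then -1 else 1)"

definition gam :: "'n::finite \<Rightarrow> real^('n set)^('n set)" where
  "gam i = (\<chi> S S'. if S' = flip i S then jw_sign i S else 0)"

definition del :: "'n::finite \<Rightarrow> real^('n set)^('n set)" where
  "del i = (\<chi> S S'. if S' = flip i S then jw_sign i S * par i S else 0)"

lemma gam_mult_nth: "(gam i ** M) $ S $ S' = jw_sign i S * M $ (flip i S) $ S'"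
  by (simp add: matrix_matrix_mult_def gam_def if_distrib [of "\<lambda>x. x * _"] cong: if_cong)

lemma del_mult_nth: "(del i ** M) $ S $ S' = jw_sign i S * par i S * M $ (flip i S) $ S'"
  by (simp add: matrix_matrix_mult_def del_def if_distrib [of "\<lambda>x. x * _"] cong: if_cong)

lemma mult_gam_nth: "(M ** gam i) $ S $ S' = M $ S $ (flip i S') * jw_sign i (flip i S')"
proof -
  have "S' = flip i k \<longleftrightarrow> k = flip i S'" for k
    by (metis flip_flip)
  then show ?thesis
    by (simp add: matrix_matrix_mult_def gam_def if_distrib [of "\<lambda>x. _ * x"] cong: if_cong)
qed

lemma mult_del_nth: "(M ** del i) $ S $ S' = M $ S $ (flip i S') * (jw_sign i (flip i S') * par i (flip i S'))"
proof -
  have "S' = flip i k \<longleftrightarrow> k = flip i S'" for k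
    by (metis flip_flip)
  then show ?thesis
    by (simp add: matrix_matrix_mult_def del_def if_distrib [of "\<lambda>x. _ * x"] cong: if_cong)
qed

lemma gam_nth: "gam i $ S $ S' = (if S' = flip i S then jw_sign i S else 0)"
  by (simp add: gam_def)

lemma del_nth: "del i $ S $ S' = (if S' = flip i S then jw_sign i S * par i S else 0)"
  by (simp add: del_def)

lemma gam_square: "gam i ** gam i = mat 1"
  by (simp add: vec_eq_iff gam_mult_nth) (auto simp: gam_nth jw_sign_flip mat_def)

lemma gam_anticommute: "i \<noteq> j \<Longrightarrow> gam i ** gam j + gam j ** gam i = 0"
  by (simp add: vec_eq_iff gam_mult_nth)
    (auto simp: gam_nth jw_sign_flip mat_def flip_commute)

text \<open>For \<open>i = j\<close> the sign comes from \<open>par\<close>, which changes under the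
  flip at \<open>i\<close>; otherwise it comes from \<open>jw_sign\<close>, as for two matrices
  \<open>gam\<close>.\<close>

lemma gam_del_anticommute: "gam i ** del j + del j ** gam i = 0"
  by (simp add: vec_eq_iff gam_mult_nth del_mult_nth)
    (auto simp: del_nth gam_nth jw_sign_flip mat_def flip_commute par_def split: if_splits)

lemma transpose_gam: "transpose (gam i) = gam i"
proof -
  have "S = flip i S' \<longleftrightarrow> S' = flip i S" for S S'
    by (metis flip_flip)
  then show ?thesis
  by (auto simp: vec_eq_iff transpose_def gam_nth jw_sign_flip)
qed

text \<open>The product \<open>gam i ** del i\<close> is diagonal, and its entries 1 and -1 tell
  whether \<open>i\<close> lies in the indexing subset; commuting with all these products forces a
  diagonal matrix. Commuting with \<open>gam i\<close> then equates the diagonal entries at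
  \<open>S\<close> and \<open>flip i S\<close>, and flips connect every subset with the empty
  one.\<close>

lemma commute_gam_del_scalar:
  fixes M :: "real^('n::finite set)^('n set)"
  assumes g: "\<And>i. M ** gam i = gam i ** M" and d: "\<And>i. M ** del i = del i ** M"
  shows "\<exists>c. M = c *\<^sub>R mat 1"
proof -
  have diag: "M $ S $ S' = 0" if ne: "S \<noteq> S'" for S S'
  proof -
    obtain i where i: "(i \<in> S) \<noteq> (i \<in> S')"
      using ne by blast
    have "M ** gam i ** del i = gam i ** del i ** M"
      by (metis g d matrix_mul_assoc)
    then have "(M ** gam i ** del i) $ S $ S' = (gam i ** (del i ** M)) $ S $ S'"
      by (simp add: matrix_mul_assoc)
    then have "M $ S $ S' * par i (flip i S') = M $ S $ S' * par i (flip i S)"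
      by (simp add: mult_gam_nth mult_del_nth gam_mult_nth del_mult_nth jw_sign_flip
         flip: mult.assoc)
    then show ?thesis
      using i by (auto simp: par_def split: if_splits)
  qed
  have fl: "M $ (flip i S) $ (flip i S) = M $ S $ S" for i S
  proof -
    have "(M ** gam i) $ S $ (flip i S) = (gam i ** M) $ S $ (flip i S)"
      by (simp add: g)
    then have "M $ S $ S * jw_sign i S = M $ (flip i S) $ (flip i S) * jw_sign i S"
      by (simp add: mult_gam_nth gam_mult_nth mult.commute)
    then show ?thesis
      by (metis jw_sign_square mult_cancel_right mult_zero_right zero_neq_one)
  qed
  have "M $ S $ S = M $ {} $ {}" for S
  proof (induction S rule: finite_induct [OF finite_class.finite])
    case (2 x F)
    then have "insert x F = flip x F" by (simp add: flip_def)
    with 2 fl show ?case by metis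
  qed auto
  with diag have "M = (M $ {} $ {}) *\<^sub>R mat 1"
    by (auto simp: vec_eq_iff mat_def)
  then show ?thesis ..
qed

section \<open>Continuity of the matrix operations\<close>

lemma bounded_bilinear_matrix_mult:
  "bounded_bilinear ((**) :: real^'n^'m \<Rightarrow> real^'p^'n \<Rightarrow> real^'p^'m)"
  unfolding bilinear_conv_bounded_bilinear [symmetric] bilinear_def
  by (auto intro!: linearI simp: vec_eq_iff matrix_matrix_mult_def algebra_simps sum.distrib sum_distrib_left)

interpretation mm: bounded_bilinear "(**) :: real^'n^'m \<Rightarrow> real^'p^'n \<Rightarrow> real^'p^'m"
  by (rule bounded_bilinear_matrix_mult)

lemma continuous_on_matrix_mult [continuous_intros]:
  fixes f :: "'a::topological_space \<Rightarrow> real^'n^'m" and g :: "'a \<Rightarrow> real^'p^'n"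
  assumes "continuous_on S f" "continuous_on S g"
  shows "continuous_on S (\<lambda>x. f x ** g x)"
  using mm.continuous_on [OF assms] .

lemma continuous_on_matrix_vector_mult' [continuous_intros]:
  fixes f :: "'a::topological_space \<Rightarrow> real^'n^'m" and g :: "'a \<Rightarrow> real^'n"
  assumes "continuous_on S f" "continuous_on S g"
  shows "continuous_on S (\<lambda>x. f x *v g x)"
  unfolding matrix_vector_mult_def
  by (intro continuous_intros continuous_on_vec_lambda assms continuous_on_component)

lemma continuous_on_transpose [continuous_intros]:
  fixes f :: "'a::topological_space \<Rightarrow> real^'n^'m"
  assumes "continuous_on S f"
  shows "continuous_on S (\<lambda>x. transpose (f x))"
  unfolding transpose_def
  by (intro continuous_on_vec_lambda continuous_on_component assms)

lemma orthogonal_matrix_transpose_mult: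
  fixes A :: "real^'n^'n"
  assumes "orthogonal_matrix A"
  shows "transpose A ** A = mat 1" "A ** transpose A = mat 1"
  using assms by (auto simp: orthogonal_matrix_def)

section \<open>Vectors in the Clifford algebra and their reflections\<close>

definition gamv :: "real^'n::finite \<Rightarrow> real^('n set)^('n set)" where
  "gamv v = (\<Sum>i\<in>UNIV. v $ i *\<^sub>R gam i)"

lemma linear_gamv: "linear gamv"
  by (rule linearI) (simp_all add: gamv_def scaleR_left_distrib sum.distrib scaleR_sum_right)

lemma gamv_axis [simp]: "gamv (axis i 1) = gam i"
  by (simp add: gamv_def axis_def if_distrib [of "\<lambda>x. x *\<^sub>R _"] cong: if_cong)

lemma continuous_on_gamv [continuous_intros]:
  "continuous_on S f \<Longrightarrow> continuous_on S (\<lambda>x. gamv (f x))"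
  unfolding gamv_def by (intro continuous_intros)

lemma clifford: "gamv u ** gamv v + gamv v ** gamv u = (2 * (u \<bullet> v)) *\<^sub>R mat 1"
proof -
  have gg: "gam i ** gam j + gam j ** gam i = (if i = j then 2 *\<^sub>R mat 1 else 0)" for i j :: 'a
    using gam_anticommute [of i j] by (auto simp: gam_square scaleR_2)
  have "gamv u ** gamv v + gamv v ** gamv u
      = (\<Sum>i\<in>UNIV. \<Sum>j\<in>UNIV. (v $ j * u $ i) *\<^sub>R (gam i ** gam j + gam j ** gam i))"
  proof -
    have 1: "gamv u ** gamv v = (\<Sum>i\<in>UNIV. \<Sum>j\<in>UNIV. (v $ j * u $ i) *\<^sub>R (gam i ** gam j))" for u v :: "real^'a"
      unfolding gamv_def mm.sum_left by (simp add: mm.sum_right mm.scaleR_left mm.scaleR_right scaleR_sum_right mult.commute)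
    have 2: "(\<Sum>i\<in>UNIV. \<Sum>j\<in>UNIV. (u $ j * v $ i) *\<^sub>R (gam i ** gam j))
        = (\<Sum>i\<in>UNIV. \<Sum>j\<in>UNIV. (v $ j * u $ i) *\<^sub>R (gam j ** gam i))"
      by (subst sum.swap) (simp add: mult.commute)
    show ?thesis
      unfolding 1 [of u v] 1 [of v u] 2 by (simp only: sum.distrib scaleR_right_distrib)
  qed
  also have "\<dots> = (\<Sum>i\<in>UNIV. (2 * (u $ i * v $ i)) *\<^sub>R mat 1)"
  proof -
    have "(v $ j * u $ i) *\<^sub>R (gam i ** gam j + gam j ** gam i)
        = (if i = j then (2 * (u $ i * v $ i)) *\<^sub>R mat 1 else 0)" for i j
      by (simp only: gg) (simp add: mult.commute)
    then show ?thesis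
      by simp
  qed
  also have "\<dots> = (2 * (u \<bullet> v)) *\<^sub>R mat 1"
    by (simp add: inner_vec_def sum_distrib_left scaleR_sum_left)
  finally show ?thesis .
qed

lemma gamv_square: "gamv u ** gamv u = (u \<bullet> u) *\<^sub>R mat 1"
proof -
  have "2 *\<^sub>R (gamv u ** gamv u) = 2 *\<^sub>R ((u \<bullet> u) *\<^sub>R mat 1)"
    using clifford [of u u] unfolding scaleR_2 scaleR_scaleR [symmetric] .
  then show ?thesis
    by (simp only: scaleR_cancel_left) simp
qed

lemma gamv_del: "gamv v ** del i = - (del i ** gamv v)"
proof -
  have "gam j ** del i = - (del i ** gam j)" for j
    using gam_del_anticommute [of j i] by (simp add: add_eq_0_iff2)
  then show ?thesis
    by (simp add: gamv_def mm.sum_left mm.sum_right mm.scaleR_left mm.scaleR_right sum_negf)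
qed

lemma transpose_gamv: "transpose (gamv v) = gamv v"
proof -
  have "gam i $ S $ S' = gam i $ S' $ S" for i S S'
    using arg_cong [OF transpose_gam, of "\<lambda>M. M $ S' $ S" i] by (simp add: transpose_def)
  then have "(\<Sum>i\<in>UNIV. v $ i * gam i $ S $ S') = (\<Sum>i\<in>UNIV. v $ i * gam i $ S' $ S)" for S S'
    by (intro sum.cong HOL.refl arg_cong2 [where f = "(*)"])
  then show ?thesis
    by (simp add: gamv_def transpose_def vec_eq_iff)
qed

text \<open>The reflection in the hyperplane orthogonal to \<open>u\<close>, written for vectors of
  any length so that a sum \<open>x + y\<close> can be inserted without normalising it.\<close>

definition reflm :: "real^'n \<Rightarrow> real^'n^'n" where
  "reflm u = mat 1 - (2 / (u \<bullet> u)) *\<^sub>R (\<chi> i j. u $ i * u $ j)"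

lemma reflm_mult_vec: "reflm u *v v = v - (2 * (u \<bullet> v) / (u \<bullet> u)) *\<^sub>R u"
proof -
  have "(\<chi> i j. u $ i * u $ j) *v v = (u \<bullet> v) *\<^sub>R u"
    by (simp add: vec_eq_iff matrix_vector_mult_def inner_vec_def sum_distrib_right sum_distrib_left mult_ac)
  then show ?thesis
    by (simp add: reflm_def matrix_vector_mult_diff_rdistrib scaleR_matrix_vector_assoc [symmetric])
qed

lemma transpose_reflm: "transpose (reflm u) = reflm u"
  by (simp add: reflm_def transpose_def vec_eq_iff mat_def mult.commute)

lemma reflm_square: "u \<noteq> 0 \<Longrightarrow> reflm u ** reflm u = mat 1"
  by (simp add: matrix_eq matrix_vector_mul_assoc [symmetric] reflm_mult_vec inner_diff_right)

lemma orthogonal_reflm: "u \<noteq> 0 \<Longrightarrow> orthogonal_matrix (reflm u)"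
  by (simp add: orthogonal_matrix transpose_reflm reflm_square)

lemma continuous_on_reflm [continuous_intros]:
  assumes "continuous_on S f" "\<And>x. x \<in> S \<Longrightarrow> f x \<noteq> 0"
  shows "continuous_on S (\<lambda>x. reflm (f x))"
  unfolding reflm_def using assms
  by (intro continuous_intros continuous_on_vec_lambda continuous_on_component) auto

text \<open>Conjugation by a vector is minus the reflection in its hyperplane. The sign disappears
  in products of two vectors, from which all lifts are built.\<close>

lemma gamv_reflm:
  assumes "u \<noteq> 0"
  shows "gamv u ** gamv v = - (gamv (reflm u *v v) ** gamv u)"
proof -
  have "gamv (reflm u *v v) ** gamv u = gamv v ** gamv u - (2 * (u \<bullet> v)) *\<^sub>R mat 1"
    using assms by (simp add: reflm_mult_vec linear_diff [OF linear_gamv] linear_scale [OF linear_gamv]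
       mm.diff_left mm.scaleR_left gamv_square)
  moreover have "gamv u ** gamv v = (2 * (u \<bullet> v)) *\<^sub>R mat 1 - gamv v ** gamv u"
    using clifford [of u v] by (metis add_diff_cancel_right')
  ultimately show ?thesis
    by simp
qed

text \<open>The second components of \<open>spin\<close> over \<open>A\<close> are the two elements \<open>\<plusminus>s\<close> of the spin group over \<open>A\<close>;
  commuting with all \<open>del i\<close> cuts the even Clifford algebra out of all matrices.\<close>

definition spin :: "((real^'n^'n) \<times> (real^('n set)^('n::finite set))) set" where
  "spin = {(A, s). orthogonal_matrix s \<and> (\<forall>v. s ** gamv v = gamv (A *v v) ** s)
     \<and> (\<forall>i. s ** del i = del i ** s)}"

lemma spin_one: "(mat 1, mat 1) \<in> spin"
  by (simp add: spin_def orthogonal_matrix_id)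

lemma intertwine_mult:
  fixes s :: "'a::semiring_1^'n^'n"
  assumes "s ** G' = G'' ** s" "t ** G = G' ** t"
  shows "s ** t ** G = G'' ** (s ** t)"
proof -
  have "s ** t ** G = s ** G' ** t"
    by (simp add: assms(2) flip: matrix_mul_assoc)
  then show ?thesis
    by (simp add: assms(1) matrix_mul_assoc)
qed

lemma spin_mult:
  assumes "(A, s) \<in> spin" "(B, t) \<in> spin"
  shows "(A ** B, s ** t) \<in> spin"
proof -
  have "s ** t ** gamv v = gamv ((A ** B) *v v) ** (s ** t)" for v
    using assms
    by (intro intertwine_mult [where G' = "gamv (B *v v)"])
      (auto simp: spin_def matrix_vector_mul_assoc [symmetric])
  moreover have "s ** t ** del i = del i ** (s ** t)" for i
    using assms by (intro intertwine_mult [where G' = "del i"]) (auto simp: spin_def)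
  ultimately show ?thesis
    using assms by (simp add: spin_def orthogonal_matrix_mul)
qed

lemma spin_minus: "(A, s) \<in> spin \<Longrightarrow> (A, - s) \<in> spin"
proof -
  assume "(A, s) \<in> spin"
  moreover have "transpose (- s) = - transpose s"
    by (simp add: transpose_def vec_eq_iff)
  ultimately show ?thesis
    by (simp add: spin_def mm.minus_left mm.minus_right orthogonal_matrix)
qed

text \<open>A Schur argument: \<open>transpose s ** t\<close> commutes with every
  \<open>gam i\<close> and \<open>del i\<close>, hence is a scalar \<open>c\<close>, and
  orthogonality leaves only \<open>c = 1\<close> and \<open>c = -1\<close>.\<close>

lemma spin_unique:
  assumes s: "(A, s) \<in> spin" and t: "(A, t) \<in> spin"
  shows "t = s \<or> t = - s"
proof -
  have os: "orthogonal_matrix s" and ot: "orthogonal_matrix t"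
    using assms by (auto simp: spin_def)
  note inv = orthogonal_matrix_transpose_mult [OF os]
  define u where "u = transpose s ** t"
  have comm: "u ** G = G ** u" if "s ** G = H ** s" "t ** G = H ** t" for G H
  proof -
    have "transpose s ** H = transpose s ** (H ** s) ** transpose s"
      by (simp add: inv flip: matrix_mul_assoc)
    also have "\<dots> = (transpose s ** s) ** G ** transpose s"
      by (simp add: matrix_mul_assoc flip: that(1))
    finally have "transpose s ** H = G ** transpose s"
      by (simp add: inv)
    then show ?thesis
      unfolding u_def using that(2) by (rule intertwine_mult)
  qed
  have "u ** gam i = gam i ** u" for i
    using s t by (intro comm [where H = "gamv (A *v axis i 1)"]) (auto simp: spin_def simp flip: gamv_axis)
  moreover have "u ** del i = del i ** u" for i
    using s t by (intro comm [where H = "del i"]) (auto simp: spin_def)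
  ultimately obtain c where c: "u = c *\<^sub>R mat 1"
    using commute_gam_del_scalar by blast
  have "orthogonal_matrix u"
    unfolding u_def using os ot by (simp add: orthogonal_matrix_mul orthogonal_matrix_transpose)
  then have "(c * c) *\<^sub>R (mat 1 :: real^('a set)^('a set)) = mat 1"
    unfolding c orthogonal_matrix by (simp add: transpose_scalar transpose_mat mm.scaleR_left mm.scaleR_right)
  then have "c * c = 1"
    by (auto simp: vec_eq_iff mat_def split: if_splits)
  then have "c = 1 \<or> c = -1"
    by (simp add: square_eq_1_iff)
  moreover have "t = s ** u"
    unfolding u_def by (simp add: matrix_mul_assoc inv)
  ultimately show ?thesis
    using c by (auto simp: mm.minus_right)
qed

text \<open>For unit vectors this is the rotation in their plane that takes \<open>x\<close> to
  \<open>y\<close>: the first reflection sends \<open>x\<close> to \<open>- x\<close>, the second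
  sends \<open>- x\<close> to \<open>y\<close>. It depends continuously on both vectors as long as
  they are not antipodal.\<close>

definition turn :: "real^'n \<Rightarrow> real^'n \<Rightarrow> real^'n^'n" where
  "turn x y = reflm (x + y) ** reflm x"

text \<open>An element of the spin group over \<open>turn x y\<close> when \<open>x\<close> is a
  unit vector; then only \<open>x + y\<close> has to be normalised.\<close>

definition turn_lift :: "real^'n::finite \<Rightarrow> real^'n \<Rightarrow> real^('n set)^('n set)" where
  "turn_lift x y = (1 / norm (x + y)) *\<^sub>R (gamv (x + y) ** gamv x)"

lemma turn_mult_vec:
  assumes "norm x = 1" "norm y = 1" "x + y \<noteq> 0"
  shows "turn x y *v x = y"
proof -
  have "x \<bullet> x = 1" "y \<bullet> y = 1"
    using assms by (auto simp: norm_eq_1)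
  then have "2 * ((x + y) \<bullet> x) = (x + y) \<bullet> (x + y)"
    by (simp add: inner_add_left inner_add_right inner_commute)
  then have "2 * ((x + y) \<bullet> x) / ((x + y) \<bullet> (x + y)) = 1"
    using assms(3) by (metis divide_self inner_eq_zero_iff)
  then have B: "2 * ((x + y) \<bullet> (- x)) / ((x + y) \<bullet> (x + y)) = -1"
    by (simp only: inner_minus_right mult_minus_right minus_divide_left [symmetric])
  have A: "reflm x *v x = - x"
    using \<open>x \<bullet> x = 1\<close> by (simp add: reflm_mult_vec) (simp add: scaleR_2)
  show ?thesis
    unfolding turn_def matrix_vector_mul_assoc [symmetric] A reflm_mult_vec [of "x + y"] B by simp
qed

lemma reflm_scaleR: "c \<noteq> 0 \<Longrightarrow> reflm (c *\<^sub>R u) = reflm u"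
  by (simp add: matrix_eq reflm_mult_vec)

lemma turn_same [simp]: "x \<noteq> 0 \<Longrightarrow> turn x x = mat 1"
proof -
  assume "x \<noteq> 0"
  moreover have "reflm (x + x) = reflm x"
    using reflm_scaleR [of 2 x] by (simp add: scaleR_2)
  ultimately show ?thesis
    by (simp add: turn_def reflm_square)
qed

lemma turn_fixes:
  assumes "x \<bullet> z = 0" "y \<bullet> z = 0"
  shows "turn x y *v z = z"
  using assms unfolding turn_def matrix_vector_mul_assoc [symmetric]
  by (simp add: reflm_mult_vec inner_add_left)

lemma orthogonal_turn: "x \<noteq> 0 \<Longrightarrow> x + y \<noteq> 0 \<Longrightarrow> orthogonal_matrix (turn x y)"
  by (simp add: turn_def orthogonal_matrix_mul orthogonal_reflm)

text \<open>Each vector contributes one minus sign, in the conjugation formula as well as in passing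
  a \<open>del i\<close>; with two vectors the signs cancel.\<close>

lemma spin_reflections:
  assumes "norm u = 1" "norm x = 1"
  shows "(reflm u ** reflm x, gamv u ** gamv x) \<in> spin"
proof -
  have x: "x \<noteq> 0" "x \<bullet> x = 1" and u: "u \<noteq> 0" "u \<bullet> u = 1"
    using assms by (auto simp: norm_eq_1)
  have "orthogonal_matrix (gamv v)" if "v \<bullet> v = 1" for v :: "real^'a"
    using that by (simp add: orthogonal_matrix transpose_gamv gamv_square)
  then have "orthogonal_matrix (gamv u ** gamv x)"
    using x u by (simp add: orthogonal_matrix_mul)
  moreover have "gamv u ** gamv x ** gamv v = gamv ((reflm u ** reflm x) *v v) ** (gamv u ** gamv x)" for v
  proof -
    have "gamv u ** gamv x ** gamv v = - (gamv u ** gamv (reflm x *v v) ** gamv x)"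
      by (simp add: gamv_reflm [OF x(1), of v] mm.minus_right flip: matrix_mul_assoc)
    also have "\<dots> = gamv (reflm u *v (reflm x *v v)) ** (gamv u ** gamv x)"
      by (simp add: gamv_reflm [OF u(1), of "reflm x *v v"] mm.minus_left matrix_mul_assoc)
    finally show ?thesis
      by (simp add: matrix_vector_mul_assoc)
  qed
  moreover have "gamv u ** gamv x ** del i = del i ** (gamv u ** gamv x)" for i
  proof -
    have "gamv u ** gamv x ** del i = - (gamv u ** del i ** gamv x)"
      by (simp add: gamv_del [of x] mm.minus_right flip: matrix_mul_assoc)
    also have "\<dots> = del i ** (gamv u ** gamv x)"
      by (simp add: gamv_del [of u] mm.minus_left matrix_mul_assoc)
    finally show ?thesis .
  qed
  ultimately show ?thesis
    by (simp add: spin_def)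
qed

lemma spin_turn:
  assumes "norm x = 1" "x + y \<noteq> 0"
  shows "(turn x y, turn_lift x y) \<in> spin"
proof -
  have "turn x y = reflm ((1 / norm (x + y)) *\<^sub>R (x + y)) ** reflm x"
    using assms(2) reflm_scaleR [of "1 / norm (x + y)" "x + y"] by (simp add: turn_def)
  moreover have "turn_lift x y = gamv ((1 / norm (x + y)) *\<^sub>R (x + y)) ** gamv x"
    by (simp only: turn_lift_def linear_scale [OF linear_gamv] mm.scaleR_left)
  ultimately show ?thesis
    using assms spin_reflections [of "(1 / norm (x + y)) *\<^sub>R (x + y)" x] by simp
qed

lemma continuous_on_turn [continuous_intros]:
  assumes "continuous_on S f" "continuous_on S g" "\<And>x. x \<in> S \<Longrightarrow> f x \<noteq> 0" "\<And>x. x \<in> S \<Longrightarrow> f x + g x \<noteq> 0"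
  shows "continuous_on S (\<lambda>x. turn (f x) (g x))"
  unfolding turn_def using assms by (intro continuous_intros) auto

lemma continuous_on_turn_lift [continuous_intros]:
  assumes "continuous_on S f" "continuous_on S g" "\<And>x. x \<in> S \<Longrightarrow> f x + g x \<noteq> 0"
  shows "continuous_on S (\<lambda>x. turn_lift (f x) (g x))"
  unfolding turn_lift_def using assms by (intro continuous_intros) auto

subsection \<open>Lifting maps to spheres\<close>

text \<open>\<open>K\<close> is the set of coordinates that may move, so this is a copy of the
  orthogonal group of the coordinate space of \<open>K\<close>. The determinant is left free here
  and recovered later by connectedness.\<close>

definition fixing_O :: "'n set \<Rightarrow> (real^'n^'n) set" where
  "fixing_O K = {A. orthogonal_matrix A \<and> (\<forall>i. i \<notin> K \<longrightarrow> A *v axis i 1 = axis i 1)}"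

definition coord_sphere :: "'n set \<Rightarrow> (real^'n) set" where
  "coord_sphere K = {v. norm v = 1 \<and> (\<forall>i. i \<notin> K \<longrightarrow> v $ i = 0)}"

lemma orthogonal_matrix_inner:
  fixes A :: "real^'n^'n"
  assumes "orthogonal_matrix A"
  shows "(A *v x) \<bullet> (A *v y) = x \<bullet> y"
proof -
  have "(A *v x) \<bullet> (A *v y) = (transpose A *v (A *v x)) \<bullet> y"
    by (simp add: dot_lmul_matrix)
  then show ?thesis
    by (simp only: matrix_vector_mul_assoc orthogonal_matrix_transpose_mult [OF assms] matrix_vector_mul_lid)
qed

lemma fixing_O_one: "mat 1 \<in> fixing_O K"
  by (simp add: fixing_O_def orthogonal_matrix_id)

lemma fixing_O_mult: "A \<in> fixing_O K \<Longrightarrow> B \<in> fixing_O K \<Longrightarrow> A ** B \<in> fixing_O K"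
  by (simp add: fixing_O_def orthogonal_matrix_mul flip: matrix_vector_mul_assoc)

lemma transpose_mult_vec_eq:
  fixes A :: "real^'n^'n"
  assumes "orthogonal_matrix A" "A *v x = y"
  shows "transpose A *v y = x"
  unfolding assms(2) [symmetric] matrix_vector_mul_assoc orthogonal_matrix_transpose_mult [OF assms(1)]
  by (rule matrix_vector_mul_lid)

lemma fixing_O_transpose: "A \<in> fixing_O K \<Longrightarrow> transpose A \<in> fixing_O K"
  by (auto simp: fixing_O_def transpose_mult_vec_eq simp del: transpose_matrix_vector)

lemma fixing_O_mono: "K \<subseteq> L \<Longrightarrow> fixing_O K \<subseteq> fixing_O L"
  by (auto simp: fixing_O_def)

lemma fixing_O_insertD:
  "A \<in> fixing_O (insert k K) \<Longrightarrow> A *v axis k 1 = axis k 1 \<Longrightarrow> A \<in> fixing_O K"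
  by (auto simp: fixing_O_def)

lemma fixing_O_column:
  assumes "A \<in> fixing_O K" "k \<in> K"
  shows "A *v axis k 1 \<in> coord_sphere K"
proof -
  have A: "orthogonal_matrix A"
    using assms by (simp add: fixing_O_def)
  have "norm (A *v axis k 1) = 1"
    using orthogonal_matrix_inner [OF A, of "axis k 1" "axis k 1"] by (simp add: norm_eq_1 inner_axis_axis)
  moreover have "(A *v axis k 1) $ i = 0" if "i \<notin> K" for i
  proof -
    have "(A *v axis k 1) $ i = (A *v axis k 1) \<bullet> (A *v axis i 1)"
      using assms(1) that by (simp add: fixing_O_def inner_axis)
    also have "\<dots> = 0"
      unfolding orthogonal_matrix_inner [OF A] using assms(2) that by (auto simp: inner_axis_axis)
    finally show ?thesis .
  qed
  ultimately show ?thesis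
    by (simp add: coord_sphere_def)
qed

lemma turn_in_fixing_O:
  assumes "x \<in> coord_sphere K" "y \<in> coord_sphere K" "x + y \<noteq> 0"
  shows "turn x y \<in> fixing_O K"
proof -
  have "turn x y *v axis i 1 = axis i 1" if "i \<notin> K" for i
    using assms that by (intro turn_fixes) (auto simp: coord_sphere_def inner_axis)
  moreover have "x \<noteq> 0"
    using assms by (auto simp: coord_sphere_def)
  ultimately show ?thesis
    using assms by (simp add: fixing_O_def orthogonal_turn)
qed

text \<open>Every factor is an explicit continuous function of \<open>x\<close> with an explicit
  spin lift, so \<open>A\<close> and \<open>s\<close> are continuous without any gluing. Keeping
  \<open>A\<close> in \<open>fixing_O K\<close> leaves the other coordinates fixed, as the
  inductions over coordinates require.\<close>

lemma lift_to_coord_sphere: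
  fixes h :: "'a::euclidean_space \<Rightarrow> real^'n::finite"
  assumes C: "compact C" "0 \<in> C" "\<And>x t. x \<in> C \<Longrightarrow> 0 \<le> t \<Longrightarrow> t \<le> 1 \<Longrightarrow> t *\<^sub>R x \<in> C"
    and h: "continuous_on C h" "\<And>x. x \<in> C \<Longrightarrow> h x \<in> coord_sphere K" "h 0 = axis k 1"
  obtains A s where "continuous_on C A" "continuous_on C s"
    "\<And>x. x \<in> C \<Longrightarrow> A x \<in> fixing_O K" "\<And>x. x \<in> C \<Longrightarrow> (A x, s x) \<in> spin"
    "\<And>x. x \<in> C \<Longrightarrow> A x *v axis k 1 = h x" "A 0 = mat 1"
proof -
  \<comment> \<open>Unit vectors at distance less than 2 are not antipodal, which is what
    \<open>turn\<close> needs.\<close>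
  have "\<exists>d>0. \<forall>x\<in>C. \<forall>x'\<in>C. dist x' x < d \<longrightarrow> dist (h x') (h x) < 2"
    using compact_uniformly_continuous [OF h(1) C(1)] zero_less_numeral
    unfolding uniformly_continuous_on_def by blast
  then obtain d where d: "d > 0"
      "\<And>x x'. x \<in> C \<Longrightarrow> x' \<in> C \<Longrightarrow> dist x' x < d \<Longrightarrow> dist (h x') (h x) < 2"
    by blast
  have close: "h x + h x' \<noteq> 0" if "x \<in> C" "x' \<in> C" "dist x' x < d" for x x'
  proof
    assume "h x + h x' = 0"
    then have "h x' = - h x"
      by (metis add_eq_0_iff)
    then have "dist (h x') (h x) = norm (- (2 *\<^sub>R h x))"
      by (simp add: dist_norm scaleR_2)
    also have "\<dots> = 2"
      using h(2) [OF that(1)] by (simp add: coord_sphere_def)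
    finally show False
      using d(2) [OF that] by simp
  qed
  obtain B where B: "\<And>x. x \<in> C \<Longrightarrow> norm x \<le> B"
    using compact_imp_bounded [OF C(1)] bounded_iff by blast
  \<comment> \<open>With \<open>N\<close> equal steps on each ray, consecutive points are at
    distance at most \<open>B / N < d\<close>.\<close>
  obtain N where N: "B / d < real N"
    using reals_Archimedean2 by blast
  have "0 \<le> B"
    using B [OF C(2)] by simp
  then have N0: "0 < real N"
    using N d(1) by (meson divide_nonneg_pos le_less_trans)
  have "\<exists>A s. continuous_on C A \<and> continuous_on C s \<and> (\<forall>x\<in>C. A x \<in> fixing_O K
      \<and> (A x, s x) \<in> spin \<and> A x *v axis k 1 = h ((real j / real N) *\<^sub>R x)) \<and> A 0 = mat 1" if "j \<le> N" for j
    using that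
  proof (induction j)
    case 0
    then show ?case
      by (intro exI [of _ "\<lambda>_. mat 1"]) (auto simp: spin_one fixing_O_one h(3))
  next
    case (Suc j)
    then obtain A s where A: "continuous_on C A" "continuous_on C s" "A 0 = mat 1"
      "\<And>x. x \<in> C \<Longrightarrow> A x \<in> fixing_O K \<and> (A x, s x) \<in> spin \<and> A x *v axis k 1 = h ((real j / real N) *\<^sub>R x)"
      by auto
    define a where "a x = h ((real j / real N) *\<^sub>R x)" for x
    define b where "b x = h ((real (Suc j) / real N) *\<^sub>R x)" for x
    have inC: "(real i / real N) *\<^sub>R x \<in> C" if "x \<in> C" "i \<le> Suc j" for x i
      using that Suc.prems N0 by (intro C(3)) auto
    have ab: "continuous_on C a" "continuous_on C b"
      unfolding a_def b_def using inC
      by (auto intro!: continuous_on_compose2 [OF h(1)] continuous_intros simp del: of_nat_Suc)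
    have in_sphere: "a x \<in> coord_sphere K" "b x \<in> coord_sphere K" if "x \<in> C" for x
      unfolding a_def b_def using inC that by (auto intro!: h(2) simp del: of_nat_Suc)
    have "a x + b x \<noteq> 0" if "x \<in> C" for x
      unfolding a_def b_def
    proof (rule close)
      have "dist ((real (Suc j) / real N) *\<^sub>R x) ((real j / real N) *\<^sub>R x) = norm x / real N"
        by (simp add: dist_norm algebra_simps add_divide_distrib flip: scaleR_diff_left)
      also have "\<dots> \<le> B / real N"
        using B [OF that] N0 by (simp add: divide_right_mono)
      also have "\<dots> < d"
        using N N0 d(1) by (simp add: field_simps)
      finally show "dist ((real (Suc j) / real N) *\<^sub>R x) ((real j / real N) *\<^sub>R x) < d" .
    qed (use that inC in \<open>auto simp del: of_nat_Suc\<close>)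
    note abx = in_sphere this
    have nz: "a x \<noteq> 0" "norm (a x) = 1" "norm (b x) = 1" if "x \<in> C" for x
      using in_sphere [OF that] by (auto simp: coord_sphere_def)
    show ?case
    proof (intro exI conjI ballI)
      show "continuous_on C (\<lambda>x. turn (a x) (b x) ** A x)"
        "continuous_on C (\<lambda>x. turn_lift (a x) (b x) ** s x)"
        using ab A nz abx by (auto intro!: continuous_intros)
      show "turn (a 0) (b 0) ** A 0 = mat 1"
        using A(3) nz [OF C(2)] by (simp add: a_def b_def)
      fix x assume x: "x \<in> C"
      show "turn (a x) (b x) ** A x \<in> fixing_O K"
        using abx A(4) x by (auto intro!: fixing_O_mult turn_in_fixing_O)
      show "(turn (a x) (b x) ** A x, turn_lift (a x) (b x) ** s x) \<in> spin"
        using abx nz A(4) x by (auto intro!: spin_mult spin_turn)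
      have "(turn (a x) (b x) ** A x) *v axis k 1 = turn (a x) (b x) *v a x"
        using A(4) [OF x] by (simp add: a_def flip: matrix_vector_mul_assoc)
      also have "\<dots> = b x"
        using nz abx x by (simp add: turn_mult_vec)
      finally show "(turn (a x) (b x) ** A x) *v axis k 1 = h ((real (Suc j) / real N) *\<^sub>R x)"
        by (simp add: b_def)
    qed
  qed
  from this [of N] show thesis
    using that N0 by auto
qed

text \<open>The motion of \<open>axis k 1\<close> under \<open>F\<close> is copied by some
  \<open>A\<close> that comes with a lift. Then \<open>transpose A ** F\<close> fixes
  \<open>axis k 1\<close>, so it moves fewer coordinates and has a lift by induction; lifts
  multiply.\<close>

lemma spin_lift_exists:
  fixes F :: "'a::euclidean_space \<Rightarrow> real^'n^'n::finite"
  assumes "finite K" and C: "compact C" "0 \<in> C" "\<And>x t. x \<in> C \<Longrightarrow> 0 \<le> t \<Longrightarrow> t \<le> 1 \<Longrightarrow> t *\<^sub>R x \<in> C"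
    and "continuous_on C F" "\<And>x. x \<in> C \<Longrightarrow> F x \<in> fixing_O K" "F 0 = mat 1"
  shows "\<exists>s. continuous_on C s \<and> (\<forall>x\<in>C. (F x, s x) \<in> spin)"
  using assms(1,5-)
proof (induction K arbitrary: F rule: finite_induct)
  case empty
  have "F x = mat 1" if "x \<in> C" for x
  proof -
    have "F x *v axis i 1 = mat 1 *v axis i 1" for i
      using empty that by (simp add: fixing_O_def)
    then show ?thesis
      by (simp add: matrix_vector_mult_basis column_def vec_eq_iff)
  qed
  then show ?case
    by (intro exI [of _ "\<lambda>_. mat 1"]) (auto simp: spin_one)
next
  case (insert k K)
  define h where "h x = F x *v axis k 1" for x
  obtain A s where A: "continuous_on C A" "continuous_on C s"
    "\<And>x. x \<in> C \<Longrightarrow> A x \<in> fixing_O (insert k K)" "\<And>x. x \<in> C \<Longrightarrow> (A x, s x) \<in> spin"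
    "\<And>x. x \<in> C \<Longrightarrow> A x *v axis k 1 = h x" "A 0 = mat 1"
  proof (rule lift_to_coord_sphere [OF C, of h "insert k K" k])
    show "continuous_on C h"
      unfolding h_def using insert.prems by (intro continuous_intros)
  qed (use insert.prems in \<open>auto simp: h_def fixing_O_column\<close>)
  have orth: "orthogonal_matrix (A x)" if "x \<in> C" for x
    using A(3) [OF that] by (simp add: fixing_O_def)
  define B where "B x = transpose (A x) ** F x" for x
  have F: "F x = A x ** B x" if "x \<in> C" for x
    by (simp add: B_def matrix_mul_assoc orthogonal_matrix_transpose_mult orth that)
  have "\<exists>s. continuous_on C s \<and> (\<forall>x\<in>C. (B x, s x) \<in> spin)"
  proof (rule insert.IH)
    show "continuous_on C B"
      unfolding B_def using A insert.prems by (intro continuous_intros)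
    show "B 0 = mat 1"
      by (simp add: B_def A insert.prems)
    fix x assume x: "x \<in> C"
    have "B x \<in> fixing_O (insert k K)"
      unfolding B_def using A x insert.prems by (auto intro!: fixing_O_mult fixing_O_transpose)
    moreover have "B x *v axis k 1 = axis k 1"
      unfolding B_def matrix_vector_mul_assoc [symmetric] h_def [symmetric]
      by (rule transpose_mult_vec_eq [OF orth [OF x] A(5) [OF x]])
    ultimately show "B x \<in> fixing_O K"
      by (rule fixing_O_insertD)
  qed
  then obtain t where "continuous_on C t" "\<forall>x\<in>C. (B x, t x) \<in> spin"
    by blast
  with A show ?case
    by (intro exI [of _ "\<lambda>x. s x ** t x"]) (auto simp: F spin_mult intro!: continuous_intros)
qed

text \<open>At each point the two lifts differ by a sign. The entry of
  \<open>transpose (s x) ** t x\<close> at the empty set reads off this sign, and a continuous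
  function with finitely many values on a connected set is constant.\<close>

lemma spin_lift_unique:
  assumes "connected S" "continuous_on S s" "continuous_on S t"
    and "\<And>x. x \<in> S \<Longrightarrow> (F x, s x) \<in> spin" "\<And>x. x \<in> S \<Longrightarrow> (F x, t x) \<in> spin"
    and "x \<in> S" "y \<in> S" "s x = t x"
  shows "s y = t y"
proof -
  define f where "f x = transpose (s x) ** t x" for x
  have s: "orthogonal_matrix (s x)" if "x \<in> S" for x
    using assms(4) [OF that] by (simp add: spin_def)
  have "continuous_on S f"
    unfolding f_def using assms by (intro continuous_intros)
  then have "continuous_on S (\<lambda>x. f x $ {} $ {})"
    by (intro continuous_on_component)
  moreover have f: "f x = mat 1 \<or> f x = - mat 1" if "x \<in> S" for x
    using spin_unique [OF assms(4) [OF that] assms(5) [OF that]]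
      orthogonal_matrix_transpose_mult(1) [OF s [OF that]]
    by (auto simp: f_def mm.minus_right)
  then have "(\<lambda>x. f x $ {} $ {}) ` S \<subseteq> {1, -1}"
    by (force simp: mat_def)
  then have "finite ((\<lambda>x. f x $ {} $ {}) ` S)"
    by (rule finite_subset) auto
  ultimately have "(\<lambda>x. f x $ {} $ {}) constant_on S"
    using \<open>connected S\<close> by (simp add: continuous_finite_range_constant)
  then have "f y $ {} $ {} = f x $ {} $ {}"
    using assms(6,7) unfolding constant_on_def by auto
  moreover have "f x = mat 1"
    by (simp add: f_def orthogonal_matrix_transpose_mult s assms(6) flip: assms(8))
  ultimately have "f y = mat 1"
    using f [OF assms(7)] by (auto simp: mat_def)
  then have "s y ** (transpose (s y) ** t y) = s y"
    by (simp add: f_def)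
  then show ?thesis
    using s [OF assms(7)] by (simp add: matrix_mul_assoc orthogonal_matrix_transpose_mult)
qed

subsection \<open>Loops of rotations\<close>

lemma SO_iff: "A \<in> SO \<longleftrightarrow> orthogonal_matrix A \<and> det A = 1"
  by (simp add: SO_def rotation_matrix_def)

lemma SO_mult: "A \<in> SO \<Longrightarrow> B \<in> SO \<Longrightarrow> A ** B \<in> SO"
  by (simp add: SO_iff orthogonal_matrix_mul det_mul)

lemma SO_transpose: "A \<in> SO \<Longrightarrow> transpose A \<in> SO"
  by (simp add: SO_iff)

lemma SO_one: "mat 1 \<in> SO"
  by (simp add: SO_iff orthogonal_matrix_id)

lemma continuous_on_det [continuous_intros]:
  fixes f :: "'a::topological_space \<Rightarrow> real^'n^'n"
  assumes "continuous_on S f"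
  shows "continuous_on S (\<lambda>x. det (f x))"
  unfolding det_def by (intro continuous_intros continuous_on_component assms)

text \<open>The determinant is continuous with values in 1 and -1, hence constant on a connected
  set.\<close>

lemma connected_orthogonal_in_SO:
  fixes F :: "'a::topological_space \<Rightarrow> real^'n^'n"
  assumes "connected S" "continuous_on S F" "\<And>x. x \<in> S \<Longrightarrow> orthogonal_matrix (F x)"
    and "x0 \<in> S" "F x0 = mat 1" "x \<in> S"
  shows "F x \<in> SO"
proof -
  have "(\<lambda>x. det (F x)) ` S \<subseteq> {1, -1}"
    using det_orthogonal_matrix assms(3) by auto
  then have "finite ((\<lambda>x. det (F x)) ` S)"
    by (rule finite_subset) auto
  then have "(\<lambda>x. det (F x)) constant_on S"
    using assms(1,2) by (simp add: continuous_finite_range_constant continuous_on_det)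
  then have "det (F x) = det (F x0)"
    using assms(4,6) unfolding constant_on_def by auto
  then show ?thesis
    using assms by (simp add: SO_iff)
qed

lemma matrix_eq_axis:
  fixes A B :: "real^'n^'m"
  assumes "\<And>i. A *v axis i 1 = B *v axis i 1"
  shows "A = B"
  using assms by (simp add: matrix_vector_mult_basis column_def vec_eq_iff)

text \<open>Two mirrors at an angle of \<open>\<theta> / 2\<close> compose to a rotation by
  \<open>\<theta>\<close>. The half angle is what makes the spin lift change sign after a full
  turn.\<close>

lemma plane_rotation_reflm:
  assumes "i \<noteq> j"
  shows "plane_rotation i j \<theta>
    = reflm (cos (\<theta> / 2) *\<^sub>R axis i 1 + sin (\<theta> / 2) *\<^sub>R axis j 1) ** reflm (axis i 1)"
proof (rule matrix_eq_axis)
  fix l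
  define u :: "real^'a" where "u = cos (\<theta> / 2) *\<^sub>R axis i 1 + sin (\<theta> / 2) *\<^sub>R axis j 1"
  have ip: "u \<bullet> u = 1" "u \<bullet> axis i 1 = cos (\<theta> / 2)" "u \<bullet> axis j 1 = sin (\<theta> / 2)"
      "l \<noteq> i \<Longrightarrow> l \<noteq> j \<Longrightarrow> u \<bullet> axis l 1 = 0"
    using assms by (auto simp: u_def inner_add_left inner_add_right inner_axis_axis power2_eq_square [symmetric])
  have r: "reflm (axis i 1) *v axis l 1 = (if l = i then - axis i 1 else axis l 1 :: real^'a)"
    by (auto simp: reflm_mult_vec inner_axis_axis scaleR_2)
  have cs: "cos \<theta> = 2 * cos (\<theta> / 2) * cos (\<theta> / 2) - 1" "cos \<theta> = 1 - 2 * sin (\<theta> / 2) * sin (\<theta> / 2)"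
     "sin \<theta> = 2 * sin (\<theta> / 2) * cos (\<theta> / 2)"
    using cos_double_cos [of "\<theta> / 2"] cos_double_sin [of "\<theta> / 2"] sin_double [of "\<theta> / 2"]
    by (simp_all add: power2_eq_square)
  have u: "reflm u *v v = v - (2 * (u \<bullet> v)) *\<^sub>R u" for v
    by (simp add: reflm_mult_vec ip)
  have "plane_rotation i j \<theta> *v axis l 1 = reflm u *v (reflm (axis i 1) *v axis l 1)"
  proof (cases "l = i")
    case True
    then show ?thesis
      unfolding r u using assms
      by (simp add: plane_rotation_axis ip cs(1,3)) (simp add: u_def algebra_simps)
  next
    case False
    show ?thesis
    proof (cases "l = j")
      case True
      then show ?thesis
        unfolding r u using assms
        by (simp add: plane_rotation_axis ip cs(2,3)) (simp add: u_def algebra_simps)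
    qed (use False assms in \<open>simp add: r u plane_rotation_axis ip\<close>)
  qed
  then show "plane_rotation i j \<theta> *v axis l 1 = (reflm u ** reflm (axis i 1)) *v axis l 1"
    by (simp add: matrix_vector_mul_assoc)
qed

lemma half_angle_vector_norm:
  "i \<noteq> j \<Longrightarrow> norm (cos \<theta> *\<^sub>R axis i 1 + sin \<theta> *\<^sub>R axis j 1 :: real^'n) = 1"
  by (auto simp: norm_eq_1 inner_add_left inner_add_right inner_axis_axis power2_eq_square [symmetric])

lemma continuous_on_plane_rotation [continuous_intros]:
  assumes "continuous_on S f"
  shows "continuous_on S (\<lambda>x. plane_rotation i j (f x))"
proof -
  have "continuous_on S (\<lambda>x. cos (f x))" "continuous_on S (\<lambda>x. sin (f x))"
    by (rule continuous_on_compose2 [of UNIV _ S f], auto intro!: assms continuous_intros)+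
  then have "continuous_on S (\<lambda>x. plane_rotation i j (f x) $ k $ l)" for k l
    by (cases "l = i"; cases "l = j"; cases "k = i"; cases "k = j")
      (auto simp: plane_rotation_def intro!: continuous_intros)
  then have "continuous_on S (\<lambda>x. \<chi> k l. plane_rotation i j (f x) $ k $ l)"
    by (intro continuous_on_vec_lambda)
  then show ?thesis
    by simp
qed

lemma orthogonal_plane_rotation: "i \<noteq> j \<Longrightarrow> orthogonal_matrix (plane_rotation i j \<theta>)"
  using half_angle_vector_norm [of i j "\<theta> / 2"] unfolding plane_rotation_reflm
  by (intro orthogonal_matrix_mul orthogonal_reflm) auto

lemma plane_rotation_0: "plane_rotation i j 0 = mat 1"
  by (auto simp: plane_rotation_def vec_eq_iff mat_def)

lemma plane_rotation_in_SO:
  assumes "i \<noteq> j"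
  shows "plane_rotation i j \<theta> \<in> SO"
  by (rule connected_orthogonal_in_SO [of UNIV "plane_rotation i j" 0])
    (use assms in \<open>auto intro!: continuous_intros orthogonal_plane_rotation plane_rotation_0\<close>)

lemma plane_rotation_in_fixing_O: "i \<noteq> j \<Longrightarrow> plane_rotation i j \<theta> \<in> fixing_O {i, j}"
  by (auto simp: fixing_O_def orthogonal_plane_rotation plane_rotation_axis)

lemma unit_square_star:
  fixes x :: "real \<times> real"
  assumes "x \<in> {0..1} \<times> {0..1}" "0 \<le> t" "t \<le> 1"
  shows "t *\<^sub>R x \<in> {0..1} \<times> {0..1}"
  using assms by (auto simp: mult_le_one)

text \<open>On three sides of the square a null-homotopy is the identity, so a lift has equal values
  at both ends of the fourth side. Along that side the half-angle formula determines the lift up to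
  a global sign, and its two ends are opposite.\<close>

theorem full_turn_not_nullhomotopic:
  fixes i j :: "'n::finite"
  assumes ij: "i \<noteq> j"
  shows "\<not> homotopic_paths SO (\<lambda>t. plane_rotation i j (2 * pi * t)) (\<lambda>t. mat 1)"
proof
  let ?C = "{0..1::real} \<times> {0..1::real}"
  assume "homotopic_paths SO (\<lambda>t. plane_rotation i j (2 * pi * t)) (\<lambda>t. mat 1)"
  then obtain H where H12: "continuous_on ?C H" "H \<in> ?C \<rightarrow> SO"
    and H': "\<forall>t\<in>{0..1}. H (0, t) = plane_rotation i j (2 * pi * t)"
    "\<forall>t\<in>{0..1}. H (1, t) = mat 1"
    "\<forall>t\<in>{0..1}. pathstart (H \<circ> Pair t) = pathstart (\<lambda>t. plane_rotation i j (2 * pi * t))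
       \<and> pathfinish (H \<circ> Pair t) = pathfinish (\<lambda>t. plane_rotation i j (2 * pi * t))"
    unfolding homotopic_paths by blast
  have H: "continuous_on ?C H" "H \<in> ?C \<rightarrow> SO"
    "H (0, t) = plane_rotation i j (2 * pi * t)" "H (1, t) = mat 1"
    "H (t, 0) = plane_rotation i j 0" "H (t, 1) = plane_rotation i j (2 * pi)" if "t \<in> {0..1}" for t
    using H12 H' that by (auto simp: pathstart_def pathfinish_def)
  have full: "plane_rotation i j (2 * pi) = mat 1"
    using H(4) [of 1] H(6) [of 1] by simp
  have "\<exists>s. continuous_on ?C s \<and> (\<forall>x\<in>?C. (H x, s x) \<in> spin)"
  proof (rule spin_lift_exists [of UNIV])
    show "H 0 = mat 1"
      using H(3) [of 0] by (simp add: plane_rotation_0 zero_prod_def)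
    show "H x \<in> fixing_O UNIV" if "x \<in> ?C" for x
      using H12(2) that by (auto simp: fixing_O_def SO_iff)
  qed (auto intro!: H12 compact_Times simp: mult_le_one zero_prod_def)
  then obtain s where s: "continuous_on ?C s" "\<And>x. x \<in> ?C \<Longrightarrow> (H x, s x) \<in> spin"
    by blast
  \<comment> \<open>The three sides of the square on which \<open>H\<close> is the identity; the
    side that carries the full turn is left out.\<close>
  let ?L = "{0..1::real} \<times> {0::real} \<union> ({1} \<times> {0..1} \<union> {0..1} \<times> {1})"
  have L: "connected ?L"
  proof (intro connected_Un connected_Times)
    show "{1::real} \<times> {0..1::real} \<inter> {0..1} \<times> {1} \<noteq> {}"
      by (auto simp: set_eq_iff)
    have "(1, 0) \<in> {0..1::real} \<times> {0::real} \<inter> ({1} \<times> {0..1} \<union> {0..1} \<times> {1})"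
      by simp
    then show "{0..1::real} \<times> {0::real} \<inter> ({1} \<times> {0..1} \<union> {0..1} \<times> {1}) \<noteq> {}"
      by blast
  qed auto
  have HL: "H x = mat 1" if "x \<in> ?L" for x
    using that H(4-6) full by (auto simp: plane_rotation_0)
  \<comment> \<open>The lift of \<open>H\<close> is not normalised, so its value at the corner is
    known only up to the sign \<open>c\<close>.\<close>
  have s1: "s (0, 1) = c *\<^sub>R mat 1" if "s (0, 0) = c *\<^sub>R mat 1" "c = 1 \<or> c = -1" for c
  proof (rule spin_lift_unique [OF L, of s "\<lambda>_. c *\<^sub>R mat 1" H "(0, 0)" "(0, 1)"])
    show "continuous_on ?L s"
      using s(1) by (rule continuous_on_subset) auto
    show "(H x, c *\<^sub>R mat 1) \<in> spin" if "x \<in> ?L" for x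
      using \<open>c = 1 \<or> c = -1\<close> HL [OF that] spin_one spin_minus [OF spin_one] by auto
    show "(H x, s x) \<in> spin" if "x \<in> ?L" for x
      using that by (intro s(2)) auto
  qed (use that in auto)
  \<comment> \<open>An explicit lift of the full turn: while the rotation angle runs to
    \<open>2 * pi\<close>, the moving vector goes only from \<open>axis i 1\<close> to
    \<open>- axis i 1\<close>.\<close>
  define r where "r t = gamv (cos (pi * t) *\<^sub>R axis i 1 + sin (pi * t) *\<^sub>R axis j 1) ** gamv (axis i 1)" for t
  have r: "(plane_rotation i j (2 * pi * t), r t) \<in> spin" for t
    using spin_reflections [OF half_angle_vector_norm [OF ij], of "axis i 1" "pi * t"] plane_rotation_reflm [OF ij, of "2 * pi * t"]
    by (simp add: r_def)
  have r0: "r 0 = mat 1" and r1: "r 1 = - mat 1"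
    by (simp_all add: r_def linear_neg [OF linear_gamv] gam_square mm.minus_left)
  have s2: "s (0, 1) = c *\<^sub>R r 1" if "s (0, 0) = c *\<^sub>R mat 1" "c = 1 \<or> c = -1" for c
  proof (rule spin_lift_unique [of "{0..1}" "\<lambda>t. s (0, t)" "\<lambda>t. c *\<^sub>R r t" "\<lambda>t. plane_rotation i j (2 * pi * t)" 0 1])
    show "continuous_on {0..1} (\<lambda>t. s (0, t))"
      by (rule continuous_on_compose2 [OF s(1)]) (auto intro!: continuous_intros)
    show "continuous_on {0..1} (\<lambda>t. c *\<^sub>R r t)"
      unfolding r_def by (intro continuous_intros)
    show "(plane_rotation i j (2 * pi * t), c *\<^sub>R r t) \<in> spin" if "t \<in> {0..1}" for t
      using \<open>c = 1 \<or> c = -1\<close> r spin_minus [OF r] by auto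
    show "(plane_rotation i j (2 * pi * t), s (0, t)) \<in> spin" if "t \<in> {0..1}" for t
      using s(2) [of "(0, t)"] H(3) that by auto
  qed (use that r0 in auto)
  have "s (0, 0) = mat 1 \<or> s (0, 0) = - mat 1"
    using spin_unique [of "mat 1" "mat 1" "s (0, 0)"] s(2) [of "(0, 0)"] HL [of "(0, 0)"] spin_one by auto
  then obtain c :: real where c: "s (0, 0) = c *\<^sub>R mat 1" "c = 1 \<or> c = -1"
    by (metis scaleR_minus1_left scaleR_one)
  from s1 [OF c] s2 [OF c] have "c *\<^sub>R mat 1 = - (c *\<^sub>R mat 1 :: real^('n set)^('n set))"
    by (simp add: r1)
  then have "c = - c"
    by (auto simp: vec_eq_iff mat_def split: if_splits)
  with c(2) show False
    by auto
qed

subsection \<open>Every loop of rotations is a power of the full turn\<close>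

text \<open>The sphere is the relative boundary of the unit ball in a coordinate subspace, whose
  dimension is at least 3.\<close>

lemma simply_connected_coord_sphere:
  fixes K :: "'n::finite set"
  assumes "card K \<ge> 3"
  shows "simply_connected (coord_sphere K :: (real^'n) set)"
proof -
  let ?T = "{v :: real^'n. \<forall>i. i \<notin> K \<longrightarrow> v $ i = 0}"
  have sub: "subspace ?T"
    by (auto simp: subspace_def)
  have K: "finite K"
    by simp
  have "int (card K) \<le> aff_dim ?T"
  proof -
    have "(\<lambda>i. axis i 1 :: real^'n) ` K \<subseteq> Basis"
      by (auto simp: axis_in_Basis_iff)
    then have "independent ((\<lambda>i. axis i 1 :: real^'n) ` K)"
      using independent_Basis independent_mono by blast
    moreover have "(\<lambda>i. axis i 1 :: real^'n) ` K \<subseteq> ?T"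
      by (auto simp: axis_def)
    ultimately have "card ((\<lambda>i. axis i 1 :: real^'n) ` K) \<le> dim ?T"
      by (intro independent_card_le_dim)
    moreover have "inj_on (\<lambda>i. axis i 1 :: real^'n) K"
      by (auto simp: inj_on_def axis_eq_axis)
    ultimately show ?thesis
      using sub by (simp add: card_image aff_dim_subspace)
  qed
  moreover have "aff_dim (?T \<inter> ball 0 1) = aff_dim ?T"
    using sub by (intro aff_dim_convex_Int_open subspace_imp_convex)
      (auto intro!: exI [of _ 0] simp: set_eq_iff)
  ultimately have "simply_connected (rel_frontier (ball 0 1 \<inter> ?T))"
    using assms sub
    by (intro simply_connected_sphere_gen) (auto simp: convex_Int subspace_imp_convex bounded_Int Int_commute)
  moreover have "rel_frontier (ball 0 1 \<inter> ?T) = frontier (ball 0 1) \<inter> ?T"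
    using sub by (intro convex_affine_rel_frontier_Int subspace_imp_affine)
      (auto intro!: exI [of _ 0] simp: set_eq_iff)
  moreover have "frontier (ball 0 1) \<inter> ?T = coord_sphere K"
    by (auto simp: coord_sphere_def)
  ultimately show ?thesis
    by simp
qed

text \<open>The loop that \<open>p\<close> traces on the sphere through \<open>axis k 1\<close> is
  contracted by some \<open>H\<close>, and \<open>H\<close> is lifted to \<open>A\<close>. The map
  \<open>F\<close>, at \<open>(s, t)\<close> the product of \<open>A (s, t)\<close>, the inverse of
  \<open>A (0, t)\<close> and \<open>p t\<close>, equals \<open>p\<close> for \<open>s = 0\<close>
  and moves \<open>axis k 1\<close> according to \<open>H\<close>. It is not a homotopy with fixed
  ends: on the sides \<open>t = 0\<close> and \<open>t = 1\<close> it merely stays in the stabilizer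
  of \<open>axis k 1\<close>. Hence the side that carries \<open>p\<close> is compared with the
  detour along the other three, where all values lie in the stabilizer.\<close>

lemma homotopic_paths_into_stabilizer:
  fixes K :: "'n::finite set"
  assumes K: "k \<notin> K" "card K \<ge> 2"
    and p: "path p" "path_image p \<subseteq> fixing_O (insert k K)" "p 0 = mat 1" "p 1 = mat 1"
  shows "\<exists>q. path_image q \<subseteq> fixing_O K \<and> homotopic_paths (fixing_O (insert k K)) p q"
proof -
  let ?I = "{0..1::real}"
  let ?C = "?I \<times> ?I"
  let ?V = "coord_sphere (insert k K) :: (real^'n) set"
  have cp: "continuous_on ?I p" and pin: "\<And>t. t \<in> ?I \<Longrightarrow> p t \<in> fixing_O (insert k K)"
    using p by (auto simp: path_def path_image_def)
  have axis: "axis k 1 \<in> ?V"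
    by (auto simp: coord_sphere_def norm_eq_1 inner_axis_axis) (auto simp: axis_def)
  have "simply_connected ?V"
    using K by (intro simply_connected_coord_sphere) simp
  moreover have "path (\<lambda>t. p t *v axis k 1)"
    unfolding path_def by (intro continuous_intros cp)
  moreover have "path_image (\<lambda>t. p t *v axis k 1) \<subseteq> ?V"
    using pin by (auto simp: path_image_def intro!: fixing_O_column)
  moreover have "path (linepath (axis k 1) (axis k 1 :: real^'n))" "path_image (linepath (axis k 1) (axis k 1)) \<subseteq> ?V"
    using axis by auto
  ultimately have "homotopic_paths ?V (\<lambda>t. p t *v axis k 1) (linepath (axis k 1) (axis k 1))"
    using p unfolding simply_connected_eq_homotopic_paths by (simp add: pathstart_def pathfinish_def)
  then obtain H where H: "continuous_on ?C H" "H \<in> ?C \<rightarrow> ?V"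
    and H0: "\<forall>t\<in>?I. H (0, t) = p t *v axis k 1"
    and H1: "\<forall>t\<in>?I. H (1, t) = linepath (axis k 1) (axis k 1) t"
    and Hends: "\<forall>t\<in>?I. pathstart (H \<circ> Pair t) = pathstart (\<lambda>t. p t *v axis k 1)
       \<and> pathfinish (H \<circ> Pair t) = pathfinish (\<lambda>t. p t *v axis k 1)"
    unfolding homotopic_paths by blast
  have sides: "H (1, t) = axis k 1" "H (t, 0) = axis k 1" "H (t, 1) = axis k 1" if "t \<in> ?I" for t
    using H1 Hends that p by (auto simp: pathstart_def pathfinish_def linepath_refl)
  obtain A where A: "continuous_on ?C A" "\<And>x. x \<in> ?C \<Longrightarrow> A x \<in> fixing_O (insert k K)"
    "\<And>x. x \<in> ?C \<Longrightarrow> A x *v axis k 1 = H x" "A 0 = mat 1"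
  proof (rule lift_to_coord_sphere [of ?C H "insert k K" k])
    show "H 0 = axis k 1"
      using sides(2) [of 0] by (simp add: zero_prod_def)
    show "t *\<^sub>R x \<in> ?C" if "x \<in> ?C" "0 \<le> t" "t \<le> 1" for x t
      using unit_square_star that by blast
  qed (use H in \<open>auto simp: zero_prod_def intro!: compact_Times\<close>)
  have orth: "orthogonal_matrix (A x)" if "x \<in> ?C" for x
    using A(2) [OF that] by (simp add: fixing_O_def)
  define F where "F x = A x ** (transpose (A (0, snd x)) ** p (snd x))" for x
  have cF: "continuous_on ?C F"
    unfolding F_def
    by (intro continuous_intros A continuous_on_compose2 [OF A(1)] continuous_on_compose2 [OF cp]) auto
  have Fin: "F x \<in> fixing_O (insert k K)" if "x \<in> ?C" for x
    unfolding F_def using that by (intro fixing_O_mult fixing_O_transpose A(2) pin) auto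
  have Faxis: "F x *v axis k 1 = H x" if x: "x \<in> ?C" for x
  proof -
    have x': "(0, snd x) \<in> ?C" "snd x \<in> ?I"
      using x by auto
    have "transpose (A (0, snd x)) *v (p (snd x) *v axis k 1) = axis k 1"
      using A(3) [OF x'(1)] H0 x'(2) by (intro transpose_mult_vec_eq orth x') auto
    then show ?thesis
      using A(3) [OF x] by (simp add: F_def del: transpose_matrix_vector flip: matrix_vector_mul_assoc)
  qed
  have Fstab: "F x \<in> fixing_O K" if "x \<in> ?C" "H x = axis k 1" for x
    using fixing_O_insertD Fin Faxis that by metis
  have F0: "F (0, t) = p t" if "t \<in> ?I" for t
    using orth [of "(0, t)"] that
    by (simp add: F_def matrix_mul_assoc orthogonal_matrix_transpose_mult)
  \<comment> \<open>\<open>l\<close> is the side of the square that carries \<open>p\<close>, and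
    \<open>r\<close> leads through the other three sides between the same corners; they are
    homotopic because the square is convex.\<close>
  define l where "l = linepath (0::real, 0::real) (0, 1)"
  define r where "r = linepath (0::real, 0::real) (1, 0) +++ (linepath (1, 0) (1, 1) +++ linepath (1, 1) (0, 1))"
  have seg: "path_image r \<subseteq> ?I \<times> {0} \<union> ({1} \<times> ?I \<union> ?I \<times> {1})"
    unfolding r_def by (intro subset_path_image_join)
      (auto simp: closed_segment_def)
  have conv: "convex ?C"
    by (intro convex_Times) auto
  have "homotopic_paths ?C l r"
  proof -
    have "simply_connected ?C"
      using conv by (rule convex_imp_simply_connected)
    moreover have "path_image l \<subseteq> ?C"
      by (auto simp: l_def closed_segment_def)
    moreover have "path_image r \<subseteq> ?C"
      using seg by auto
    ultimately show ?thesis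
      unfolding simply_connected_eq_homotopic_paths by (simp add: l_def r_def)
  qed
  then have "homotopic_paths (fixing_O (insert k K)) (F \<circ> l) (F \<circ> r)"
    by (rule homotopic_paths_continuous_image) (use cF Fin in auto)
  moreover have "homotopic_paths (fixing_O (insert k K)) p (F \<circ> l)"
    using p by (intro homotopic_paths_eq) (auto simp: l_def linepath_def F0)
  moreover have "path_image (F \<circ> r) \<subseteq> fixing_O K"
    unfolding path_image_compose using seg sides by (auto intro!: Fstab)
  ultimately show ?thesis
    using homotopic_paths_trans by blast
qed

lemma homotopic_paths_into_plane:
  fixes K :: "'n::finite set"
  assumes "finite L" "K \<inter> L = {}" "card K \<ge> 2"
    and "path p" "path_image p \<subseteq> fixing_O (L \<union> K)" "p 0 = mat 1" "p 1 = mat 1"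
  shows "\<exists>q. path_image q \<subseteq> fixing_O K \<and> homotopic_paths (fixing_O (L \<union> K)) p q"
  using assms
proof (induction L arbitrary: p rule: finite_induct)
  case empty
  then show ?case by (intro exI [of _ p]) auto
next
  case (insert k L)
  have "card (L \<union> K) \<ge> 2"
    using insert.prems(2) by (meson card_mono finite le_trans sup_ge2)
  moreover have "k \<notin> L \<union> K"
    using insert by auto
  ultimately obtain q where q: "path_image q \<subseteq> fixing_O (L \<union> K)"
      "homotopic_paths (fixing_O (insert k (L \<union> K))) p q"
    using homotopic_paths_into_stabilizer [of k "L \<union> K" p] insert.prems by auto
  have "\<exists>q'. path_image q' \<subseteq> fixing_O K \<and> homotopic_paths (fixing_O (L \<union> K)) q q'"
    using q homotopic_paths_imp_pathstart [OF q(2)] homotopic_paths_imp_pathfinish [OF q(2)]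
      homotopic_paths_imp_path [OF q(2)] insert.prems
    by (intro insert.IH) (auto simp: pathstart_def pathfinish_def)
  then obtain q' where "path_image q' \<subseteq> fixing_O K" "homotopic_paths (fixing_O (L \<union> K)) q q'"
    by blast
  moreover have "fixing_O (L \<union> K) \<subseteq> fixing_O (insert k (L \<union> K))"
    by (rule fixing_O_mono) auto
  ultimately show ?case
    using q(2) by (auto intro!: exI [of _ q'] intro: homotopic_paths_trans homotopic_paths_subset)
qed

text \<open>The homotopy is a continuous map on a connected square and takes the identity as a
  value, so its determinant is 1 throughout.\<close>

lemma homotopic_paths_SO_I:
  assumes "homotopic_paths (fixing_O K) p q" "p 0 = mat 1"
  shows "homotopic_paths SO p q"
proof -
  let ?C = "{0..1::real} \<times> {0..1::real}"
  obtain H where H: "continuous_on ?C H" "H \<in> ?C \<rightarrow> fixing_O K"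
    and H': "\<forall>t\<in>{0..1}. H (0, t) = p t" "\<forall>t\<in>{0..1}. H (1, t) = q t"
    "\<forall>t\<in>{0..1}. pathstart (H \<circ> Pair t) = pathstart p
       \<and> pathfinish (H \<circ> Pair t) = pathfinish p"
    using assms(1) unfolding homotopic_paths by blast
  have "H x \<in> SO" if "x \<in> ?C" for x
  proof (rule connected_orthogonal_in_SO [of ?C H "(0, 0)"])
    show "connected ?C"
      by (intro connected_Times) auto
  qed (use that H H' assms(2) in \<open>auto simp: fixing_O_def\<close>)
  then show ?thesis
    unfolding homotopic_paths using H H' by blast
qed

text \<open>The image of \<open>axis i 1\<close> runs on a circle and has a continuous angle, taken
  from a continuous logarithm. Undoing the rotation by this angle leaves a matrix that fixes
  \<open>axis i 1\<close> and can at most negate \<open>axis j 1\<close>; this sign is constant in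
  time, so the remainder is the identity. The angle ends at a multiple of \<open>2 * pi\<close> and
  can be deformed linearly.\<close>

lemma plane_loop_homotopic:
  assumes ij: "i \<noteq> j" and p: "path p" "path_image p \<subseteq> fixing_O {i, j}" "p 0 = mat 1" "p 1 = mat 1"
  shows "\<exists>m::int. homotopic_paths SO p (\<lambda>t. plane_rotation i j (2 * pi * m * t))"
proof -
  have cp: "continuous_on {0..1} p" and pin: "\<And>t. t \<in> {0..1} \<Longrightarrow> p t \<in> fixing_O {i, j}"
    using p by (auto simp: path_def path_image_def)
  define v where "v t = p t *v axis i 1" for t
  have cv: "continuous_on {0..1} v"
    unfolding v_def by (intro continuous_intros cp)
  have vin: "v t \<in> coord_sphere {i, j}" if "t \<in> {0..1}" for t
    unfolding v_def using pin [OF that] by (intro fixing_O_column) auto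
  define c where "c t = Complex (v t $ i) (v t $ j)" for t
  have v_eq: "v t = v t $ i *\<^sub>R axis i 1 + v t $ j *\<^sub>R axis j 1" if "t \<in> {0..1}" for t
    using vin [OF that] ij by (auto simp: vec_eq_iff coord_sphere_def axis_def)
  have norm_c: "norm (c t) = 1" if "t \<in> {0..1}" for t
  proof -
    have "v t \<bullet> v t = 1"
      using vin [OF that] by (simp add: coord_sphere_def norm_eq_1)
    then have "(v t $ i)\<^sup>2 + (v t $ j)\<^sup>2 = 1"
      by (subst (asm) (1 2) v_eq [OF that])
        (use ij in \<open>auto simp: inner_add_left inner_add_right inner_axis_axis power2_eq_square\<close>)
    then show ?thesis
      by (simp add: c_def cmod_def)
  qed
  have "continuous_on {0..1} c"
    unfolding c_def Complex_eq by (intro continuous_intros continuous_on_component cv)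
  then obtain g where g: "continuous_on {0..1} g" "\<And>t. t \<in> {0..1} \<Longrightarrow> c t = exp (g t)"
    using norm_c continuous_logarithm_on_contractible [of "{0..1}" c] convex_imp_contractible [of "{0..1::real}"]
    by (metis convex_real_interval(5) norm_zero zero_neq_one)
  have cis: "c t = cis (Im (g t))" if "t \<in> {0..1}" for t
  proof -
    have "Re (g t) = 0"
      using norm_c [OF that] g(2) [OF that] by (simp add: norm_exp_eq_Re)
    then show ?thesis
      using g(2) [OF that] by (simp add: exp_eq_polar)
  qed
  have v0: "v 0 = axis i 1" and v1: "v 1 = axis i 1"
    by (simp_all add: v_def p)
  have c01: "c 0 = 1" "c 1 = 1"
    using ij by (auto simp: c_def v0 v1 axis_def complex_eq_iff)
  \<comment> \<open>Subtracting the initial value gives \<open>\<theta> 0 = 0\<close>; since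
    \<open>c 0 = 1\<close>, the new angle still describes \<open>c\<close>.\<close>
  define \<theta> where "\<theta> t = Im (g t) - Im (g 0)" for t
  have c\<theta>: "continuous_on {0..1} \<theta>"
    unfolding \<theta>_def by (intro continuous_intros g)
  have \<theta>: "c t = cis (\<theta> t)" if "t \<in> {0..1}" for t
    using cis [OF that] cis [of 0] c01 by (simp add: \<theta>_def flip: cis_divide)
  define B where "B t = transpose (plane_rotation i j (\<theta> t)) ** p t" for t
  have p_eq: "p t = plane_rotation i j (\<theta> t) ** B t" for t
    by (simp add: B_def matrix_mul_assoc orthogonal_matrix_transpose_mult orthogonal_plane_rotation ij)
  have Bin: "B t \<in> fixing_O {j}" if t: "t \<in> {0..1}" for t
  proof -
    have "B t \<in> fixing_O {i, j}"
      unfolding B_def using pin [OF t] ij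
      by (intro fixing_O_mult fixing_O_transpose plane_rotation_in_fixing_O) auto
    moreover have "v t = cos (\<theta> t) *\<^sub>R axis i 1 + sin (\<theta> t) *\<^sub>R axis j 1"
      using v_eq [OF t] \<theta> [OF t] by (simp add: c_def complex_eq_iff)
    then have "B t *v axis i 1 = axis i 1"
      unfolding B_def matrix_vector_mul_assoc [symmetric]
      by (intro transpose_mult_vec_eq orthogonal_plane_rotation ij)
        (simp add: plane_rotation_axis ij flip: v_def)
    ultimately show ?thesis
      by (rule fixing_O_insertD)
  qed
  have cB: "continuous_on {0..1} B"
    unfolding B_def by (intro continuous_intros c\<theta> cp)
  have Baxis: "B t *v axis j 1 = (B t $ j $ j) *\<^sub>R axis j 1 \<and> B t $ j $ j \<in> {1, -1}" if "t \<in> {0..1}" for t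
  proof -
    have *: "B t *v axis j 1 \<in> coord_sphere {j}"
      using Bin [OF that] by (intro fixing_O_column) auto
    have jj: "(B t *v axis j 1) $ j = B t $ j $ j"
      by (simp add: matrix_vector_mult_basis column_def)
    have eq: "B t *v axis j 1 = (B t $ j $ j) *\<^sub>R axis j 1"
      using * jj by (auto simp: coord_sphere_def vec_eq_iff axis_def)
    have "norm (B t *v axis j 1) = 1"
      using * by (simp add: coord_sphere_def)
    then have "\<bar>B t $ j $ j\<bar> = 1"
      unfolding eq by simp
    with eq show ?thesis
      by (auto simp: abs_if split: if_splits)
  qed
  have "(\<lambda>t. B t $ j $ j) ` {0..1} \<subseteq> {1, -1}"
    using Baxis by blast
  then have "finite ((\<lambda>t. B t $ j $ j) ` {0..1})"
    by (rule finite_subset) auto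
  moreover have "continuous_on {0..1} (\<lambda>t. B t $ j $ j)"
    by (intro continuous_on_component cB)
  ultimately have "(\<lambda>t. B t $ j $ j) constant_on {0..1}"
    by (simp add: continuous_finite_range_constant)
  moreover have "B 0 $ j $ j = 1"
  proof -
    have "B 0 = mat 1"
      by (simp add: B_def p \<theta>_def plane_rotation_0)
    then show ?thesis
      by (simp add: mat_def)
  qed
  ultimately have Bjj: "B t $ j $ j = 1" if "t \<in> {0..1}" for t
    using that unfolding constant_on_def by (metis atLeastAtMost_iff order_refl zero_le_one)
  have B1: "B t = mat 1" if t: "t \<in> {0..1}" for t
  proof (rule matrix_eq_axis)
    show "B t *v axis l 1 = mat 1 *v axis l 1" for l
      using Bin [OF t] Baxis [OF t] Bjj [OF t] by (cases "l = j") (auto simp: fixing_O_def)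
  qed
  have "cos (\<theta> 1) = 1"
    using \<theta> [of 1] c01 by (simp add: complex_eq_iff)
  then obtain m :: int where m: "\<theta> 1 = of_int m * 2 * pi"
    using cos_one_2pi_int by blast
  have "homotopic_paths UNIV \<theta> (\<lambda>t. 2 * pi * m * t)"
    using m by (intro homotopic_paths_linear)
      (auto simp: path_def c\<theta> pathstart_def pathfinish_def \<theta>_def intro!: continuous_intros g(1))
  then have "homotopic_paths SO (plane_rotation i j \<circ> \<theta>) (plane_rotation i j \<circ> (\<lambda>t. 2 * pi * m * t))"
    by (rule homotopic_paths_continuous_image)
      (auto intro!: continuous_intros plane_rotation_in_SO ij)
  moreover have "homotopic_paths (fixing_O {i, j}) p (plane_rotation i j \<circ> \<theta>)"
    using p by (intro homotopic_paths_eq) (auto simp: p_eq B1)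
  then have "homotopic_paths SO p (plane_rotation i j \<circ> \<theta>)"
    using p(3) by (rule homotopic_paths_SO_I)
  ultimately have "homotopic_paths SO p (plane_rotation i j \<circ> (\<lambda>t. 2 * pi * m * t))"
    by (metis homotopic_paths_trans)
  then show ?thesis
    by (auto simp: o_def)
qed

theorem SO_loop_homotopic_to_full_turns:
  fixes i j :: "'n::finite"
  assumes ij: "i \<noteq> j" and p: "path p" "path_image p \<subseteq> SO" "p 0 = mat 1" "p 1 = mat 1"
  shows "\<exists>m::int. homotopic_paths SO p (\<lambda>t. plane_rotation i j (2 * pi * m * t))"
proof -
  have "path_image p \<subseteq> fixing_O (- {i, j} \<union> {i, j})"
    using p(2) by (auto simp: fixing_O_def SO_iff)
  then obtain q where q: "path_image q \<subseteq> fixing_O {i, j}" "homotopic_paths (fixing_O (- {i, j} \<union> {i, j})) p q"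
    using homotopic_paths_into_plane [of "- {i, j}" "{i, j}" p] p ij by auto
  have "q 0 = mat 1" "q 1 = mat 1" "path q"
    using homotopic_paths_imp_pathstart [OF q(2)] homotopic_paths_imp_pathfinish [OF q(2)]
      homotopic_paths_imp_path [OF q(2)] p by (auto simp: pathstart_def pathfinish_def)
  then obtain m :: int where "homotopic_paths SO q (\<lambda>t. plane_rotation i j (2 * pi * m * t))"
    using plane_loop_homotopic [OF ij _ q(1)] by blast
  then show ?thesis
    using homotopic_paths_SO_I [OF q(2) p(3)] homotopic_paths_trans by blast
qed

subsection \<open>The path group\<close>

lemma finite_hyperoct_vertices: "finite (hyperoct_vertices :: (real^'n::finite) set)"
  by (simp add: hyperoct_vertices_def)

lemma matrix_vector_mult_minus_right: "(A :: real^'n^'m) *v (- v) = - (A *v v)"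
  by (simp add: matrix_vector_mult_def vec_eq_iff sum_negf)

text \<open>The vertex set is finite and closed under negation, so for an injective linear map it is
  enough that the basis vectors go to vertices.\<close>

lemma hyperoct_rotationsI:
  fixes A :: "real^'n^'n"
  assumes "A \<in> SO" "\<And>i. A *v axis i 1 \<in> hyperoct_vertices"
  shows "A \<in> hyperoct_rotations"
proof -
  have neg: "- v \<in> hyperoct_vertices" if "v \<in> hyperoct_vertices" for v :: "real^'n"
    using that unfolding hyperoct_vertices_def by fastforce
  have "A *v v \<in> hyperoct_vertices" if v: "v \<in> hyperoct_vertices" for v
  proof -
    consider i where "v = axis i 1" | i where "v = - axis i 1"
      using v by (auto simp: hyperoct_vertices_def)
    then show ?thesis
      by cases (simp_all add: matrix_vector_mult_minus_right neg assms(2))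
  qed
  then have "(*v) A ` hyperoct_vertices \<subseteq> hyperoct_vertices"
    by blast
  moreover have "inj ((*v) A)"
    using assms(1) transpose_mult_vec_eq [of A] by (metis SO_iff injI)
  then have "inj_on ((*v) A) hyperoct_vertices"
    by (rule inj_on_subset) simp
  ultimately have "bij_betw ((*v) A) hyperoct_vertices hyperoct_vertices"
    unfolding bij_betw_def using endo_inj_surj [OF finite_hyperoct_vertices] by blast
  then show ?thesis
    using assms(1) by (simp add: hyperoct_rotations_def)
qed

lemma hyperoct_rotations_SO: "A \<in> hyperoct_rotations \<Longrightarrow> A \<in> SO"
  by (simp add: hyperoct_rotations_def)

lemma hyperoct_rotations_vertex:
  assumes "A \<in> hyperoct_rotations" "v \<in> hyperoct_vertices"
  shows "A *v v \<in> hyperoct_vertices"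
  using assms by (auto simp: hyperoct_rotations_def bij_betw_def)

lemma axis_in_vertices: "axis i 1 \<in> hyperoct_vertices" "- axis i 1 \<in> hyperoct_vertices"
  by (auto simp: hyperoct_vertices_def)

lemma hyperoct_rotations_one: "mat 1 \<in> hyperoct_rotations"
  by (intro hyperoct_rotationsI) (simp_all add: SO_one axis_in_vertices)

lemma hyperoct_rotations_mult:
  "A \<in> hyperoct_rotations \<Longrightarrow> B \<in> hyperoct_rotations \<Longrightarrow> A ** B \<in> hyperoct_rotations"
  by (intro hyperoct_rotationsI SO_mult)
    (simp_all add: hyperoct_rotations_SO hyperoct_rotations_vertex axis_in_vertices flip: matrix_vector_mul_assoc)

lemma hyperoct_rotations_transpose:
  assumes "A \<in> hyperoct_rotations"
  shows "transpose A \<in> hyperoct_rotations"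
proof (rule hyperoct_rotationsI)
  show "transpose A \<in> SO"
    using assms by (simp add: SO_transpose hyperoct_rotations_SO)
  fix i
  have "axis i 1 \<in> (*v) A ` hyperoct_vertices"
    using assms axis_in_vertices(1) [of i] by (simp add: hyperoct_rotations_def bij_betw_def)
  then obtain v where "v \<in> hyperoct_vertices" "A *v v = axis i 1"
    by (metis imageE)
  then show "transpose A *v axis i 1 \<in> hyperoct_vertices"
    using assms transpose_mult_vec_eq [of A v "axis i 1"] by (simp add: hyperoct_rotations_def SO_iff)
qed

lemma SO_path_class_eq: "homotopic_paths SO p q \<Longrightarrow> SO_path_class p = SO_path_class q"
  unfolding SO_path_class_def by (auto intro: homotopic_paths_trans homotopic_paths_sym)

text \<open>\<open>homotopic_paths SO p p\<close> encodes that \<open>p\<close> is a path in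
  \<open>SO\<close>; in this form closure under products and transposes is an instance of the
  homotopy lemmas below.\<close>

lemma hyperoct_paths_iff:
  "p \<in> hyperoct_paths \<longleftrightarrow> homotopic_paths SO p p \<and> p 0 = mat 1 \<and> p 1 \<in> hyperoct_rotations"
  by (auto simp: hyperoct_paths_def pathstart_def pathfinish_def)

lemma SO_path_class_eqD:
  "SO_path_class p = SO_path_class q \<Longrightarrow> q \<in> hyperoct_paths \<Longrightarrow> homotopic_paths SO p q"
  unfolding SO_path_class_def hyperoct_paths_iff by blast

lemma homotopic_paths_SO_mult:
  fixes p q :: "real \<Rightarrow> real^'n^'n"
  assumes "homotopic_paths SO p p'" "homotopic_paths SO q q'"
  shows "homotopic_paths SO (\<lambda>t. p t ** q t) (\<lambda>t. p' t ** q' t)"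
proof -
  let ?C = "{0..1::real} \<times> {0..1::real}"
  obtain H where H: "continuous_on ?C H" "H \<in> ?C \<rightarrow> SO"
    and H': "\<forall>t\<in>{0..1}. H (0, t) = p t" "\<forall>t\<in>{0..1}. H (1, t) = p' t"
    "\<forall>t\<in>{0..1}. pathstart (H \<circ> Pair t) = pathstart p
       \<and> pathfinish (H \<circ> Pair t) = pathfinish p"
    using assms(1) unfolding homotopic_paths by blast
  obtain K where K: "continuous_on ?C K" "K \<in> ?C \<rightarrow> SO"
    and K': "\<forall>t\<in>{0..1}. K (0, t) = q t" "\<forall>t\<in>{0..1}. K (1, t) = q' t"
    "\<forall>t\<in>{0..1}. pathstart (K \<circ> Pair t) = pathstart q
       \<and> pathfinish (K \<circ> Pair t) = pathfinish q"
    using assms(2) unfolding homotopic_paths by blast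
  show ?thesis
    unfolding homotopic_paths
  proof (intro exI conjI)
    show "continuous_on ?C (\<lambda>x. H x ** K x)"
      by (intro continuous_intros H K)
    show "(\<lambda>x. H x ** K x) \<in> ?C \<rightarrow> SO"
      using H K by (auto intro!: SO_mult)
  qed (use H' K' in \<open>auto simp: pathstart_def pathfinish_def\<close>)
qed

lemma homotopic_paths_SO_transpose:
  fixes p :: "real \<Rightarrow> real^'n^'n"
  assumes "homotopic_paths SO p q"
  shows "homotopic_paths SO (\<lambda>t. transpose (p t)) (\<lambda>t. transpose (q t))"
proof -
  have "homotopic_paths SO (transpose \<circ> p) (transpose \<circ> q)"
    using assms by (rule homotopic_paths_continuous_image) (auto intro!: continuous_intros SO_transpose)
  then show ?thesis
    by (simp add: o_def)
qed

text \<open>The concatenated product is itself a pointwise product of reparametrised paths: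
  \<open>q\<close> runs at double speed and then waits, while \<open>p\<close> waits and then runs
  at double speed.\<close>

lemma path_mult_homotopic:
  fixes p q :: "real \<Rightarrow> real^'n^'n"
  assumes "homotopic_paths SO p p" "homotopic_paths SO q q" "p 0 = mat 1"
  shows "homotopic_paths SO (\<lambda>t. p t ** q t) (path_mult p q)"
proof -
  define p' where "p' t = p (max 0 (2 * t - 1))" for t
  define q' where "q' t = q (min 1 (2 * t))" for t
  have "homotopic_paths SO p p'"
    using assms(1) by (intro homotopic_paths_reparametrize [where f = "\<lambda>t. max 0 (2 * t - 1)"])
      (auto simp: p'_def intro!: continuous_intros)
  moreover have "homotopic_paths SO q q'"
    using assms(2) by (intro homotopic_paths_reparametrize [where f = "\<lambda>t. min 1 (2 * t)"])
      (auto simp: q'_def intro!: continuous_intros)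
  ultimately have *: "homotopic_paths SO (\<lambda>t. p t ** q t) (\<lambda>t. p' t ** q' t)"
    by (rule homotopic_paths_SO_mult)
  have "p' t ** q' t = path_mult p q t" for t
    by (auto simp: path_mult_def p'_def q'_def assms(3) max_def min_def)
  with * show ?thesis
    by simp
qed

lemma hyperoct_paths_mult:
  "p \<in> hyperoct_paths \<Longrightarrow> q \<in> hyperoct_paths \<Longrightarrow> (\<lambda>t. p t ** q t) \<in> hyperoct_paths"
  by (simp add: hyperoct_paths_iff hyperoct_rotations_mult homotopic_paths_SO_mult del: homotopic_paths_refl)

lemma hyperoct_paths_transpose:
  "p \<in> hyperoct_paths \<Longrightarrow> (\<lambda>t. transpose (p t)) \<in> hyperoct_paths"
  by (simp add: hyperoct_paths_iff hyperoct_rotations_transpose homotopic_paths_SO_transpose del: homotopic_paths_refl)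

lemma hyperoct_paths_one: "(\<lambda>t. mat 1) \<in> hyperoct_paths"
  by (auto simp: hyperoct_paths_iff hyperoct_rotations_one path_def path_image_def SO_one)

lemma path_group_carrier: "carrier hyperoct_path_group = SO_path_class ` hyperoct_paths"
  by (simp add: hyperoct_path_group_def)

lemma path_group_one: "\<one>\<^bsub>hyperoct_path_group\<^esub> = SO_path_class (\<lambda>t. mat 1)"
  by (simp add: hyperoct_path_group_def)

text \<open>The product in the group is a union over all representatives; the classes that are
  united are all the same.\<close>

lemma path_group_mult:
  fixes p q :: "real \<Rightarrow> real^'n^'n"
  assumes "p \<in> hyperoct_paths" "q \<in> hyperoct_paths"
  shows "SO_path_class p \<otimes>\<^bsub>hyperoct_path_group\<^esub> SO_path_class q = SO_path_class (\<lambda>t. p t ** q t)"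
proof -
  have eq: "SO_path_class (path_mult R S) = SO_path_class (\<lambda>t. p t ** q t)"
    if "R \<in> SO_path_class p" "S \<in> SO_path_class q" for R S
  proof -
    have RS: "homotopic_paths SO p R" "homotopic_paths SO q S"
      using that by (auto simp: SO_path_class_def)
    then have "homotopic_paths SO R R" "homotopic_paths SO S S"
      by (meson homotopic_paths_sym homotopic_paths_trans)+
    moreover have "R 0 = mat 1"
      using homotopic_paths_imp_pathstart [OF RS(1)] assms(1) by (simp add: hyperoct_paths_iff pathstart_def)
    ultimately have "homotopic_paths SO (\<lambda>t. R t ** S t) (path_mult R S)"
      by (rule path_mult_homotopic)
    with homotopic_paths_SO_mult [OF RS] show ?thesis
      by (metis SO_path_class_eq)
  qed
  have "p \<in> SO_path_class p" "q \<in> SO_path_class q"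
    using assms by (simp_all add: SO_path_class_def hyperoct_paths_iff)
  then show ?thesis
    using eq by (simp add: hyperoct_path_group_def) blast
qed

lemma hyperoct_paths_orthogonal: "p \<in> hyperoct_paths \<Longrightarrow> t \<in> {0..1} \<Longrightarrow> orthogonal_matrix (p t)"
  by (auto simp: hyperoct_paths_iff path_image_def SO_iff image_subset_iff)

lemma SO_path_class_cong:
  assumes "p \<in> hyperoct_paths" "\<And>t. t \<in> {0..1} \<Longrightarrow> p t = q t"
  shows "SO_path_class p = SO_path_class q"
  using assms by (intro SO_path_class_eq homotopic_paths_eq) (auto simp: hyperoct_paths_iff)

lemma path_group_transpose:
  assumes "p \<in> hyperoct_paths"
  shows "SO_path_class (\<lambda>t. transpose (p t)) \<otimes>\<^bsub>hyperoct_path_group\<^esub> SO_path_class p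
    = \<one>\<^bsub>hyperoct_path_group\<^esub>"
  unfolding path_group_mult [OF hyperoct_paths_transpose [OF assms] assms] path_group_one
  by (intro SO_path_class_cong hyperoct_paths_mult hyperoct_paths_transpose assms)
    (simp add: orthogonal_matrix_transpose_mult hyperoct_paths_orthogonal assms)

lemma group_hyperoct_path_group: "group hyperoct_path_group"
proof (rule groupI)
  fix x :: "(real \<Rightarrow> real^'a^'a) set" assume "x \<in> carrier hyperoct_path_group"
  then show "\<exists>y\<in>carrier hyperoct_path_group. y \<otimes>\<^bsub>hyperoct_path_group\<^esub> x = \<one>\<^bsub>hyperoct_path_group\<^esub>"
    using path_group_transpose hyperoct_paths_transpose by (fastforce simp: path_group_carrier)
qed (auto simp: path_group_carrier path_group_mult hyperoct_paths_mult hyperoct_paths_one path_group_one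
    matrix_mul_assoc)

text \<open>The end-point of an arbitrary representative. Homotopies fix end-points, so the choice
  does not matter.\<close>

definition endpt :: "(real \<Rightarrow> real^'n^'n) set \<Rightarrow> real^'n^'n" where
  "endpt X = (SOME p. p \<in> X) 1"

lemma endpt_class:
  assumes "p \<in> hyperoct_paths"
  shows "endpt (SO_path_class p) = p 1"
proof -
  have "p \<in> SO_path_class p"
    using assms by (simp add: SO_path_class_def hyperoct_paths_iff)
  then have "(SOME q. q \<in> SO_path_class p) \<in> SO_path_class p"
    by (metis someI)
  then have "homotopic_paths SO p (SOME q. q \<in> SO_path_class p)"
    by (simp only: SO_path_class_def mem_Collect_eq)
  from homotopic_paths_imp_pathfinish [OF this] show ?thesis
    by (simp add: endpt_def pathfinish_def)
qed

lemma endpt_mult: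
  assumes "x \<in> carrier hyperoct_path_group" "y \<in> carrier hyperoct_path_group"
  shows "endpt (x \<otimes>\<^bsub>hyperoct_path_group\<^esub> y) = endpt x ** endpt y"
  using assms by (auto simp: path_group_carrier path_group_mult endpt_class hyperoct_paths_mult)

lemma endpt_one: "endpt \<one>\<^bsub>hyperoct_path_group\<^esub> = mat 1"
  by (simp add: path_group_one endpt_class hyperoct_paths_one)

lemma endpt_in: "x \<in> carrier hyperoct_path_group \<Longrightarrow> endpt x \<in> hyperoct_rotations"
  by (auto simp: path_group_carrier endpt_class hyperoct_paths_iff)

text \<open>Conjugate \<open>q t\<close> by \<open>p w\<close>, multiply by \<open>p t\<close>, and
  let \<open>w\<close> move from \<open>t\<close> to 1: for \<open>w = t\<close> the result is
  \<open>p t ** q t\<close>, for \<open>w = 1\<close> it is \<open>r t ** p t\<close>. The ends stay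
  fixed because \<open>q 0\<close> is the identity and because \<open>t = 1\<close> forces
  \<open>w = 1\<close>.\<close>

lemma path_group_conj:
  fixes p q r :: "real \<Rightarrow> real^'n^'n"
  assumes p: "p \<in> hyperoct_paths" and q: "q \<in> hyperoct_paths" and r: "r \<in> hyperoct_paths"
    and eq: "\<And>t. t \<in> {0..1} \<Longrightarrow> r t = p 1 ** q t ** transpose (p 1)"
  shows "SO_path_class p \<otimes>\<^bsub>hyperoct_path_group\<^esub> SO_path_class q
    = SO_path_class r \<otimes>\<^bsub>hyperoct_path_group\<^esub> SO_path_class p"
proof -
  let ?C = "{0..1::real} \<times> {0..1::real}"
  define w where "w x = snd x + fst x * (1 - snd x)" for x :: "real \<times> real"
  have w: "w x \<in> {0..1}" if "x \<in> ?C" for x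
  proof -
    have "0 \<le> fst x" "fst x \<le> 1" "0 \<le> snd x" "snd x \<le> 1"
      using that by auto
    moreover from this have "(1 - fst x) * (1 - snd x) \<ge> 0" "fst x * (1 - snd x) \<ge> 0"
      by (auto intro!: mult_nonneg_nonneg)
    ultimately show ?thesis
      by (auto simp: w_def algebra_simps)
  qed
  have cont: "continuous_on {0..1} p" "continuous_on {0..1} q"
    using p q by (auto simp: hyperoct_paths_iff path_def)
  have SO: "p t \<in> SO" "q t \<in> SO" if "t \<in> {0..1}" for t
    using p q that by (auto simp: hyperoct_paths_iff path_image_def)
  have cw: "continuous_on ?C w"
    unfolding w_def by (intro continuous_intros)
  have ends: "p 0 = mat 1" "q 0 = mat 1"
    using p q by (auto simp: hyperoct_paths_iff)
  have inv: "transpose (p t) ** p t = mat 1" "p t ** transpose (p t) = mat 1" if "t \<in> {0..1}" for t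
    using orthogonal_matrix_transpose_mult [OF hyperoct_paths_orthogonal [OF p that]] by auto
  have "homotopic_paths SO (\<lambda>t. p t ** q t) (\<lambda>t. r t ** p t)"
    unfolding homotopic_paths
  proof (intro exI conjI)
    let ?H = "\<lambda>x. p (w x) ** q (snd x) ** transpose (p (w x)) ** p (snd x)"
    show "continuous_on ?C ?H"
      using w by (intro continuous_intros continuous_on_compose2 [OF cont(1)]
          continuous_on_compose2 [OF cont(2)] cw) auto
    show "?H \<in> ?C \<rightarrow> SO"
      using w SO by (auto intro!: SO_mult SO_transpose)
    show "\<forall>t\<in>{0..1}. ?H (0, t) = p t ** q t"
      by (auto simp: w_def inv simp flip: matrix_mul_assoc)
    show "\<forall>t\<in>{0..1}. ?H (1, t) = r t ** p t"
      by (auto simp: w_def eq)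
    have "?H (s, 0) = p 0 ** q 0" if "s \<in> {0..1}" for s
      using that by (simp add: w_def ends inv)
    moreover have "?H (s, 1) = p 1 ** q 1" if "s \<in> {0..1}" for s
      by (simp add: w_def inv flip: matrix_mul_assoc)
    ultimately show "\<forall>t\<in>{0..1}. pathstart (?H \<circ> Pair t) = pathstart (\<lambda>t. p t ** q t)
       \<and> pathfinish (?H \<circ> Pair t) = pathfinish (\<lambda>t. p t ** q t)"
      by (simp add: pathstart_def pathfinish_def)
  qed
  then show ?thesis
    unfolding path_group_mult [OF p q] path_group_mult [OF r p] by (rule SO_path_class_eq)
qed

subsection \<open>The relations\<close>

lemma plane_rotation_fixes:
  assumes "i \<noteq> j" "v $ i = 0" "v $ j = 0"
  shows "plane_rotation i j \<theta> *v v = v"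
proof -
  have "(cos (\<theta> / 2) *\<^sub>R axis i 1 + sin (\<theta> / 2) *\<^sub>R axis j 1) \<bullet> v = 0" "axis i 1 \<bullet> v = 0"
    using assms by (auto simp: inner_add_left inner_axis' )
  then show ?thesis
    unfolding plane_rotation_reflm [OF assms(1)] by (simp add: reflm_mult_vec flip: matrix_vector_mul_assoc)
qed

text \<open>Reversing one of the two basis vectors of a plane reverses the sense of rotation, hence
  the factor \<open>a * b\<close> on the angle.\<close>

lemma plane_rotation_conj:
  fixes g :: "real^'n^'n"
  assumes g: "orthogonal_matrix g" and ij: "i \<noteq> j" and kl: "k \<noteq> l"
    and ab: "g *v axis i 1 = a *\<^sub>R axis k 1" "g *v axis j 1 = b *\<^sub>R axis l 1" "\<bar>a\<bar> = 1" "\<bar>b\<bar> = 1"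
  shows "g ** plane_rotation i j \<theta> ** transpose g = plane_rotation k l (a * b * \<theta>)"
proof -
  have "g ** plane_rotation i j \<theta> = plane_rotation k l (a * b * \<theta>) ** g"
  proof (rule matrix_eq_axis)
    fix m
    have cs: "cos (a * b * \<theta>) = cos \<theta>" "sin (a * b * \<theta>) = a * b * sin \<theta>"
      using ab(3,4) by (auto simp: abs_if split: if_splits)
    have sq: "a * a = 1" "b * b = 1"
      using ab(3,4) by (auto simp: abs_if split: if_splits)
    have ss: "a * (a * b * sin \<theta>) = b * sin \<theta>" "b * (a * b * sin \<theta>) = a * sin \<theta>"
      using sq by algebra+
    have "g *v (plane_rotation i j \<theta> *v axis m 1) = plane_rotation k l (a * b * \<theta>) *v (g *v axis m 1)"
    proof (cases "m = i \<or> m = j")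
      case True
      then show ?thesis
      proof
        assume "m = i"
        then show ?thesis
          by (simp add: plane_rotation_axis ij kl ab cs matrix_vector_right_distrib
             matrix_vector_mult_scaleR matrix_vector_mult_diff_distrib scaleR_add_right scaleR_diff_right ss; simp add: mult.commute)
      next
        assume "m = j"
        then show ?thesis
          by (simp add: plane_rotation_axis ij kl ab cs matrix_vector_right_distrib
             matrix_vector_mult_scaleR matrix_vector_mult_diff_distrib scaleR_add_right scaleR_diff_right ss; simp add: mult.commute)
      qed
    next
      case False
      have "(g *v axis m 1) \<bullet> (g *v axis i 1) = 0" "(g *v axis m 1) \<bullet> (g *v axis j 1) = 0"
        unfolding orthogonal_matrix_inner [OF g] using False by (auto simp: inner_axis_axis)
      then have "(g *v axis m 1) $ k = 0" "(g *v axis m 1) $ l = 0"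
        using sq by (auto simp: ab inner_axis)
      then show ?thesis
        using False by (simp add: plane_rotation_axis ij plane_rotation_fixes kl)
    qed
    then show "(g ** plane_rotation i j \<theta>) *v axis m 1 = (plane_rotation k l (a * b * \<theta>) ** g) *v axis m 1"
      by (simp add: matrix_vector_mul_assoc)
  qed
  then show ?thesis
    by (simp add: orthogonal_matrix_transpose_mult [OF g] flip: matrix_mul_assoc)
qed

lemma plane_rotation_add:
  assumes "i \<noteq> j"
  shows "plane_rotation i j \<theta> ** plane_rotation i j \<phi> = plane_rotation i j (\<theta> + \<phi>)"
proof (rule matrix_eq_axis)
  fix m
  show "(plane_rotation i j \<theta> ** plane_rotation i j \<phi>) *v axis m 1 = plane_rotation i j (\<theta> + \<phi>) *v axis m 1"
    using assms by (cases "m = i"; cases "m = j")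
      (auto simp: plane_rotation_axis matrix_vector_right_distrib matrix_vector_mult_scaleR
         cos_add sin_add algebra_simps simp flip: matrix_vector_mul_assoc)
qed

section \<open>Turns in a coordinate plane as elements of the path group\<close>

definition turn_path :: "'n \<Rightarrow> 'n \<Rightarrow> real \<Rightarrow> real \<Rightarrow> real^'n^'n" where
  "turn_path i j c t = plane_rotation i j (c * t)"

lemma R_path_eq: "R_path i j = turn_path i j (pi / 2)"
  by (simp add: R_path_def turn_path_def fun_eq_iff mult.commute)

lemma turn_path_hyperoct:
  assumes "i \<noteq> j" "plane_rotation i j c \<in> hyperoct_rotations"
  shows "turn_path i j c \<in> hyperoct_paths"
  using assms unfolding hyperoct_paths_iff turn_path_def
  by (auto simp: path_def path_image_def plane_rotation_0 plane_rotation_in_SO intro!: continuous_intros)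

lemma plane_rotation_quarter:
  assumes "i \<noteq> j"
  shows "plane_rotation i j (pi / 2) *v axis i 1 = axis j 1"
    "plane_rotation i j (pi / 2) *v axis j 1 = - axis i 1"
    "l \<noteq> i \<Longrightarrow> l \<noteq> j \<Longrightarrow> plane_rotation i j (pi / 2) *v axis l 1 = axis l 1"
  using assms by (auto simp: plane_rotation_axis)

lemma plane_rotation_quarter_hyperoct:
  assumes "i \<noteq> j"
  shows "plane_rotation i j (pi / 2) \<in> hyperoct_rotations"
proof (rule hyperoct_rotationsI)
  show "plane_rotation i j (pi / 2) *v axis l 1 \<in> hyperoct_vertices" for l
    using assms by (cases "l = i"; cases "l = j") (auto simp: plane_rotation_quarter axis_in_vertices)
qed (simp add: assms plane_rotation_in_SO)

lemma plane_rotation_quarters_hyperoct: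
  assumes "i \<noteq> j"
  shows "plane_rotation i j (real k * (pi / 2)) \<in> hyperoct_rotations"
proof (induction k)
  case (Suc k)
  have "plane_rotation i j (real (Suc k) * (pi / 2))
      = plane_rotation i j (pi / 2) ** plane_rotation i j (real k * (pi / 2))"
    unfolding plane_rotation_add [OF assms] by (simp add: algebra_simps add_divide_distrib)
  then show ?case
    using Suc hyperoct_rotations_mult plane_rotation_quarter_hyperoct [OF assms] by metis
qed (simp add: plane_rotation_0 hyperoct_rotations_one)

lemma R_path_hyperoct: "i \<noteq> j \<Longrightarrow> R_path i j \<in> hyperoct_paths"
  by (simp add: R_path_eq turn_path_hyperoct plane_rotation_quarter_hyperoct)

lemma turn_path_hyperoct_neg:
  assumes "i \<noteq> j" "turn_path i j c \<in> hyperoct_paths"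
  shows "turn_path i j (- c) \<in> hyperoct_paths"
proof (rule turn_path_hyperoct)
  have "transpose (plane_rotation i j c) = transpose (plane_rotation i j c) ** (plane_rotation i j c ** plane_rotation i j (- c))"
    by (simp add: plane_rotation_add assms plane_rotation_0)
  also have "\<dots> = plane_rotation i j (- c)"
    by (simp add: matrix_mul_assoc orthogonal_matrix_transpose_mult orthogonal_plane_rotation assms)
  finally show "plane_rotation i j (- c) \<in> hyperoct_rotations"
    using assms(2) hyperoct_rotations_transpose [of "plane_rotation i j c"] by (simp add: hyperoct_paths_iff turn_path_def)
qed (rule assms)

lemma turn_path_class_add:
  assumes "i \<noteq> j" "turn_path i j a \<in> hyperoct_paths" "turn_path i j b \<in> hyperoct_paths"
  shows "SO_path_class (turn_path i j a) \<otimes>\<^bsub>hyperoct_path_group\<^esub> SO_path_class (turn_path i j b)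
    = SO_path_class (turn_path i j (a + b))"
  unfolding path_group_mult [OF assms(2,3)]
  by (rule arg_cong [where f = SO_path_class])
    (simp add: fun_eq_iff turn_path_def plane_rotation_add assms algebra_simps)

lemma R_path_class_pow:
  assumes "i \<noteq> j"
  shows "SO_path_class (R_path i j) [^]\<^bsub>hyperoct_path_group\<^esub> (k::nat) = SO_path_class (turn_path i j (real k * (pi / 2)))"
proof (induction k)
  case 0
  then show ?case
    by (simp add: path_group_one turn_path_def [abs_def] plane_rotation_0)
next
  case (Suc k)
  have "turn_path i j (real k * (pi / 2)) \<in> hyperoct_paths"
    by (intro turn_path_hyperoct plane_rotation_quarters_hyperoct assms)
  then show ?case
    using turn_path_class_add [OF assms _ R_path_hyperoct [OF assms, unfolded R_path_eq]] Suc
    by (simp add: R_path_eq algebra_simps add_divide_distrib)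
qed

text \<open>Conjugation by \<open>a\<close> takes \<open>b\<close> to the quarter turn
  \<open>r\<close> from \<open>z\<close> to \<open>x\<close>, and conjugation by \<open>b\<close>
  takes \<open>r\<close> to \<open>a\<close>. Thus \<open>a b = r a\<close> and
  \<open>b r = a b\<close>, so that \<open>b a b = b r a = a b a\<close>.\<close>

lemma R_path_braid:
  fixes x y z :: "'n::finite"
  assumes xyz: "x \<noteq> y" "y \<noteq> z" "x \<noteq> z"
  defines "a \<equiv> SO_path_class (R_path x y)" and "b \<equiv> SO_path_class (R_path y z)"
  shows "a \<otimes>\<^bsub>hyperoct_path_group\<^esub> (b \<otimes>\<^bsub>hyperoct_path_group\<^esub> a)
    = b \<otimes>\<^bsub>hyperoct_path_group\<^esub> (a \<otimes>\<^bsub>hyperoct_path_group\<^esub> b)"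
proof -
  interpret group hyperoct_path_group
    by (rule group_hyperoct_path_group)
  define r where "r = SO_path_class (turn_path x z (- (pi / 2)))"
  have rp: "turn_path x z (- (pi / 2)) \<in> hyperoct_paths"
    using R_path_hyperoct [OF xyz(3)] by (intro turn_path_hyperoct_neg xyz) (simp add: R_path_eq)
  have car: "a \<in> carrier hyperoct_path_group" "b \<in> carrier hyperoct_path_group" "r \<in> carrier hyperoct_path_group"
    using xyz rp by (auto simp: a_def b_def r_def path_group_carrier intro!: imageI R_path_hyperoct)
  have "plane_rotation x y (pi / 2) ** plane_rotation y z \<theta> ** transpose (plane_rotation x y (pi / 2))
      = plane_rotation x z (- 1 * 1 * \<theta>)" for \<theta>
    using xyz by (intro plane_rotation_conj orthogonal_plane_rotation) (auto simp: plane_rotation_quarter)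
  then have 1: "a \<otimes>\<^bsub>hyperoct_path_group\<^esub> b = r \<otimes>\<^bsub>hyperoct_path_group\<^esub> a"
    unfolding a_def b_def r_def using xyz rp
    by (intro path_group_conj R_path_hyperoct) (auto simp: R_path_eq turn_path_def)
  have "plane_rotation y z (pi / 2) ** plane_rotation x z \<theta> ** transpose (plane_rotation y z (pi / 2))
      = plane_rotation x y (1 * - 1 * \<theta>)" for \<theta>
    using xyz by (intro plane_rotation_conj orthogonal_plane_rotation) (auto simp: plane_rotation_quarter)
  then have 2: "b \<otimes>\<^bsub>hyperoct_path_group\<^esub> r = a \<otimes>\<^bsub>hyperoct_path_group\<^esub> b"
    unfolding a_def b_def r_def using xyz rp
    by (intro path_group_conj R_path_hyperoct) (auto simp: R_path_eq turn_path_def)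
  show ?thesis
    using 1 2 car by (metis m_assoc)
qed

lemma R_path_commute:
  fixes x y :: "'n::finite"
  assumes "x \<noteq> y" "u \<noteq> v" "{x, y} \<inter> {u, v} = {}"
  shows "SO_path_class (R_path x y) \<otimes>\<^bsub>hyperoct_path_group\<^esub> SO_path_class (R_path u v)
    = SO_path_class (R_path u v) \<otimes>\<^bsub>hyperoct_path_group\<^esub> SO_path_class (R_path x y)"
proof -
  have "plane_rotation x y (pi / 2) ** plane_rotation u v \<theta> ** transpose (plane_rotation x y (pi / 2))
      = plane_rotation u v (1 * 1 * \<theta>)" for \<theta>
    using assms by (intro plane_rotation_conj orthogonal_plane_rotation) (auto simp: plane_rotation_quarter)
  then show ?thesis
    using assms by (intro path_group_conj R_path_hyperoct) (auto simp: R_path_eq turn_path_def)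
qed

text \<open>The end-point of \<open>a a\<close> is a half turn that negates \<open>axis y 1\<close>
  and fixes \<open>axis z 1\<close>, so conjugation by \<open>a a\<close> inverts \<open>b\<close>;
  the inverse is \<open>r\<close>.\<close>

lemma R_path_square_relation:
  fixes x y z :: "'n::finite"
  assumes xyz: "x \<noteq> y" "y \<noteq> z" "x \<noteq> z"
  defines "a \<equiv> SO_path_class (R_path x y)" and "b \<equiv> SO_path_class (R_path y z)"
  shows "a \<otimes>\<^bsub>hyperoct_path_group\<^esub> a
    = b \<otimes>\<^bsub>hyperoct_path_group\<^esub> (a \<otimes>\<^bsub>hyperoct_path_group\<^esub> (a \<otimes>\<^bsub>hyperoct_path_group\<^esub> b))"
proof -
  interpret group hyperoct_path_group
    by (rule group_hyperoct_path_group)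
  define r where "r = SO_path_class (turn_path y z (- (pi / 2)))"
  have rp: "turn_path y z (- (pi / 2)) \<in> hyperoct_paths"
    using R_path_hyperoct [OF xyz(2)] by (intro turn_path_hyperoct_neg xyz) (simp add: R_path_eq)
  have car: "a \<in> carrier hyperoct_path_group" "b \<in> carrier hyperoct_path_group" "r \<in> carrier hyperoct_path_group"
    using xyz rp by (auto simp: a_def b_def r_def path_group_carrier intro!: imageI R_path_hyperoct)
  have aa: "a \<otimes>\<^bsub>hyperoct_path_group\<^esub> a = SO_path_class (\<lambda>t. R_path x y t ** R_path x y t)"
    unfolding a_def using xyz by (intro path_group_mult R_path_hyperoct)
  let ?g = "plane_rotation x y (pi / 2) ** plane_rotation x y (pi / 2)"
  have g: "orthogonal_matrix ?g" "?g *v axis y 1 = - axis y 1" "?g *v axis z 1 = axis z 1"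
    using xyz by (auto simp: orthogonal_matrix_mul orthogonal_plane_rotation plane_rotation_add plane_rotation_axis)
  have "?g ** plane_rotation y z \<theta> ** transpose ?g = plane_rotation y z (- 1 * 1 * \<theta>)" for \<theta>
    using xyz g by (intro plane_rotation_conj) auto
  then have 1: "(a \<otimes>\<^bsub>hyperoct_path_group\<^esub> a) \<otimes>\<^bsub>hyperoct_path_group\<^esub> b
      = r \<otimes>\<^bsub>hyperoct_path_group\<^esub> (a \<otimes>\<^bsub>hyperoct_path_group\<^esub> a)"
    unfolding aa b_def r_def using xyz rp
    by (intro path_group_conj R_path_hyperoct hyperoct_paths_mult) (auto simp: R_path_eq turn_path_def)
  have "b \<otimes>\<^bsub>hyperoct_path_group\<^esub> r = SO_path_class (turn_path y z (pi / 2 + - (pi / 2)))"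
    unfolding b_def r_def R_path_eq using xyz rp R_path_hyperoct [of y z]
    by (intro turn_path_class_add) (auto simp: R_path_eq)
  then have 2: "b \<otimes>\<^bsub>hyperoct_path_group\<^esub> r = \<one>\<^bsub>hyperoct_path_group\<^esub>"
    by (simp add: path_group_one turn_path_def [abs_def] plane_rotation_0)
  have "b \<otimes>\<^bsub>hyperoct_path_group\<^esub> (a \<otimes>\<^bsub>hyperoct_path_group\<^esub> (a \<otimes>\<^bsub>hyperoct_path_group\<^esub> b))
      = (b \<otimes>\<^bsub>hyperoct_path_group\<^esub> r) \<otimes>\<^bsub>hyperoct_path_group\<^esub> (a \<otimes>\<^bsub>hyperoct_path_group\<^esub> a)"
    using 1 car by (simp add: m_assoc)
  then show ?thesis
    using 2 car by simp
qed

subsection \<open>Consequences of the relations\<close>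

text \<open>Conjugation by \<open>w\<close>, phrased without inverses so that its hypotheses can be
  checked as identities between words.\<close>

lemma (in group) square_relation_transport:
  assumes car: "w \<in> carrier G" "a \<in> carrier G" "b \<in> carrier G" "a' \<in> carrier G" "b' \<in> carrier G"
    and wa: "w \<otimes> a = a' \<otimes> w" and wb: "w \<otimes> b = b' \<otimes> w"
    and sq: "a \<otimes> a = b \<otimes> (a \<otimes> (a \<otimes> b))"
  shows "a' \<otimes> a' = b' \<otimes> (a' \<otimes> (a' \<otimes> b'))"
proof -
  have wa': "w \<otimes> (a \<otimes> x) = a' \<otimes> (w \<otimes> x)" and wb': "w \<otimes> (b \<otimes> x) = b' \<otimes> (w \<otimes> x)" if "x \<in> carrier G" for x
    using that car wa wb by (simp_all flip: m_assoc)
  have "(a' \<otimes> a') \<otimes> w = w \<otimes> (a \<otimes> a)"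
    using car by (simp add: wa' wa m_assoc)
  also have "\<dots> = (b' \<otimes> (a' \<otimes> (a' \<otimes> b'))) \<otimes> w"
    unfolding sq using car by (simp add: wa' wb' wb m_assoc)
  finally show ?thesis
    using car by simp
qed

text \<open>By the braid relation, conjugation by \<open>a b a\<close> exchanges \<open>a\<close>
  and \<open>b\<close>.\<close>

lemma (in group) square_relation_swap:
  assumes car: "a \<in> carrier G" "b \<in> carrier G"
    and braid: "a \<otimes> (b \<otimes> a) = b \<otimes> (a \<otimes> b)"
    and sq: "a \<otimes> a = b \<otimes> (a \<otimes> (a \<otimes> b))"
  shows "b \<otimes> b = a \<otimes> (b \<otimes> (b \<otimes> a))"
proof (rule square_relation_transport [of "a \<otimes> (b \<otimes> a)" a b])
  have "a \<otimes> (b \<otimes> a) \<otimes> a = b \<otimes> (a \<otimes> b) \<otimes> a"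
    by (simp only: braid)
  then show "a \<otimes> (b \<otimes> a) \<otimes> a = b \<otimes> (a \<otimes> (b \<otimes> a))"
    using car by (simp only: m_assoc m_closed)
  have "a \<otimes> (b \<otimes> a) \<otimes> b = a \<otimes> (b \<otimes> (a \<otimes> b))"
    using car by (simp only: m_assoc m_closed)
  then show "a \<otimes> (b \<otimes> a) \<otimes> b = a \<otimes> (a \<otimes> (b \<otimes> a))"
    by (simp only: braid)
qed (use car sq in auto)

text \<open>With \<open>x = a\<^sup>2\<close> and \<open>y = b\<^sup>2\<close> the two square relations give \<open>y x y = x\<close> and \<open>x y x = y\<close>.\<close>

lemma (in group) square_relation_fourth_powers:
  assumes car: "a \<in> carrier G" "b \<in> carrier G"
    and ab: "a \<otimes> a = b \<otimes> (a \<otimes> (a \<otimes> b))" and ba: "b \<otimes> b = a \<otimes> (b \<otimes> (b \<otimes> a))"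
  shows "(a \<otimes> a) \<otimes> (a \<otimes> a) = (b \<otimes> b) \<otimes> (b \<otimes> b)"
    and "((a \<otimes> a) \<otimes> (a \<otimes> a)) \<otimes> ((a \<otimes> a) \<otimes> (a \<otimes> a)) = \<one>"
proof -
  define x where "x = a \<otimes> a"
  define y where "y = b \<otimes> b"
  have xy: "x \<in> carrier G" "y \<in> carrier G"
    using car by (auto simp: x_def y_def)
  have "b \<otimes> (x \<otimes> b) = b \<otimes> (a \<otimes> (a \<otimes> b))" "a \<otimes> (y \<otimes> a) = a \<otimes> (b \<otimes> (b \<otimes> a))"
    using car by (simp_all add: x_def y_def m_assoc)
  then have bx: "b \<otimes> (x \<otimes> b) = x" and ay: "a \<otimes> (y \<otimes> a) = y"
    by (simp_all only: ab [symmetric] ba [symmetric]) (simp_all only: x_def y_def)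
  have "y \<otimes> (x \<otimes> y) = b \<otimes> ((b \<otimes> (x \<otimes> b)) \<otimes> b)"
    using car xy by (simp add: y_def m_assoc)
  then have yxy: "y \<otimes> (x \<otimes> y) = x"
    using bx by simp
  have "x \<otimes> (y \<otimes> x) = a \<otimes> ((a \<otimes> (y \<otimes> a)) \<otimes> a)"
    using car xy by (simp add: x_def m_assoc)
  then have xyx: "x \<otimes> (y \<otimes> x) = y"
    using ay by simp
  have "(y \<otimes> (x \<otimes> (x \<otimes> y))) \<otimes> x = y \<otimes> (x \<otimes> (x \<otimes> (y \<otimes> x)))"
    using xy by (simp add: m_assoc)
  also have "\<dots> = x"
    by (simp add: xyx yxy)
  finally have yxxy: "y \<otimes> (x \<otimes> (x \<otimes> y)) = \<one>"
    using xy by simp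
  have "y \<otimes> (x \<otimes> (x \<otimes> (y \<otimes> y))) = (y \<otimes> (x \<otimes> (x \<otimes> y))) \<otimes> y"
    using xy by (simp add: m_assoc)
  also have "\<dots> = y"
    using xy by (simp add: yxxy)
  finally have xxyy: "x \<otimes> (x \<otimes> (y \<otimes> y)) = \<one>"
    using xy by simp
  have "x \<otimes> x = (y \<otimes> (x \<otimes> y)) \<otimes> x"
    by (simp only: yxy)
  also have "\<dots> = y \<otimes> (x \<otimes> (y \<otimes> x))"
    using xy by (simp only: m_assoc m_closed)
  also have "\<dots> = y \<otimes> y"
    by (simp only: xyx)
  finally have eq: "x \<otimes> x = y \<otimes> y" .
  then show "(a \<otimes> a) \<otimes> (a \<otimes> a) = (b \<otimes> b) \<otimes> (b \<otimes> b)"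
    by (simp add: x_def y_def)
  have "(x \<otimes> x) \<otimes> (x \<otimes> x) = x \<otimes> (x \<otimes> (y \<otimes> y))"
    using xy by (simp only: m_assoc eq [symmetric] m_closed)
  also have "\<dots> = \<one>"
    by (rule xxyy)
  finally have "(x \<otimes> x) \<otimes> (x \<otimes> x) = \<one>" .
  then show "((a \<otimes> a) \<otimes> (a \<otimes> a)) \<otimes> ((a \<otimes> a) \<otimes> (a \<otimes> a)) = \<one>"
    by (simp add: x_def)
qed

text \<open>Both the presented group and the path group are instances, so every consequence of the
  relations becomes available on both sides of the isomorphism.\<close>

locale hyperoct_relations = group G for G (structure) +
  fixes r :: "nat \<Rightarrow> 'a" and n :: nat
  assumes n3: "n \<ge> 3"
    and r_closed: "1 \<le> i \<Longrightarrow> i < n \<Longrightarrow> r i \<in> carrier G"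
    and braid: "1 \<le> i \<Longrightarrow> Suc i < n \<Longrightarrow> r i \<otimes> (r (Suc i) \<otimes> r i) = r (Suc i) \<otimes> (r i \<otimes> r (Suc i))"
    and far_commute: "1 \<le> i \<Longrightarrow> Suc i < j \<Longrightarrow> j < n \<Longrightarrow> r i \<otimes> r j = r j \<otimes> r i"
    and square: "r 1 \<otimes> r 1 = r 2 \<otimes> (r 1 \<otimes> (r 1 \<otimes> r 2))"
begin

definition sq :: "nat \<Rightarrow> 'a" where "sq i = r i \<otimes> r i"

definition z :: 'a where "z = sq 1 \<otimes> sq 1"

lemma sq_closed: "1 \<le> i \<Longrightarrow> i < n \<Longrightarrow> sq i \<in> carrier G"
  by (simp add: sq_def r_closed)

lemma z_closed [simp]: "z \<in> carrier G"
  using n3 by (simp add: z_def sq_closed)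

text \<open>Conjugation by the product of three consecutive generators shifts the pair of its first
  two generators to the pair of its last two. In this way the single square relation spreads to all
  indices.\<close>

lemma square_up: "1 \<le> i \<Longrightarrow> Suc i < n \<Longrightarrow> r i \<otimes> r i = r (Suc i) \<otimes> (r i \<otimes> (r i \<otimes> r (Suc i)))"
proof (induction i rule: dec_induct)
  case base
  then show ?case
    using square by (simp add: numeral_2_eq_2)
next
  case (step i)
  have car: "r i \<in> carrier G" "r (Suc i) \<in> carrier G" "r (Suc (Suc i)) \<in> carrier G"
    using step by (auto intro!: r_closed)
  have far: "r i \<otimes> r (Suc (Suc i)) = r (Suc (Suc i)) \<otimes> r i"
    using step by (intro far_commute) auto
  let ?w = "r i \<otimes> (r (Suc i) \<otimes> r (Suc (Suc i)))"
  have "?w \<otimes> r i = (r i \<otimes> (r (Suc i) \<otimes> r i)) \<otimes> r (Suc (Suc i))"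
    using car by (simp add: m_assoc far)
  also have "\<dots> = r (Suc i) \<otimes> ?w"
    using car step braid [of i] by (simp add: m_assoc)
  finally have 1: "?w \<otimes> r i = r (Suc i) \<otimes> ?w" .
  have "?w \<otimes> r (Suc i) = r i \<otimes> (r (Suc i) \<otimes> (r (Suc (Suc i)) \<otimes> r (Suc i)))"
    using car by (simp add: m_assoc)
  also have "\<dots> = (r i \<otimes> r (Suc (Suc i))) \<otimes> (r (Suc i) \<otimes> r (Suc (Suc i)))"
    using car step braid [of "Suc i"] by (simp add: m_assoc)
  also have "\<dots> = r (Suc (Suc i)) \<otimes> ?w"
    using car unfolding far by (simp add: m_assoc)
  finally have 2: "?w \<otimes> r (Suc i) = r (Suc (Suc i)) \<otimes> ?w" .
  show ?case
    using step car by (intro square_relation_transport [OF _ _ _ _ _ 1 2]) auto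
qed

lemma square_down:
  assumes "1 \<le> i" "Suc i < n"
  shows "r (Suc i) \<otimes> r (Suc i) = r i \<otimes> (r (Suc i) \<otimes> (r (Suc i) \<otimes> r i))"
  by (rule square_relation_swap [OF _ _ braid square_up]) (use assms in \<open>auto simp: r_closed\<close>)

lemma fourth_power: "1 \<le> i \<Longrightarrow> i < n \<Longrightarrow> sq i \<otimes> sq i = z"
proof (induction i rule: dec_induct)
  case (step i)
  then have "sq i \<otimes> sq i = sq (Suc i) \<otimes> sq (Suc i)"
    unfolding sq_def
    by (intro square_relation_fourth_powers(1) [OF _ _ square_up square_down]) (auto simp: r_closed)
  with step show ?case by simp
qed (simp add: z_def)

lemma z_square: "z \<otimes> z = \<one>"
  unfolding z_def sq_def using n3
  by (intro square_relation_fourth_powers(2) [OF _ _ square_up square_down]) (auto simp: r_closed)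

lemma z_commute_r: "1 \<le> i \<Longrightarrow> i < n \<Longrightarrow> z \<otimes> r i = r i \<otimes> z"
proof -
  assume i: "1 \<le> i" "i < n"
  then have "(sq i \<otimes> sq i) \<otimes> r i = r i \<otimes> (sq i \<otimes> sq i)"
    by (simp add: sq_def m_assoc r_closed)
  then show ?thesis
    using i by (simp only: fourth_power)
qed

lemma sq_up: "1 \<le> i \<Longrightarrow> Suc i < n \<Longrightarrow> r (Suc i) \<otimes> (sq i \<otimes> r (Suc i)) = sq i"
proof -
  assume i: "1 \<le> i" "Suc i < n"
  then have "r (Suc i) \<otimes> (sq i \<otimes> r (Suc i)) = r (Suc i) \<otimes> (r i \<otimes> (r i \<otimes> r (Suc i)))"
    by (simp add: sq_def m_assoc r_closed)
  also have "\<dots> = sq i"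
    unfolding sq_def using i by (rule square_up [symmetric])
  finally show ?thesis .
qed

lemma sq_down: "1 \<le> i \<Longrightarrow> Suc i < n \<Longrightarrow> r i \<otimes> (sq (Suc i) \<otimes> r i) = sq (Suc i)"
proof -
  assume i: "1 \<le> i" "Suc i < n"
  then have "r i \<otimes> (sq (Suc i) \<otimes> r i) = r i \<otimes> (r (Suc i) \<otimes> (r (Suc i) \<otimes> r i))"
    by (simp add: sq_def m_assoc r_closed)
  also have "\<dots> = sq (Suc i)"
    unfolding sq_def using i by (rule square_down [symmetric])
  finally show ?thesis .
qed

text \<open>The fourth power \<open>z\<close> is its own inverse. Inverses of generators are
  therefore positive words, which is why \<open>P\<close> can be built without inverses.\<close>

lemma r_inverse:
  assumes "1 \<le> i" "i < n"
  shows "inv (r i) = z \<otimes> (sq i \<otimes> r i)"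
proof (rule inv_equality)
  have "z \<otimes> (sq i \<otimes> r i) \<otimes> r i = z \<otimes> (sq i \<otimes> sq i)"
    using assms by (simp add: sq_def m_assoc r_closed)
  then show "z \<otimes> (sq i \<otimes> r i) \<otimes> r i = \<one>"
    by (simp only: fourth_power [OF assms] z_square)
qed (use assms in \<open>auto simp: r_closed sq_closed\<close>)

text \<open>Positive words in the generators with index below \<open>k\<close>, which involve only
  the first \<open>k\<close> coordinates. Letters are added on the left, matching the left action on
  coset representatives.\<close>

inductive_set P :: "nat \<Rightarrow> 'a set" for k :: nat where
  one: "\<one> \<in> P k"
| step: "1 \<le> i \<Longrightarrow> i < k \<Longrightarrow> p \<in> P k \<Longrightarrow> r i \<otimes> p \<in> P k"

lemma P_closed: "p \<in> P k \<Longrightarrow> k \<le> n \<Longrightarrow> p \<in> carrier G"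
  by (induction rule: P.induct) (auto simp: r_closed)

lemma P_mult:
  assumes "k \<le> n" "p \<in> P k" "q \<in> P k"
  shows "p \<otimes> q \<in> P k"
  using assms(2)
proof (induction rule: P.induct)
  case one
  then show ?case using assms P_closed by simp
next
  case (step i p)
  then show ?case
    using assms P_closed [of _ k] P.step [of i k "p \<otimes> q"] by (simp add: m_assoc r_closed)
qed

lemma r_in_P: "1 \<le> i \<Longrightarrow> i < k \<Longrightarrow> k \<le> n \<Longrightarrow> r i \<in> P k"
  using P.step [OF _ _ P.one, of i k] by (simp add: r_closed)

lemma sq_in_P: "1 \<le> i \<Longrightarrow> i < k \<Longrightarrow> k \<le> n \<Longrightarrow> sq i \<in> P k"
  unfolding sq_def by (intro P_mult r_in_P)

lemma z_in_P: "2 \<le> k \<Longrightarrow> k \<le> n \<Longrightarrow> z \<in> P k"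
  unfolding z_def by (intro P_mult sq_in_P) auto

lemma inv_r_in_P: "1 \<le> i \<Longrightarrow> i < k \<Longrightarrow> k \<le> n \<Longrightarrow> inv (r i) \<in> P k"
  by (simp add: r_inverse) (intro P_mult z_in_P sq_in_P r_in_P; simp)

lemma generate_subset_P: "generate G (r ` {1..n - 1}) \<subseteq> P n"
proof
  fix w assume "w \<in> generate G (r ` {1..n - 1})"
  then show "w \<in> P n"
    by (induction rule: generate.induct)
      (use n3 in \<open>auto intro!: P.one r_in_P inv_r_in_P P_mult\<close>)
qed

text \<open>The cosets of \<open>P k\<close> in \<open>P (Suc k)\<close> are represented by \<open>c\<close> and \<open>c r\<^sub>k\<^sup>2\<close> where
  \<open>c = r\<^sub>j \<cdots> r\<^sub>k\<close>; here \<open>rep k m\<close> is the product of the \<open>m\<close> factors with \<open>j = k + 1 - m\<close>.\<close>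

fun rep :: "nat \<Rightarrow> nat \<Rightarrow> 'a" where
  "rep k 0 = \<one>"
| "rep k (Suc m) = r (k - m) \<otimes> rep k m"

text \<open>The candidate for the stabilizer of the pair of opposite vertices with index
  \<open>k + 1\<close>: \<open>P k\<close> fixes both and \<open>sq k\<close> exchanges
  them.\<close>

definition Q :: "nat \<Rightarrow> 'a set" where
  "Q k = P k \<union> {sq k \<otimes> p | p. p \<in> P k}"

context
  fixes k assumes k: "2 \<le> k" "k < n"
begin

lemma rep_closed: "m \<le> k \<Longrightarrow> rep k m \<in> carrier G"
  using k by (induction m) (auto simp: r_closed)

lemma Q_closed: "q \<in> Q k \<Longrightarrow> q \<in> carrier G"
  using k P_closed [of _ k] by (auto simp: Q_def sq_closed)

lemma far_commute_sym:
  assumes "1 \<le> i" "i < n" "1 \<le> j" "j < n" "Suc i < j \<or> Suc j < i"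
  shows "r i \<otimes> r j = r j \<otimes> r i"
  using assms far_commute [of i j] far_commute [of j i] by auto

text \<open>\<open>sq k\<close> commutes with \<open>r i\<close> for \<open>i < k - 1\<close> and,
  by \<open>sq_down\<close>, conjugates \<open>r (k - 1)\<close> to its inverse, which again lies in
  \<open>P k\<close>.\<close>

lemma P_sq:
  assumes "p \<in> P k"
  shows "\<exists>p'\<in>P k. p \<otimes> sq k = sq k \<otimes> p'"
  using assms
proof (induction rule: P.induct)
  case one
  then show ?case
    using k by (auto intro!: bexI [of _ \<one>] P.one simp: sq_closed)
next
  case (step i p)
  then obtain p' where p': "p' \<in> P k" "p \<otimes> sq k = sq k \<otimes> p'"
    by blast
  have car: "r i \<in> carrier G" "r k \<in> carrier G" "sq k \<in> carrier G" "p \<in> carrier G" "p' \<in> carrier G"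
    using step k p' P_closed [of _ k] by (auto simp: r_closed sq_closed)
  have "\<exists>g\<in>P k. r i \<otimes> sq k = sq k \<otimes> g"
  proof (cases "Suc i = k")
    case True
    have "r i \<otimes> (sq k \<otimes> r i) = sq k"
      using sq_down [of i] True step k by simp
    then have "sq k \<otimes> inv (r i) = r i \<otimes> (sq k \<otimes> r i) \<otimes> inv (r i)"
      by simp
    also have "\<dots> = r i \<otimes> sq k"
      using car by (simp add: m_assoc)
    finally have "r i \<otimes> sq k = sq k \<otimes> inv (r i)" ..
    moreover have "inv (r i) \<in> P k"
      using step k by (intro inv_r_in_P) auto
    ultimately show ?thesis
      by blast
  next
    case False
    then have c: "r i \<otimes> r k = r k \<otimes> r i"
      using step k by (intro far_commute) auto
    have "r i \<otimes> sq k = (r i \<otimes> r k) \<otimes> r k"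
      using car by (simp add: sq_def m_assoc)
    also have "\<dots> = (r k \<otimes> r i) \<otimes> r k"
      by (simp only: c)
    also have "\<dots> = r k \<otimes> (r i \<otimes> r k)"
      using car by (simp add: m_assoc)
    also have "\<dots> = r k \<otimes> (r k \<otimes> r i)"
      by (simp only: c)
    also have "\<dots> = sq k \<otimes> r i"
      using car by (simp add: sq_def m_assoc)
    finally show ?thesis
      using r_in_P [of i k] step k by auto
  qed
  then obtain g where g: "g \<in> P k" "r i \<otimes> sq k = sq k \<otimes> g"
    by blast
  have "r i \<otimes> p \<otimes> sq k = (r i \<otimes> sq k) \<otimes> p'"
    using car p' by (simp add: m_assoc)
  also have "\<dots> = sq k \<otimes> (g \<otimes> p')"
    unfolding g(2) using car g(1) k P_closed [of _ k] by (simp add: m_assoc)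
  finally show ?case
    using P_mult [of k g p'] g p' k by auto
qed

lemma P_Q:
  assumes "p \<in> P k" "q \<in> Q k"
  shows "p \<otimes> q \<in> Q k"
proof -
  have Pk: "x \<in> carrier G" if "x \<in> P k" for x
    using that k P_closed [of _ k] by simp
  from assms(2) consider "q \<in> P k" | p' where "p' \<in> P k" "q = sq k \<otimes> p'"
    by (auto simp: Q_def)
  then show ?thesis
  proof cases
    case 1
    then show ?thesis
      using assms P_mult [of k] k by (auto simp: Q_def)
  next
    case 2
    obtain p'' where p'': "p'' \<in> P k" "p \<otimes> sq k = sq k \<otimes> p''"
      using P_sq [OF assms(1)] by blast
    have "p \<otimes> q = (p \<otimes> sq k) \<otimes> p'"
      using 2 assms(1) Pk k by (simp add: m_assoc sq_closed)
    also have "\<dots> = sq k \<otimes> (p'' \<otimes> p')"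
      using p'' 2(1) Pk k by (simp add: m_assoc sq_closed)
    finally show ?thesis
      using P_mult [of k p'' p'] p'' 2 k by (auto simp: Q_def)
  qed
qed

lemma sq_Q:
  assumes "q \<in> Q k"
  shows "sq k \<otimes> q \<in> Q k"
proof -
  from assms consider "q \<in> P k" | p where "p \<in> P k" "q = sq k \<otimes> p"
    by (auto simp: Q_def)
  then show ?thesis
  proof cases
    case 1
    then show ?thesis by (auto simp: Q_def)
  next
    case 2
    have "sq k \<otimes> q = (sq k \<otimes> sq k) \<otimes> p"
      using 2 k P_closed [of _ k] by (simp add: m_assoc sq_closed)
    then have "sq k \<otimes> q = z \<otimes> p"
      using k by (simp add: fourth_power)
    then show ?thesis
      using P_mult [of k z p] z_in_P [of k] 2 k by (simp add: Q_def)
  qed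
qed

lemma Q_Q: "q \<in> Q k \<Longrightarrow> q' \<in> Q k \<Longrightarrow> q \<otimes> q' \<in> Q k"
proof -
  assume q: "q \<in> Q k" and q': "q' \<in> Q k"
  from q consider "q \<in> P k" | p where "p \<in> P k" "q = sq k \<otimes> p"
    by (auto simp: Q_def)
  then show ?thesis
  proof cases
    case 2
    then have "q \<otimes> q' = sq k \<otimes> (p \<otimes> q')"
      using k P_closed [of _ k] Q_closed [OF q'] by (simp add: m_assoc sq_closed)
    then show ?thesis
      using P_Q [OF 2(1) q'] sq_Q by simp
  qed (rule P_Q [OF _ q'])
qed

lemma P_subset_Q: "P k \<subseteq> Q k"
  by (auto simp: Q_def)

lemma sq_in_Q: "sq k \<in> Q k"
  using sq_Q [of \<one>] P.one [of k] k by (simp add: Q_def sq_closed)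

text \<open>All factors of \<open>rep k m\<close> have index above \<open>k - m\<close>, hence at
  least \<open>i + 2\<close>.\<close>

lemma r_commute_rep:
  assumes "1 \<le> i" "i + m < k"
  shows "r i \<otimes> rep k m = rep k m \<otimes> r i"
  using assms
proof (induction m)
  case 0
  then show ?case using k by (simp add: r_closed)
next
  case (Suc m)
  have car: "r i \<in> carrier G" "r (k - m) \<in> carrier G" "rep k m \<in> carrier G"
    using Suc.prems k by (auto intro!: r_closed rep_closed)
  have c: "r i \<otimes> r (k - m) = r (k - m) \<otimes> r i"
    using Suc.prems k by (intro far_commute) auto
  have "r i \<otimes> rep k (Suc m) = (r i \<otimes> r (k - m)) \<otimes> rep k m"
    using car by (simp add: m_assoc)
  also have "\<dots> = r (k - m) \<otimes> (r i \<otimes> rep k m)"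
    unfolding c using car by (simp add: m_assoc)
  also have "\<dots> = rep k (Suc m) \<otimes> r i"
    using Suc car by (simp add: m_assoc)
  finally show ?case .
qed

text \<open>Read from the left, \<open>r i\<close> commutes with the factors until it meets
  \<open>r (i - 1)\<close> followed by \<open>r i\<close>. There the braid relation turns it into
  \<open>r (i - 1)\<close>, which commutes with all later factors.\<close>

lemma r_rep_shift:
  assumes "k + 2 \<le> i + m" "i \<le> k" "m \<le> k"
  shows "r i \<otimes> rep k m = rep k m \<otimes> r (i - 1)"
  using assms
proof (induction m)
  case (Suc m)
  define j where "j = k - m"
  have car: "r i \<in> carrier G" "r j \<in> carrier G" "rep k m \<in> carrier G"
    using Suc.prems k by (auto simp: j_def intro!: r_closed rep_closed)
  have rep: "rep k (Suc m) = r j \<otimes> rep k m"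
    by (simp add: j_def)
  show ?case
  proof (cases "k + 2 \<le> i + m")
    case True
    have c: "r i \<otimes> r j = r j \<otimes> r i"
      using Suc.prems True k by (intro far_commute_sym) (auto simp: j_def)
    have car': "r (i - 1) \<in> carrier G"
      using Suc.prems True k by (intro r_closed) auto
    have "r i \<otimes> rep k (Suc m) = (r i \<otimes> r j) \<otimes> rep k m"
      unfolding rep using car by (simp add: m_assoc)
    also have "\<dots> = r j \<otimes> (r i \<otimes> rep k m)"
      unfolding c using car by (simp add: m_assoc)
    also have "\<dots> = rep k (Suc m) \<otimes> r (i - 1)"
      unfolding rep using Suc True car car' by (simp add: m_assoc)
    finally show ?thesis .
  next
    case False
    \<comment> \<open>Here the leading factor is \<open>r j\<close> with \<open>j = i - 1\<close>,
      and the factor after it is \<open>r i\<close>.\<close>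
    then obtain l where m: "m = Suc l" and i: "i = Suc j" "i = k - l"
      using Suc.prems k by (cases m) (auto simp: j_def)
    have carl: "rep k l \<in> carrier G"
      using Suc.prems m by (intro rep_closed) auto
    have br: "r i \<otimes> (r j \<otimes> r i) = r j \<otimes> (r i \<otimes> r j)"
      unfolding i(1) using Suc.prems k i by (intro braid [symmetric]) (auto simp: j_def)
    have "r i \<otimes> rep k (Suc m) = (r i \<otimes> (r j \<otimes> r i)) \<otimes> rep k l"
      unfolding rep using car carl by (simp add: m i(2) [symmetric] m_assoc)
    also have "\<dots> = r j \<otimes> (r i \<otimes> (r j \<otimes> rep k l))"
      unfolding br using car carl by (simp add: m_assoc)
    also have "r j \<otimes> rep k l = rep k l \<otimes> r j"
      using Suc.prems m by (intro r_commute_rep) (auto simp: j_def)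
    also have "r j \<otimes> (r i \<otimes> (rep k l \<otimes> r j)) = rep k (Suc m) \<otimes> r (i - 1)"
      unfolding rep using car carl by (simp add: m i(2) [symmetric] m_assoc) (simp add: i(1) m_assoc)
    finally show ?thesis .
  qed
qed simp

text \<open>Passing \<open>r (j + 1)\<close>, the square \<open>sq j\<close> turns into a product of
  \<open>z\<close>, \<open>sq (j + 1)\<close> and \<open>sq j\<close>. The induction hypothesis
  moves \<open>sq (j + 1)\<close> through the remaining factors, and \<open>z\<close> and
  \<open>sq j\<close> commute with them.\<close>

lemma sq_rep:
  assumes "m < k"
  shows "\<exists>q\<in>Q k. sq (k - m) \<otimes> rep k m = rep k m \<otimes> q"
  using assms
proof (induction m)
  case 0
  then show ?case
    using sq_in_Q k by (auto intro!: bexI [of _ "sq k"] simp: sq_closed)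
next
  case (Suc m)
  define j where "j = k - Suc m"
  have j: "k - m = Suc j" "1 \<le> j" "Suc j < n" "j < k"
    using Suc.prems k by (auto simp: j_def)
  obtain q where q: "q \<in> Q k" "sq (Suc j) \<otimes> rep k m = rep k m \<otimes> q"
    using Suc j by auto
  have car: "r j \<in> carrier G" "r (Suc j) \<in> carrier G" "sq j \<in> carrier G" "sq (Suc j) \<in> carrier G"
      "rep k m \<in> carrier G" "q \<in> carrier G"
    using Suc.prems q j Q_closed by (auto intro!: r_closed sq_closed rep_closed)
  have "r (Suc j) \<otimes> (sq j \<otimes> r (Suc j)) = sq j"
    using j by (intro sq_up) auto
  then have "inv (r (Suc j)) \<otimes> sq j = inv (r (Suc j)) \<otimes> (r (Suc j) \<otimes> (sq j \<otimes> r (Suc j)))"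
    by simp
  also have "\<dots> = sq j \<otimes> r (Suc j)"
    using car by (simp flip: m_assoc)
  finally have "sq j \<otimes> r (Suc j) = inv (r (Suc j)) \<otimes> sq j" ..
  also have "\<dots> = (z \<otimes> (sq (Suc j) \<otimes> r (Suc j))) \<otimes> sq j"
    using j by (simp add: r_inverse)
  also have "\<dots> = (z \<otimes> r (Suc j)) \<otimes> (sq (Suc j) \<otimes> sq j)"
    using car by (simp add: sq_def m_assoc)
  finally have "sq j \<otimes> r (Suc j) = (r (Suc j) \<otimes> z) \<otimes> (sq (Suc j) \<otimes> sq j)"
    using j by (simp add: z_commute_r)
  then have 1: "sq j \<otimes> r (Suc j) = r (Suc j) \<otimes> (z \<otimes> (sq (Suc j) \<otimes> sq j))"
    using car by (simp add: m_assoc)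
  have c: "r j \<otimes> rep k m = rep k m \<otimes> r j"
    using Suc.prems by (intro r_commute_rep) (auto simp: j_def)
  have "sq j \<otimes> rep k m = r j \<otimes> (r j \<otimes> rep k m)"
    using car by (simp add: sq_def m_assoc)
  also have "\<dots> = r j \<otimes> (rep k m \<otimes> r j)"
    by (simp only: c)
  also have "\<dots> = (r j \<otimes> rep k m) \<otimes> r j"
    using car by (simp add: m_assoc)
  also have "\<dots> = (rep k m \<otimes> r j) \<otimes> r j"
    by (simp only: c)
  also have "\<dots> = rep k m \<otimes> sq j"
    using car by (simp add: sq_def m_assoc)
  finally have 2: "sq j \<otimes> rep k m = rep k m \<otimes> sq j" .
  have "m \<le> k"
    using Suc.prems by simp
  have 3: "z \<otimes> rep k l = rep k l \<otimes> z" if "l \<le> k" for l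
    using that
  proof (induction l)
    case (Suc l)
    have "1 \<le> k - l" "k - l < n"
      using Suc.prems k by auto
    moreover have "rep k l \<in> carrier G" "r (k - l) \<in> carrier G"
      using Suc.prems k by (auto intro!: rep_closed r_closed)
    ultimately show ?case
      using Suc z_commute_r [of "k - l"] by (simp flip: m_assoc) (simp add: m_assoc)
  qed simp
  have "sq j \<otimes> rep k (Suc m) = (sq j \<otimes> r (Suc j)) \<otimes> rep k m"
    using car by (simp add: j m_assoc)
  also have "\<dots> = r (Suc j) \<otimes> (z \<otimes> (sq (Suc j) \<otimes> (sq j \<otimes> rep k m)))"
    unfolding 1 using car by (simp add: m_assoc)
  also have "\<dots> = r (Suc j) \<otimes> (z \<otimes> ((sq (Suc j) \<otimes> rep k m) \<otimes> sq j))"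
    unfolding 2 using car by (simp add: m_assoc)
  also have "\<dots> = r (Suc j) \<otimes> ((z \<otimes> rep k m) \<otimes> (q \<otimes> sq j))"
    unfolding q(2) using car by (simp add: m_assoc)
  also have "\<dots> = rep k (Suc m) \<otimes> (z \<otimes> (q \<otimes> sq j))"
    unfolding 3 [OF \<open>m \<le> k\<close>] using car by (simp add: j m_assoc)
  finally have "sq j \<otimes> rep k (Suc m) = rep k (Suc m) \<otimes> (z \<otimes> (q \<otimes> sq j))" .
  moreover have "z \<otimes> (q \<otimes> sq j) \<in> Q k"
    using P_subset_Q z_in_P [of k] sq_in_P [of j k] j k q by (intro Q_Q) auto
  ultimately show ?case
    unfolding j_def by blast
qed

text \<open>The cases compare \<open>i\<close> with the leading index \<open>k + 1 - m\<close>: well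
  below it \<open>r i\<close> commutes, just below it \<open>r i\<close> lengthens the
  representative, at equality a square arises, and above it the index shifts.\<close>

lemma r_rep:
  assumes "1 \<le> i" "i \<le> k" "m \<le> k"
  shows "\<exists>m'\<le>k. \<exists>q\<in>Q k. r i \<otimes> rep k m = rep k m' \<otimes> q"
proof -
  have one: "\<one> \<in> Q k"
    using P_subset_Q P.one by blast
  consider "i + m < k" | "i + m = k" | "i + m = Suc k" | "k + 2 \<le> i + m"
    by linarith
  then show ?thesis
  proof cases
    case 1
    then show ?thesis
      using r_commute_rep [of i m] r_in_P [of i k] P_subset_Q assms k by (intro exI [of _ m]) auto
  next
    case 2
    then have "i = k - m" "Suc m \<le> k"
      using assms by auto
    moreover from this have "rep k (Suc m) \<in> carrier G"
      by (intro rep_closed)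
    ultimately show ?thesis
      using one by (intro exI [of _ "Suc m"]) (auto intro!: bexI [of _ \<one>])
  next
    case 3
    then obtain l where m: "m = Suc l" "i = k - l" "l < k"
      using assms by (cases m) auto
    have "r i \<otimes> rep k m = sq i \<otimes> rep k l"
      using assms m k by (simp add: sq_def m_assoc r_closed rep_closed)
    then show ?thesis
      using sq_rep [OF m(3)] m by (intro exI [of _ l]) auto
  next
    case 4
    then have "1 \<le> i - 1" "i - 1 < k"
      using assms by auto
    then have "r (i - 1) \<in> Q k"
      using r_in_P [of "i - 1" k] P_subset_Q k by auto
    then show ?thesis
      using r_rep_shift [OF 4 assms(2,3)] assms(3) by blast
  qed
qed

lemma P_Suc_cosets:
  assumes "w \<in> P (Suc k)"
  shows "\<exists>m\<le>k. \<exists>q\<in>Q k. w = rep k m \<otimes> q"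
  using assms
proof (induction rule: P.induct)
  case one
  then show ?case
    using P_subset_Q P.one by (intro exI [of _ 0]) (auto intro!: bexI [of _ \<one>])
next
  case (step i w)
  then obtain m q where m: "m \<le> k" "q \<in> Q k" "w = rep k m \<otimes> q"
    by blast
  obtain m' q' where m': "m' \<le> k" "q' \<in> Q k" "r i \<otimes> rep k m = rep k m' \<otimes> q'"
    using r_rep [of i m] step m by auto
  have car: "r i \<in> carrier G" "rep k m \<in> carrier G" "rep k m' \<in> carrier G" "q \<in> carrier G" "q' \<in> carrier G"
    using step k m m' Q_closed rep_closed by (auto simp: r_closed)
  have "r i \<otimes> w = (r i \<otimes> rep k m) \<otimes> q"
    unfolding m(3) using car by (simp add: m_assoc)
  also have "\<dots> = rep k m' \<otimes> (q' \<otimes> q)"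
    unfolding m'(3) using car by (simp add: m_assoc)
  finally show ?case
    using Q_Q m m' by blast
qed

end

end

subsection \<open>Comparison with signed permutation matrices\<close>

text \<open>Orthogonality leaves a diagonal matrix with a single free sign, and the determinant
  decides this sign.\<close>

lemma SO_fixing_all_but_one:
  fixes A :: "real^'n^'n"
  assumes "A \<in> SO" "A \<in> fixing_O {k}"
  shows "A = mat 1"
proof -
  have col: "A *v axis k 1 \<in> coord_sphere {k}"
    using assms(2) by (rule fixing_O_column) simp
  have ax: "A *v axis i 1 = axis i 1" if "i \<noteq> k" for i
    using assms(2) that by (simp add: fixing_O_def)
  have entry: "A $ i $ j = (A *v axis j 1) $ i" for i j
    by (simp add: matrix_vector_mult_basis column_def)
  have off: "A $ i $ j = 0" if "i \<noteq> j" for i j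
    using col ax [of j] that by (cases "j = k") (auto simp: entry coord_sphere_def axis_def)
  have diag: "A $ i $ i = 1" if "i \<noteq> k" for i
    using ax [OF that] by (simp add: entry)
  have "det A = (\<Prod>i\<in>UNIV. A $ i $ i)"
    using off by (rule det_diagonal)
  also have "\<dots> = A $ k $ k"
    using diag by (subst prod.remove [of _ k]) auto
  finally have "A $ k $ k = 1"
    using assms(1) by (simp add: SO_iff)
  then have "A $ i $ i = 1" for i
    using diag by (cases "i = k") auto
  then show ?thesis
    using off by (auto simp: vec_eq_iff mat_def)
qed

text \<open>Instantiated twice: with \<open>endpt\<close> on the path group, where it serves
  generation, and with \<open>endpt\<close> after the homomorphism on the presented group, where it
  bounds the kernel.\<close>

locale hyperoct_action = hyperoct_relations G r n for G (structure) and r n +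
  fixes M :: "'a \<Rightarrow> real^'m^'m" and e :: "nat \<Rightarrow> 'm"
  assumes e: "bij_betw e {1..n} UNIV"
    and M_mult: "x \<in> carrier G \<Longrightarrow> y \<in> carrier G \<Longrightarrow> M (x \<otimes> y) = M x ** M y"
    and M_one: "M \<one> = mat 1"
    and M_r: "1 \<le> i \<Longrightarrow> i < n \<Longrightarrow> M (r i) = plane_rotation (e i) (e (Suc i)) (pi / 2)"
    and M_in: "x \<in> carrier G \<Longrightarrow> M x \<in> hyperoct_rotations"
begin

definition E :: "nat \<Rightarrow> real^'m" where "E i = axis (e i) 1"

lemma e_eq_iff: "1 \<le> i \<Longrightarrow> i \<le> n \<Longrightarrow> 1 \<le> j \<Longrightarrow> j \<le> n \<Longrightarrow> e i = e j \<longleftrightarrow> i = j"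
  using e by (auto simp: bij_betw_def inj_on_eq_iff)

lemma E_eq_iff: "1 \<le> i \<Longrightarrow> i \<le> n \<Longrightarrow> 1 \<le> j \<Longrightarrow> j \<le> n \<Longrightarrow> E i = E j \<longleftrightarrow> i = j"
  by (simp add: E_def axis_eq_axis e_eq_iff)

lemma E_neq_minus: "E i \<noteq> - E j"
  by (auto simp: E_def axis_def vec_eq_iff)

lemma M_r_E:
  assumes "1 \<le> i" "i < n"
  shows "M (r i) *v E i = E (Suc i)" "M (r i) *v E (Suc i) = - E i"
    "1 \<le> l \<Longrightarrow> l \<le> n \<Longrightarrow> l \<noteq> i \<Longrightarrow> l \<noteq> Suc i \<Longrightarrow> M (r i) *v E l = E l"
  using assms by (simp_all add: M_r E_def plane_rotation_quarter e_eq_iff)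

lemma M_mult_vec: "x \<in> carrier G \<Longrightarrow> y \<in> carrier G \<Longrightarrow> M (x \<otimes> y) *v v = M x *v (M y *v v)"
  by (simp add: M_mult matrix_vector_mul_assoc)

lemma M_sq_E: "1 \<le> i \<Longrightarrow> i < n \<Longrightarrow> M (sq i) *v E (Suc i) = - E (Suc i)"
  by (simp add: sq_def M_mult_vec r_closed M_r_E matrix_vector_mult_minus_right)

lemma P_fixes: "p \<in> P k \<Longrightarrow> k \<le> n \<Longrightarrow> k < l \<Longrightarrow> l \<le> n \<Longrightarrow> M p *v E l = E l"
  by (induction rule: P.induct) (auto simp: M_one M_mult_vec r_closed P_closed M_r_E)

lemma rep_E:
  assumes "2 \<le> k" "k < n" "m \<le> k"
  shows "M (rep k m) *v E (Suc k) = E (Suc k - m) \<or> M (rep k m) *v E (Suc k) = - E (Suc k - m)"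
  using assms(3)
proof (induction m)
  case (Suc m)
  then have "Suc k - m = Suc (k - m)" "1 \<le> k - m" "k - m < n"
    using assms by auto
  with Suc assms show ?case
    by (auto simp: M_mult_vec r_closed rep_closed M_r_E matrix_vector_mult_minus_right)
qed (simp add: M_one)

text \<open>\<open>Q k\<close> preserves the pair of opposite vertices with index
  \<open>k + 1\<close>, and \<open>rep k m\<close> moves it to the pair with index
  \<open>k + 1 - m\<close>. Fixing the vertex forces \<open>m = 0\<close>, and the sign then
  excludes the coset of \<open>sq k\<close>.\<close>

lemma stabilizer_subset_P:
  assumes k: "2 \<le> k" "k < n" and w: "w \<in> P (Suc k)" "M w *v E (Suc k) = E (Suc k)"
  shows "w \<in> P k"
proof -
  obtain m q where m: "m \<le> k" "q \<in> Q k" "w = rep k m \<otimes> q"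
    using P_Suc_cosets [OF k w(1)] by blast
  have car: "rep k m \<in> carrier G" "q \<in> carrier G"
    using rep_closed [OF k m(1)] Q_closed [OF k m(2)] by auto
  have fix_P: "M p *v E (Suc k) = E (Suc k)" if "p \<in> P k" for p
    using that k by (intro P_fixes) auto
  have sqp: "M (sq k \<otimes> p) *v E (Suc k) = - E (Suc k)" if "p \<in> P k" for p
    using that k P_closed [of p k] by (simp add: M_mult_vec sq_closed fix_P M_sq_E)
  have q: "M q *v E (Suc k) = E (Suc k) \<or> M q *v E (Suc k) = - E (Suc k)"
    using m(2) fix_P sqp by (auto simp: Q_def)
  have "M w *v E (Suc k) = M (rep k m) *v (M q *v E (Suc k))"
    using m car by (simp add: M_mult_vec)
  then have "E (Suc k) = E (Suc k - m)"
    using q rep_E [OF k m(1)] w(2) E_neq_minus by (auto simp: matrix_vector_mult_minus_right)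
  then have "m = 0"
    using k m(1) by (subst (asm) E_eq_iff) auto
  then have "w = q"
    using m car by simp
  then show ?thesis
    using m(2) w(2) sqp E_neq_minus [of "Suc k" "Suc k"] by (auto simp: Q_def)
qed

text \<open>Only powers of \<open>r 1\<close> occur. They are sorted by the exponent modulo 4, and
  \<open>a\<close> absorbs the fourth power \<open>z\<close>, whose square is
  \<open>1\<close>.\<close>

lemma P_2: "p \<in> P 2 \<Longrightarrow> \<exists>a\<in>{\<one>, z}. p = a \<or> p = r 1 \<otimes> a \<or> p = sq 1 \<otimes> a \<or> p = r 1 \<otimes> (sq 1 \<otimes> a)"
proof (induction rule: P.induct)
  case (step i p)
  then obtain a where a: "a \<in> {\<one>, z}" "p = a \<or> p = r 1 \<otimes> a \<or> p = sq 1 \<otimes> a \<or> p = r 1 \<otimes> (sq 1 \<otimes> a)"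
    by blast
  have i: "i = 1"
    using step by simp
  have car: "r 1 \<in> carrier G" "a \<in> carrier G" "sq 1 \<in> carrier G"
    using a n3 r_closed [of 1] sq_closed [of 1] by auto
  have 1: "r 1 \<otimes> (r 1 \<otimes> x) = sq 1 \<otimes> x" if "x \<in> carrier G" for x
    using car that by (simp add: sq_def m_assoc)
  have 2: "sq 1 \<otimes> (sq 1 \<otimes> a) = z \<otimes> a"
    unfolding z_def using car by (simp add: m_assoc)
  have 3: "z \<otimes> a \<in> {\<one>, z}"
    using a(1) z_square by auto
  show ?case
    using a(2)
  proof (elim disjE)
    assume "p = a"
    then show ?thesis
      using a(1) i by blast
  next
    assume "p = r 1 \<otimes> a"
    then have "r i \<otimes> p = sq 1 \<otimes> a"
      using i 1 car by simp
    then show ?thesis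
      using a(1) by blast
  next
    assume "p = sq 1 \<otimes> a"
    then show ?thesis
      using a(1) i by blast
  next
    assume "p = r 1 \<otimes> (sq 1 \<otimes> a)"
    then have "r i \<otimes> p = z \<otimes> a"
      using i 1 2 car by simp
    then show ?thesis
      using 3 by blast
  qed
qed simp

text \<open>Descending the stabilizer chain leaves a power of \<open>r 1\<close>. Up to
  \<open>z\<close> there are four of these, and they send the first vertex to four different
  vertices.\<close>

theorem kernel:
  assumes "w \<in> P n" "M w = mat 1"
  shows "w = \<one> \<or> w = z"
proof -
  have "w \<in> P k" if "2 \<le> k" "k \<le> n" for k
    using that(2,1)
  proof (induction rule: inc_induct)
    case base
    show ?case by (rule assms)
  next
    case (step k)
    show ?case
      by (rule stabilizer_subset_P) (use step assms(2) in auto)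
  qed
  then have "w \<in> P 2"
    using n3 by simp
  then obtain a where a: "a \<in> {\<one>, z}" "w = a \<or> w = r 1 \<otimes> a \<or> w = sq 1 \<otimes> a \<or> w = r 1 \<otimes> (sq 1 \<otimes> a)"
    using P_2 by blast
  have car: "r 1 \<in> carrier G" "a \<in> carrier G" "sq 1 \<in> carrier G"
    using a n3 r_closed [of 1] sq_closed [of 1] by auto
  have r1: "M (r 1) *v E 1 = E 2" "M (r 1) *v E 2 = - E 1"
    using M_r_E(1,2) [of 1] n3 by (simp_all add: numeral_2_eq_2)
  have s1: "M (sq 1) *v E 1 = - E 1"
    by (simp add: sq_def M_mult_vec car r1 del: One_nat_def)
  have "M z *v E 1 = E 1"
    unfolding z_def by (simp add: M_mult_vec car s1 matrix_vector_mult_minus_right del: One_nat_def)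
  then have a1: "M a *v E 1 = E 1"
    using a(1) by (auto simp: M_one)
  have "E 1 \<noteq> E 2"
    using n3 by (simp add: E_eq_iff)
  moreover have "M w *v E 1 = E 1"
    by (simp add: assms)
  ultimately have "w = a"
    using a(2) E_neq_minus [of 1 1] E_neq_minus [of 1 2]
    by (auto simp: M_mult_vec car a1 r1 s1 matrix_vector_mult_minus_right simp del: One_nat_def)
  then show ?thesis
    using a(1) by auto
qed

section \<open>Surjectivity onto the rotations of the hyperoctahedron\<close>

lemma P_mono: "p \<in> P k \<Longrightarrow> k \<le> l \<Longrightarrow> p \<in> P l"
  by (induction rule: P.induct) (auto intro: P.intros)

lemma vertex_cases:
  assumes "v \<in> hyperoct_vertices"
  obtains j where "1 \<le> j" "j \<le> n" "v = E j \<or> v = - E j"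
proof -
  obtain i where i: "v = axis i 1 \<or> v = - axis i 1"
    using assms by (auto simp: hyperoct_vertices_def)
  have "i \<in> e ` {1..n}"
    using e by (simp add: bij_betw_def)
  then show thesis
    using i that by (auto simp: E_def)
qed

text \<open>Both signs are carried along because \<open>r j\<close> takes \<open>E (j + 1)\<close>
  to \<open>- E j\<close>. The induction descends from \<open>j = k + 1\<close>, where
  \<open>sq k\<close> supplies the negative sign.\<close>

lemma P_transitive:
  assumes k: "1 \<le> k" "k < n" and j: "1 \<le> j" "j \<le> Suc k"
  shows "(\<exists>c\<in>P (Suc k). M c *v E (Suc k) = E j) \<and> (\<exists>c\<in>P (Suc k). M c *v E (Suc k) = - E j)"
  using j(2,1)
proof (induction rule: inc_induct)
  case base
  have "\<one> \<in> P (Suc k)" "sq k \<in> P (Suc k)"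
    using k by (auto intro!: P.one sq_in_P)
  then show ?case
    using k M_sq_E [of k] by (auto simp: M_one intro: bexI [of _ \<one>] bexI [of _ "sq k"])
next
  case (step j)
  then obtain c d where c: "c \<in> P (Suc k)" "M c *v E (Suc k) = E (Suc j)"
    and d: "d \<in> P (Suc k)" "M d *v E (Suc k) = - E (Suc j)"
    by auto
  have car: "c \<in> carrier G" "d \<in> carrier G" "r j \<in> carrier G"
    using c d P_closed k step by (auto intro!: r_closed)
  have "M (r j \<otimes> c) *v E (Suc k) = - E j" "M (r j \<otimes> d) *v E (Suc k) = E j"
    using car step k c d by (auto simp: M_mult_vec M_r_E matrix_vector_mult_minus_right)
  moreover have "r j \<otimes> c \<in> P (Suc k)" "r j \<otimes> d \<in> P (Suc k)"
    using step c d by (auto intro!: P.step)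
  ultimately show ?case
    by blast
qed

text \<open>Some \<open>c\<close> in \<open>P (k + 1)\<close> agrees with \<open>g\<close> on the
  vertex with index \<open>k + 1\<close>, and then \<open>transpose (M c) ** g\<close> fixes one
  more vertex. At the bottom a single coordinate may move, and determinant 1 leaves the
  identity.\<close>

lemma P_surj_stabilizer:
  assumes "1 \<le> k" "k \<le> n" "g \<in> hyperoct_rotations" "\<And>l. k < l \<Longrightarrow> l \<le> n \<Longrightarrow> g *v E l = E l"
  shows "\<exists>w\<in>P k. M w = g"
  using assms
proof (induction k arbitrary: g rule: dec_induct)
  case base
  have "i = e 1" if "g *v axis i 1 \<noteq> axis i 1" for i
  proof -
    have "i \<in> e ` {1..n}"
      using e by (simp add: bij_betw_def)
    then obtain l where "i = e l" "1 \<le> l" "l \<le> n"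
      by auto
    with that base.prems(3) [of l] show ?thesis
      by (cases "l = 1") (auto simp: E_def)
  qed
  then have "g \<in> fixing_O {e 1}"
    using hyperoct_rotations_SO [OF base.prems(2)] by (auto simp: fixing_O_def SO_iff)
  then have "g = mat 1"
    using SO_fixing_all_but_one hyperoct_rotations_SO [OF base.prems(2)] by blast
  then show ?case
    by (intro bexI [of _ \<one>]) (auto simp: M_one P.one)
next
  case (step k)
  have og: "orthogonal_matrix g"
    using hyperoct_rotations_SO [OF step.prems(2)] by (simp add: SO_iff)
  have "g *v E (Suc k) \<in> hyperoct_vertices"
    using step.prems(2) by (intro hyperoct_rotations_vertex) (auto simp: E_def axis_in_vertices)
  then obtain j where j: "1 \<le> j" "j \<le> n" "g *v E (Suc k) = E j \<or> g *v E (Suc k) = - E j"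
    using vertex_cases by blast
  \<comment> \<open>\<open>g\<close> already fixes the later vertices, so by orthogonality it cannot
    send a different basis vector to one of them or its opposite.\<close>
  have "j \<le> Suc k"
  proof (rule ccontr)
    assume "\<not> j \<le> Suc k"
    then have "g *v E j = E j" "j \<noteq> Suc k"
      using j step.prems(3) [of j] by auto
    then have "(g *v E (Suc k)) \<bullet> (g *v E j) \<noteq> 0"
      using j by (auto simp: E_def inner_axis_axis)
    moreover have "E (Suc k) \<bullet> E j = 0"
      using \<open>j \<noteq> Suc k\<close> j step e_eq_iff [of "Suc k" j] by (simp add: E_def inner_axis_axis)
    ultimately show False
      by (simp add: orthogonal_matrix_inner [OF og])
  qed
  then obtain c where c: "c \<in> P (Suc k)" "M c *v E (Suc k) = g *v E (Suc k)"
    using P_transitive [of k j] j step by auto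
  have cc: "c \<in> carrier G"
    using P_closed [OF c(1)] step by simp
  have oc: "orthogonal_matrix (M c)"
    using hyperoct_rotations_SO [OF M_in [OF cc]] by (simp add: SO_iff)
  have "\<exists>w\<in>P k. M w = transpose (M c) ** g"
  proof (rule step.IH)
    show "transpose (M c) ** g \<in> hyperoct_rotations"
      using step.prems(2) M_in [OF cc] by (intro hyperoct_rotations_mult hyperoct_rotations_transpose)
    fix l assume l: "k < l" "l \<le> n"
    have "M c *v E l = g *v E l"
    proof (cases "l = Suc k")
      case False
      then show ?thesis
        using P_fixes [OF c(1), of l] step.prems l by simp
    qed (simp add: c)
    then show "(transpose (M c) ** g) *v E l = E l"
      unfolding matrix_vector_mul_assoc [symmetric] by (rule transpose_mult_vec_eq [OF oc])
  qed (use step.prems in simp)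
  then obtain w where w: "w \<in> P k" "M w = transpose (M c) ** g"
    by blast
  have "w \<in> P (Suc k)" "w \<in> carrier G"
    using P_mono [OF w(1)] P_closed [OF w(1)] step by auto
  moreover from this have "M (c \<otimes> w) = g"
    using cc w(2) by (simp add: M_mult matrix_mul_assoc orthogonal_matrix_transpose_mult [OF oc])
  ultimately show ?case
    using P_mult [OF _ c(1)] step.prems(1) by blast
qed

theorem P_surj: "g \<in> hyperoct_rotations \<Longrightarrow> \<exists>w\<in>P n. M w = g"
  using n3 by (intro P_surj_stabilizer) auto

lemma P_subset_generate: "w \<in> P n \<Longrightarrow> w \<in> generate G (r ` {1..n - 1})"
proof (induction rule: P.induct)
  case (step i p)
  then have "r i \<in> generate G (r ` {1..n - 1})"
    by (intro generate.incl) auto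
  then show ?case
    using step.IH by (rule generate.eng)
qed (rule generate.one)

end

subsection \<open>Presented groups\<close>

definition word_eval :: "('a, 'c) monoid_scheme \<Rightarrow> ('b \<Rightarrow> 'a) \<Rightarrow> 'b gword \<Rightarrow> 'a" where
  "word_eval G f w = foldr (\<lambda>(s, b) x. (if b then f s else inv\<^bsub>G\<^esub> (f s)) \<otimes>\<^bsub>G\<^esub> x) w \<one>\<^bsub>G\<^esub>"

context group
begin

lemma word_eval_simps [simp]:
  "word_eval G f [] = \<one>"
  "word_eval G f ((s, b) # w) = (if b then f s else inv (f s)) \<otimes> word_eval G f w"
  by (simp_all add: word_eval_def)

lemma word_eval_closed: "f ` S \<subseteq> carrier G \<Longrightarrow> w \<in> gwords S \<Longrightarrow> word_eval G f w \<in> carrier G"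
  by (induction w) (auto simp: gwords_def image_subset_iff)

lemma word_eval_append:
  "f ` S \<subseteq> carrier G \<Longrightarrow> u \<in> gwords S \<Longrightarrow> v \<in> gwords S
    \<Longrightarrow> word_eval G f (u @ v) = word_eval G f u \<otimes> word_eval G f v"
proof (induction u)
  case (Cons a u)
  then obtain s b where a: "a = (s, b)" "s \<in> S" "u \<in> gwords S"
    by (cases a) (auto simp: gwords_def)
  then have "f s \<in> carrier G"
    using Cons.prems by auto
  then show ?case
    using Cons a by (simp add: m_assoc word_eval_closed)
qed (simp add: word_eval_closed)

lemma word_eval_cong:
  assumes "(u, v) \<in> pres_cong S rels" and f: "f ` S \<subseteq> carrier G"
    and "\<And>u v. (u, v) \<in> rels \<Longrightarrow> u \<in> gwords S \<Longrightarrow> v \<in> gwords S \<Longrightarrow> word_eval G f u = word_eval G f v"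
  shows "word_eval G f u = word_eval G f v"
  using assms(1)
proof (induction rule: pres_cong.induct)
  case (append u v u' v')
  then show ?case
    using pres_cong_in_gwords word_eval_append [OF f] by metis
next
  case (cancel s b)
  then have "f s \<in> carrier G"
    using f by auto
  then show ?case by simp
qed (use assms(3) in auto)

text \<open>The universal property of a presentation. A class is evaluated on a chosen word, and
  \<open>word_eval_cong\<close> makes the value independent of the choice.\<close>

lemma presented_group_hom:
  assumes f: "f ` S \<subseteq> carrier G"
    and rels: "\<And>u v. (u, v) \<in> rels \<Longrightarrow> u \<in> gwords S \<Longrightarrow> v \<in> gwords S \<Longrightarrow> word_eval G f u = word_eval G f v"
  shows "\<exists>h\<in>hom (presented_group S rels) G. \<forall>s\<in>S. h (presented_gen S rels s) = f s"
proof -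
  let ?c = "\<lambda>u. pres_cong S rels `` {u}"
  define h where "h A = word_eval G f (SOME w. w \<in> A)" for A
  have h: "h (?c u) = word_eval G f u" if "u \<in> gwords S" for u
  proof -
    have "u \<in> ?c u"
      using that by (simp add: pres_cong.refl)
    then have "(SOME w. w \<in> ?c u) \<in> ?c u"
      by (rule someI)
    then have "(u, SOME w. w \<in> ?c u) \<in> pres_cong S rels"
      by simp
    then show ?thesis
      unfolding h_def using word_eval_cong [OF _ f rels] by metis
  qed
  have car: "carrier (presented_group S rels) = ?c ` gwords S"
    by (auto simp: presented_group_def quotient_def)
  show ?thesis
  proof (intro bexI ballI)
    show "h \<in> hom (presented_group S rels) G"
      by (rule homI) (auto simp: car h word_eval_closed [OF f] presented_mult_class word_eval_append [OF f])
    fix s assume s: "s \<in> S"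
    then have "gen s \<in> gwords S" "f s \<in> carrier G"
      using f by (auto simp: gen_def gwords_def)
    then show "h (presented_gen S rels s) = f s"
      by (simp add: presented_gen_def h) (simp add: gen_def)
  qed
qed

end

lemma presented_gen_closed: "s \<in> S \<Longrightarrow> presented_gen S rels s \<in> carrier (presented_group S rels)"
  by (auto simp: presented_group_def presented_gen_def quotient_def gen_def gwords_def)

lemma presented_group_generated:
  "carrier (presented_group S rels) = generate (presented_group S rels) (presented_gen S rels ` S)"
proof
  let ?G = "presented_group S rels"
  let ?c = "\<lambda>u. pres_cong S rels `` {u}"
  let ?H = "generate ?G (presented_gen S rels ` S)"
  interpret group ?G
    by (rule group_presented_group)
  have car: "carrier ?G = ?c ` gwords S"
    by (auto simp: presented_group_def quotient_def)
  have one: "\<one>\<^bsub>?G\<^esub> = ?c []"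
    by (simp add: presented_group_def)
  have letter: "?c [(s, b)] \<in> ?H" if s: "s \<in> S" for s b
  proof (cases b)
    case True
    then show ?thesis
      using s by (auto intro!: generate.incl simp: presented_gen_def gen_def)
  next
    case False
    have w: "[(s, False)] \<in> gwords S" "[(s, True)] \<in> gwords S"
      using s by (auto simp: gwords_def)
    have "?c [(s, False)] \<otimes>\<^bsub>?G\<^esub> ?c [(s, True)] = \<one>\<^bsub>?G\<^esub>"
      using presented_mult_class [OF w, of rels] pres_cong.cancel [OF s, of False rels]
      by (simp add: one equiv_class_eq [OF equiv_pres_cong])
    then have "inv\<^bsub>?G\<^esub> (?c [(s, True)]) = ?c [(s, False)]"
      using w by (intro inv_equality) (auto simp: car)
    moreover have "inv\<^bsub>?G\<^esub> (?c [(s, True)]) \<in> ?H"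
      using s by (auto intro!: generate.inv simp: presented_gen_def gen_def)
    ultimately show ?thesis
      using False by simp
  qed
  have "?c u \<in> ?H" if "u \<in> gwords S" for u
    using that
  proof (induction u)
    case Nil
    then show ?case
      using generate.one [of ?G] by (simp add: one)
  next
    case (Cons a u)
    then obtain s b where a: "a = (s, b)" "s \<in> S" "u \<in> gwords S"
      by (cases a) (auto simp: gwords_def)
    have "?c (a # u) = ?c [(s, b)] \<otimes>\<^bsub>?G\<^esub> ?c u"
      using a by (subst presented_mult_class) (auto simp: gwords_def)
    then show ?case
      using generate.eng [OF letter Cons.IH] a by simp
  qed
  then show "carrier ?G \<subseteq> ?H"
    by (auto simp: car)
  show "?H \<subseteq> carrier ?G"
  proof -
    have "presented_gen S rels ` S \<subseteq> carrier ?G"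
      using presented_gen_closed by auto
    then show ?thesis
      using generate_in_carrier by blast
  qed
qed

lemma presented_relation:
  assumes "(u, v) \<in> rels" "u \<in> gwords S" "v \<in> gwords S"
  shows "pres_cong S rels `` {u} = pres_cong S rels `` {v}"
  using assms by (intro equiv_class_eq [OF equiv_pres_cong] pres_cong.rel)

lemma presented_hyperoct_relations:
  assumes "n \<ge> 3" and S: "S = {1..n - 1}"
  shows "hyperoct_relations (presented_group S (hyperoct_rels n)) (presented_gen S (hyperoct_rels n)) n"
proof -
  let ?R = "hyperoct_rels n"
  let ?c = "\<lambda>u. pres_cong S ?R `` {u}"
  have gen: "gen i \<in> gwords S" if "1 \<le> i" "i < n" for i
    using that by (auto simp: S gen_def gwords_def)
  interpret group "presented_group S ?R"
    by (rule group_presented_group)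
  show ?thesis
  proof
    show "3 \<le> n" by (rule assms(1))
    show "presented_gen S ?R i \<in> carrier (presented_group S ?R)" if "1 \<le> i" "i < n" for i
      using that by (intro presented_gen_closed) (auto simp: S)
    show "presented_gen S ?R i \<otimes>\<^bsub>presented_group S ?R\<^esub> (presented_gen S ?R (Suc i)
        \<otimes>\<^bsub>presented_group S ?R\<^esub> presented_gen S ?R i)
      = presented_gen S ?R (Suc i) \<otimes>\<^bsub>presented_group S ?R\<^esub> (presented_gen S ?R i
        \<otimes>\<^bsub>presented_group S ?R\<^esub> presented_gen S ?R (Suc i))" if "1 \<le> i" "Suc i < n" for i
    proof -
      have "i \<le> n - 2"
        using that by simp
      then have "(gen i @ gen (i + 1) @ gen i, gen (i + 1) @ gen i @ gen (i + 1)) \<in> ?R"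
        using that(1) unfolding hyperoct_rels_def by blast
      from presented_relation [OF this, of S] show ?thesis
        using that by (simp add: presented_gen_def presented_mult_class gen)
    qed
    show "presented_gen S ?R i \<otimes>\<^bsub>presented_group S ?R\<^esub> presented_gen S ?R j
      = presented_gen S ?R j \<otimes>\<^bsub>presented_group S ?R\<^esub> presented_gen S ?R i"
      if "1 \<le> i" "Suc i < j" "j < n" for i j
    proof -
      have "i \<in> S" "j \<in> S" "\<bar>int i - int j\<bar> \<ge> 2"
        using that by (auto simp: S)
      then have "(gen i @ gen j, gen j @ gen i) \<in> ?R"
        unfolding hyperoct_rels_def S by blast
      from presented_relation [OF this, of S] show ?thesis
        using that by (simp add: presented_gen_def presented_mult_class gen)
    qed
    have "(gen 1 @ gen 1, gen 2 @ gen 1 @ gen 1 @ gen 2) \<in> ?R"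
      unfolding hyperoct_rels_def by blast
    from presented_relation [OF this, of S]
    show "presented_gen S ?R 1 \<otimes>\<^bsub>presented_group S ?R\<^esub> presented_gen S ?R 1
      = presented_gen S ?R 2 \<otimes>\<^bsub>presented_group S ?R\<^esub> (presented_gen S ?R 1
        \<otimes>\<^bsub>presented_group S ?R\<^esub> (presented_gen S ?R 1 \<otimes>\<^bsub>presented_group S ?R\<^esub> presented_gen S ?R 2))"
      using assms(1) gen [of 1] gen [of 2] by (simp add: presented_gen_def presented_mult_class)
  qed
qed

subsection \<open>The presentation\<close>

lemma hyperoct_action_path_group:
  fixes e :: "nat \<Rightarrow> 'n::finite"
  assumes n: "n \<ge> 3" and e: "bij_betw e {1..n} UNIV"
  shows "hyperoct_action hyperoct_path_group (R_gen e) n endpt e"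
proof -
  interpret group "hyperoct_path_group :: (real \<Rightarrow> real^'n^'n) set monoid"
    by (rule group_hyperoct_path_group)
  have ne: "e i \<noteq> e j" if "1 \<le> i" "i \<le> n" "1 \<le> j" "j \<le> n" "i \<noteq> j" for i j
    using e that by (auto simp: bij_betw_def inj_on_eq_iff)
  show ?thesis
  proof
    show "3 \<le> n" "bij_betw e {1..n} UNIV"
      using n e by auto
    fix i assume i: "1 \<le> i" "i < n"
    then have "R_path (e i) (e (Suc i)) \<in> hyperoct_paths"
      by (intro R_path_hyperoct ne) auto
    then show "R_gen e i \<in> carrier hyperoct_path_group"
      "endpt (R_gen e i) = plane_rotation (e i) (e (Suc i)) (pi / 2)"
      by (auto simp: R_gen_def path_group_carrier endpt_class) (simp add: R_path_def)
  next
    fix i assume "1 \<le> i" "Suc i < n"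
    then show "R_gen e i \<otimes>\<^bsub>hyperoct_path_group\<^esub> (R_gen e (Suc i) \<otimes>\<^bsub>hyperoct_path_group\<^esub> R_gen e i)
      = R_gen e (Suc i) \<otimes>\<^bsub>hyperoct_path_group\<^esub> (R_gen e i \<otimes>\<^bsub>hyperoct_path_group\<^esub> R_gen e (Suc i))"
      using R_path_braid [of "e i" "e (Suc i)" "e (Suc (Suc i))"] by (simp add: R_gen_def ne)
  next
    fix i j assume "1 \<le> i" "Suc i < j" "j < n"
    then show "R_gen e i \<otimes>\<^bsub>hyperoct_path_group\<^esub> R_gen e j = R_gen e j \<otimes>\<^bsub>hyperoct_path_group\<^esub> R_gen e i"
      using R_path_commute [of "e i" "e (Suc i)" "e j" "e (Suc j)"] by (simp add: R_gen_def ne)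
  next
    have "e 1 \<noteq> e 2" "e 2 \<noteq> e 3" "e 1 \<noteq> e 3"
      using n ne [of 1 2] ne [of 2 3] ne [of 1 3] by auto
    then show "R_gen e 1 \<otimes>\<^bsub>hyperoct_path_group\<^esub> R_gen e 1
      = R_gen e 2 \<otimes>\<^bsub>hyperoct_path_group\<^esub> (R_gen e 1 \<otimes>\<^bsub>hyperoct_path_group\<^esub>
        (R_gen e 1 \<otimes>\<^bsub>hyperoct_path_group\<^esub> R_gen e 2))"
      using R_path_square_relation [of "e 1" "e 2" "e 3"] by (simp add: R_gen_def numeral_2_eq_2 numeral_3_eq_3)
  qed (auto simp: endpt_mult endpt_one endpt_in)
qed

lemma R_path_fourth_power:
  assumes "i \<noteq> j"
  shows "SO_path_class (R_path i j) [^]\<^bsub>hyperoct_path_group\<^esub> (4 * m :: nat)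
    = SO_path_class (turn_path i j (2 * pi * real m))"
  using R_path_class_pow [OF assms, of "4 * m"] by (simp add: mult.commute mult.left_commute)

lemma full_turns_in_generate:
  fixes i j :: "'n::finite"
  assumes ij: "i \<noteq> j" and H: "SO_path_class (R_path i j) \<in> H" "H \<subseteq> carrier hyperoct_path_group"
  shows "SO_path_class (turn_path i j (2 * pi * of_int m)) \<in> generate hyperoct_path_group H"
proof -
  interpret group "hyperoct_path_group :: (real \<Rightarrow> real^'n^'n) set monoid"
    by (rule group_hyperoct_path_group)
  have sub: "subgroup (generate hyperoct_path_group H) hyperoct_path_group"
    using H(2) by (rule generate_is_subgroup)
  have hp: "turn_path i j (2 * pi * real k) \<in> hyperoct_paths" for k
    using plane_rotation_quarters_hyperoct [OF ij, of "4 * k"]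
    by (intro turn_path_hyperoct ij) (simp add: mult.commute mult.left_commute)
  have pos: "SO_path_class (turn_path i j (2 * pi * real k)) \<in> generate hyperoct_path_group H" for k
    unfolding R_path_fourth_power [OF ij, symmetric]
    by (intro subgroup_int_pow_closed [OF sub, of _ "int (4 * k)", unfolded int_pow_int] generate.incl H)
  show ?thesis
  proof (cases "m \<ge> 0")
    case True
    then show ?thesis
      using pos [of "nat m"] by simp
  next
    case False
    then obtain k where k: "m = - int k"
      by (metis int_cases2 of_nat_0_le_iff)
    let ?t = "turn_path i j (2 * pi * real k)" and ?s = "turn_path i j (- (2 * pi * real k))"
    have hs: "?s \<in> hyperoct_paths"
      by (intro turn_path_hyperoct_neg ij hp)
    have "SO_path_class ?s \<otimes>\<^bsub>hyperoct_path_group\<^esub> SO_path_class ?t = \<one>\<^bsub>hyperoct_path_group\<^esub>"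
      using turn_path_class_add [OF ij hs hp] by (simp add: path_group_one turn_path_def [abs_def] plane_rotation_0)
    then have "inv\<^bsub>hyperoct_path_group\<^esub> (SO_path_class ?t) = SO_path_class ?s"
      using hp hs by (intro inv_equality) (auto simp: path_group_carrier)
    then show ?thesis
      using subgroup.m_inv_closed [OF sub pos [of k]] k by simp
  qed
qed

text \<open>Some positive word \<open>w\<close> has the same end-point as \<open>x\<close>. Dividing
  by \<open>w\<close> leaves a loop, hence a power of the full turn, and the full turn is the fourth
  power of the first generator.\<close>

lemma path_group_generated:
  fixes e :: "nat \<Rightarrow> 'n::finite"
  assumes n: "n \<ge> 3" and e: "bij_betw e {1..n} UNIV"
  shows "generate hyperoct_path_group (R_gen e ` {1..n - 1}) = carrier hyperoct_path_group"
proof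
  interpret hyperoct_action hyperoct_path_group "R_gen e" n endpt e
    using assms by (rule hyperoct_action_path_group)
  let ?H = "R_gen e ` {1..n - 1}"
  have H: "?H \<subseteq> carrier hyperoct_path_group"
    using r_closed by auto
  then show "generate hyperoct_path_group ?H \<subseteq> carrier hyperoct_path_group"
    using generate_in_carrier by blast
  show "carrier hyperoct_path_group \<subseteq> generate hyperoct_path_group ?H"
  proof
    fix x :: "(real \<Rightarrow> real^'n^'n) set" assume x: "x \<in> carrier hyperoct_path_group"
    obtain w where w: "w \<in> P n" "endpt w = endpt x"
      using P_surj [OF endpt_in [OF x]] by blast
    have wc: "w \<in> carrier hyperoct_path_group" and wg: "w \<in> generate hyperoct_path_group ?H"
      using P_closed P_subset_generate w by auto
    define y where "y = x \<otimes>\<^bsub>hyperoct_path_group\<^esub> inv\<^bsub>hyperoct_path_group\<^esub> w"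
    have y: "y \<in> carrier hyperoct_path_group" and xy: "x = y \<otimes>\<^bsub>hyperoct_path_group\<^esub> w"
      using x wc by (auto simp: y_def m_assoc)
    have "endpt y = endpt x ** endpt (inv\<^bsub>hyperoct_path_group\<^esub> w)"
      using x wc by (simp add: y_def endpt_mult)
    also have "\<dots> = endpt (w \<otimes>\<^bsub>hyperoct_path_group\<^esub> inv\<^bsub>hyperoct_path_group\<^esub> w)"
      unfolding w(2) [symmetric] using wc by (intro endpt_mult [symmetric]) auto
    finally have ey: "endpt y = mat 1"
      using wc by (simp add: endpt_one)
    obtain p where p: "p \<in> hyperoct_paths" "y = SO_path_class p"
      using y by (auto simp: path_group_carrier)
    have e12: "e 1 \<noteq> e 2"
      using n by (subst e_eq_iff) auto
    have "p 1 = mat 1"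
      using ey p by (simp add: endpt_class)
    then obtain m :: int where "homotopic_paths SO p (\<lambda>t. plane_rotation (e 1) (e 2) (2 * pi * m * t))"
      using SO_loop_homotopic_to_full_turns [OF e12, of p] p(1) by (auto simp: hyperoct_paths_iff)
    then have "y = SO_path_class (turn_path (e 1) (e 2) (2 * pi * of_int m))"
      unfolding p(2) turn_path_def [abs_def] by (rule SO_path_class_eq)
    moreover have "SO_path_class (R_path (e 1) (e 2)) \<in> ?H"
      using n by (auto simp: R_gen_def numeral_2_eq_2 intro!: image_eqI [of _ _ 1])
    ultimately have "y \<in> generate hyperoct_path_group ?H"
      using full_turns_in_generate [OF e12 _ H] by simp
    then show "x \<in> generate hyperoct_path_group ?H"
      unfolding xy using wg by (rule generate.eng)
  qed
qed

lemma (in hyperoct_relations) word_eval_relations: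
  assumes "(u, v) \<in> hyperoct_rels n" "u \<in> gwords {1..n - 1}" "v \<in> gwords {1..n - 1}"
  shows "word_eval G r u = word_eval G r v"
proof -
  \<comment> \<open>The relations list the commuting pairs in both orders, the locale only in
    increasing order.\<close>
  have commute: "r i \<otimes> r j = r j \<otimes> r i" if "i \<in> {1..n - 1}" "j \<in> {1..n - 1}" "\<bar>int i - int j\<bar> \<ge> 2" for i j
    using that far_commute [of i j] far_commute [of j i] n3 by (cases "i < j") auto
  have car: "r 1 \<in> carrier G" "r 2 \<in> carrier G"
    using n3 by (auto intro!: r_closed)
  from assms(1) consider (braid_rel) i where "1 \<le> i" "i \<le> n - 2" "u = gen i @ gen (i + 1) @ gen i"
      "v = gen (i + 1) @ gen i @ gen (i + 1)"
    | (far_rel) i j where "i \<in> {1..n - 1}" "j \<in> {1..n - 1}" "\<bar>int i - int j\<bar> \<ge> 2"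
      "u = gen i @ gen j" "v = gen j @ gen i"
    | (square_rel) "u = gen 1 @ gen 1" "v = gen 2 @ gen 1 @ gen 1 @ gen 2"
    unfolding hyperoct_rels_def by blast
  then show ?thesis
  proof cases
    case (braid_rel i)
    then have "1 \<le> i" "Suc i < n"
      using n3 by auto
    then show ?thesis
      using braid_rel(3,4) braid [of i] by (simp add: gen_def r_closed)
  next
    case (far_rel i j)
    then have "r i \<in> carrier G" "r j \<in> carrier G"
      using n3 by (auto intro!: r_closed)
    then show ?thesis
      using commute [OF far_rel(1-3)] far_rel(4,5) by (simp add: gen_def)
  next
    case square_rel
    then show ?thesis
      using square car by (simp add: gen_def del: One_nat_def)
  qed
qed

theorem mainTheorem2:
  fixes e :: "nat \<Rightarrow> 'n::finite" and n :: nat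
  assumes "n = CARD('n)" and "n \<ge> 3"
    and "bij_betw e {1..n} UNIV"
  shows "group (hyperoct_path_group :: (real \<Rightarrow> real^'n^'n) set monoid)
    \<and> R_gen e ` {1..n - 1} \<subseteq> carrier hyperoct_path_group
    \<and> generate hyperoct_path_group (R_gen e ` {1..n - 1}) = carrier hyperoct_path_group
    \<and> (\<exists>h \<in> iso (presented_group {1..n - 1} (hyperoct_rels n)) hyperoct_path_group.
         \<forall>i\<in>{1..n - 1}. h (presented_gen {1..n - 1} (hyperoct_rels n) i) = R_gen e i)"
proof -
  let ?H = "hyperoct_path_group :: (real \<Rightarrow> real^'n^'n) set monoid"
  define S where "S = {1..n - 1}"
  let ?F = "presented_group S (hyperoct_rels n)" and ?g = "presented_gen S (hyperoct_rels n)"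
  interpret H: hyperoct_action ?H "R_gen e" n endpt e
    using assms(2,3) by (rule hyperoct_action_path_group)
  interpret F: hyperoct_relations ?F ?g n
    using assms(2) S_def by (rule presented_hyperoct_relations)
  have sub: "R_gen e ` S \<subseteq> carrier ?H"
    using H.r_closed by (auto simp: S_def)
  have gen: "generate ?H (R_gen e ` S) = carrier ?H"
    using assms(2,3) unfolding S_def by (rule path_group_generated)
  have "\<exists>h\<in>hom ?F ?H. \<forall>i\<in>S. h (?g i) = R_gen e i"
    using sub by (rule H.presented_group_hom) (rule H.word_eval_relations [folded S_def])
  then obtain h where h: "h \<in> hom ?F ?H" "\<And>i. i \<in> S \<Longrightarrow> h (?g i) = R_gen e i"
    by blast
  interpret h: group_hom ?F ?H h
    by (intro group_hom.intro group_hom_axioms.intro F.is_group H.is_group h)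
  have carF: "carrier ?F = generate ?F (?g ` S)"
    by (rule presented_group_generated)
  have h_gens: "h ` ?g ` S = R_gen e ` S"
    unfolding image_image using h(2) by (rule image_cong [OF HOL.refl])
  have "h ` carrier ?F = carrier ?H"
  proof -
    have "?g ` S \<subseteq> carrier ?F"
      by (intro image_subsetI presented_gen_closed)
    then have "h ` generate ?F (?g ` S) = generate ?H (h ` ?g ` S)"
      by (rule h.generate_img [symmetric])
    then show ?thesis
      using carF h_gens gen by simp
  qed
  \<comment> \<open>Through \<open>h\<close> the presented group acts on the vertices, which makes
    \<open>kernel\<close> applicable to it.\<close>
  moreover interpret A: hyperoct_action ?F ?g n "\<lambda>x. endpt (h x)" e
  proof
    show "endpt (h (?g i)) = plane_rotation (e i) (e (Suc i)) (pi / 2)" if "1 \<le> i" "i < n" for i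
      using that h(2) [of i] H.M_r [of i] by (simp add: S_def)
  qed (auto simp: assms(3) H.M_mult H.M_one H.M_in simp del: One_nat_def)
  \<comment> \<open>The only topological input to injectivity: \<open>F.z\<close> is the fourth
    power of the first generator, so \<open>h\<close> sends it to the class of the full
    turn.\<close>
  have z: "h F.z \<noteq> \<one>\<^bsub>?H\<^esub>"
  proof
    assume "h F.z = \<one>\<^bsub>?H\<^esub>"
    have g1: "?g 1 \<in> carrier ?F" "h (?g 1) = R_gen e 1"
      using assms(2) h(2) [of 1] F.r_closed [of 1] by (auto simp: S_def)
    have e12: "e 1 \<noteq> e 2"
      using assms(2) by (subst H.e_eq_iff) auto
    have "F.z = ?g 1 [^]\<^bsub>?F\<^esub> (4 * 1 :: nat)"
      using g1 by (simp add: F.z_def F.sq_def numeral_eq_Suc F.m_assoc del: One_nat_def)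
    then have "h F.z = R_gen e 1 [^]\<^bsub>?H\<^esub> (4 * 1 :: nat)"
      using g1 by (simp add: h.hom_nat_pow del: One_nat_def)
    also have "\<dots> = SO_path_class (turn_path (e 1) (e 2) (2 * pi))"
      using R_path_fourth_power [OF e12, of 1] by (simp add: R_gen_def numeral_2_eq_2)
    finally have "SO_path_class (turn_path (e 1) (e 2) (2 * pi)) = SO_path_class (\<lambda>t. mat 1)"
      using \<open>h F.z = \<one>\<^bsub>?H\<^esub>\<close> by (simp add: path_group_one)
    then have "homotopic_paths SO (turn_path (e 1) (e 2) (2 * pi)) (\<lambda>t. mat 1)"
      using hyperoct_paths_one by (rule SO_path_class_eqD)
    then show False
      using full_turn_not_nullhomotopic [OF e12] by (simp add: turn_path_def [abs_def])
  qed
  have "inj_on h (carrier ?F)"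
  proof (rule h.inj_on_one_iff [THEN iffD2], intro allI impI)
    fix x assume x: "x \<in> carrier ?F" "h x = \<one>\<^bsub>?H\<^esub>"
    then have "x \<in> F.P n"
      using carF F.generate_subset_P unfolding S_def by blast
    then show "x = \<one>\<^bsub>?F\<^esub>"
      using A.kernel [of x] x(2) z by (auto simp: endpt_one)
  qed
  ultimately have "h \<in> iso ?F ?H"
    using h(1) by (simp add: iso_def bij_betw_def)
  then show ?thesis
    unfolding S_def [symmetric] using h(2) sub gen H.is_group by blast
qed

end
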